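(* Let $2\le m\le n$ and let $(P,\chi)$ be a set of linear evolution data, with $P$ a connected, nonsingular $(m-1)$-submanifold in $\mathbb R^n$. Then there exists a connected Lie subgroup $G$ of $\mathrm{GL}(n,\mathbb R)$ with Lie algebra $\mathfrak g$, such that $P$ is an open set in a $G$-orbit in $\mathbb R^n$, and $\chi$ is $G$-invariant. Furthermore, there is a natural, surjective, $G$-equivariant linear map $L:\Lambda^{m-2}(\mathbb R^n)^*\to\mathfrak g$.
   Context: A set of linear evolution data is a pair $(P,\chi)$, where $P$ is an $(m-1)$-dimensional submanifold of $\mathbb R^n$, and $\chi:\mathbb R^n\to\Lambda^{m-1}\mathbb R^n$ is a linear map such that $\chi(p)$ is a nonzero element of $\Lambda^{m-1}T_pP\subset\Lambda^{m-1}\mathbb R^n$ for each (nonsingular) point $p\in P$; moreover $P$ is not contained in any proper vector subspace of $\mathbb R^n$. $\chi$ is regarded as an element of $(\mathbb R^n)^*\otimes\Lambda^{m-1}\mathbb R^n$, on which $G\subset\mathrm{GL}(n,\mathbb R)$ acts; $G$ acts on $\mathfrak g\subset\mathfrak{gl}(n,\mathbb R)=(\mathbb R^n)^*\otimes\mathbb R^n$ by the adjoint action. The natural map meant is $L(\alpha)=\chi\cdot\alpha$, where $\cdot$ is the natural contraction $\Lambda^{m-1}\mathbb R^n\times\Lambda^{m-2}(\mathbb R^n)^*\to\mathbb R^n$. *)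

theory Defs
  imports "HOL-Analysis.Analysis" "HOL-Library.Function_Algebras"
begin

text \<open>Pointwise scalar multiplication, so that multilinear functionals (represented as
  functions on lists of vectors) form a real vector space and \<^const>\<open>span\<close> and \<^const>\<open>linear\<close>
  apply to them.\<close>

instantiation "fun" :: (type, real_vector) real_vector
begin

definition scaleR_fun :: "real \<Rightarrow> ('a \<Rightarrow> 'b) \<Rightarrow> 'a \<Rightarrow> 'b" where
  "scaleR_fun c f = (\<lambda>x. c *\<^sub>R f x)"

instance
  by standard (auto simp: scaleR_fun_def fun_eq_iff scaleR_add_right scaleR_add_left)

end


section \<open>Smooth maps and submanifolds\<close>

primrec C_k_on ::
  "nat \<Rightarrow> 'a::real_normed_vector set \<Rightarrow> ('a \<Rightarrow> 'b::real_normed_vector) \<Rightarrow> bool" where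
  "C_k_on 0 U f \<longleftrightarrow> continuous_on U f"
| "C_k_on (Suc k) U f \<longleftrightarrow>
     (\<forall>x\<in>U. f differentiable (at x)) \<and> (\<forall>v. C_k_on k U (\<lambda>x. frechet_derivative f (at x) v))"

text \<open>Only used for open \<open>U\<close>.\<close>

definition smooth_on ::
  "'a::real_normed_vector set \<Rightarrow> ('a \<Rightarrow> 'b::real_normed_vector) \<Rightarrow> bool" where
  "smooth_on U f \<longleftrightarrow> (\<forall>k. C_k_on k U f)"

definition smooth_submanifold :: "nat \<Rightarrow> 'a::euclidean_space set \<Rightarrow> bool" where
  "smooth_submanifold d M \<longleftrightarrow>
     (\<forall>p\<in>M. \<exists>U V \<phi> \<psi> (E :: 'a set).
        open U \<and> p \<in> U \<and> open V \<and>
        homeomorphism U V \<phi> \<psi> \<and> smooth_on U \<phi> \<and> smooth_on V \<psi> \<and>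
        subspace E \<and> dim E = d \<and> \<phi> ` (U \<inter> M) = V \<inter> E)"

text \<open>An injectively immersed submanifold is given by its underlying set together with its
  manifold topology, which may be finer than the subspace topology. The immersion is locally an
  embedding, and conversely the smooth structure is determined by the topology: the sets \<open>W\<close> are
  its charts, and a map into the manifold is smooth iff it is continuous for \<open>X\<close> and smooth as
  a map into the ambient space.\<close>

definition immersed_submanifold :: "nat \<Rightarrow> 'a::euclidean_space topology \<Rightarrow> bool" where
  "immersed_submanifold d X \<longleftrightarrow>
     second_countable X \<and>
     (\<forall>x\<in>topspace X. \<exists>W. openin X W \<and> x \<in> W \<and>
        smooth_submanifold d W \<and> subtopology X W = top_of_set W)"

text \<open>Velocities of smooth curves in the manifold. For an embedded submanifold \<open>M\<close>, \<open>X\<close> is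
  \<^term>\<open>top_of_set M\<close>.\<close>

definition tangent_space :: "'a::euclidean_space topology \<Rightarrow> 'a \<Rightarrow> 'a set" where
  "tangent_space X p =
     {v. \<exists>\<epsilon>>0. \<exists>\<gamma> :: real \<Rightarrow> 'a.
        continuous_map (top_of_set {-\<epsilon><..<\<epsilon>}) X \<gamma> \<and> smooth_on {-\<epsilon><..<\<epsilon>} \<gamma> \<and>
        \<gamma> 0 = p \<and> (\<gamma> has_vector_derivative v) (at 0)}"


section \<open>Lie subgroups of the general linear group\<close>

text \<open>The topology \<open>X\<close> is the intrinsic topology of the Lie subgroup \<open>topspace X\<close>. Closure under
  products and inverses is part of \<^const>\<open>continuous_map\<close>. Since multiplication and inversion
  are smooth on the ambient general linear group, their continuity for \<open>X\<close> is equivalent to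
  smoothness as maps into the immersed submanifold.\<close>

definition GL_lie_subgroup :: "(real^'n^'n) topology \<Rightarrow> bool" where
  "GL_lie_subgroup X \<longleftrightarrow>
     (\<forall>g\<in>topspace X. invertible g) \<and> mat 1 \<in> topspace X \<and>
     (\<exists>d. immersed_submanifold d X) \<and>
     continuous_map (prod_topology X X) X (\<lambda>(g, h). g ** h) \<and>
     continuous_map X X matrix_inv"

definition lie_algebra :: "(real^'n^'n) topology \<Rightarrow> (real^'n^'n) set" where
  "lie_algebra X = tangent_space X (mat 1)"


section \<open>Exterior powers\<close>

text \<open>A \<open>k\<close>-vector on \<open>\<real>\<^sup>n\<close> is represented as an alternating \<open>k\<close>-linear functional of covectors, and
  a \<open>k\<close>-covector as an alternating \<open>k\<close>-linear functional of vectors. A covector is given by its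
  row \<open>\<phi>\<close> of coefficients and sends \<open>v\<close> to \<open>\<phi> \<bullet> v\<close>, so the two kinds of functional have the same
  type and differ in the group action. Arguments are lists of length \<open>k\<close>; on lists
  of any other length a functional vanishes.\<close>

text \<open>The value of \<open>v\<^sub>1 \<and> \<dots> \<and> v\<^sub>k\<close> on \<open>\<phi>\<^sub>1, \<dots>, \<phi>\<^sub>k\<close> is the determinant of \<open>\<phi>\<^sub>i(v\<^sub>j)\<close>.\<close>

definition wedge :: "'a::euclidean_space list \<Rightarrow> 'a list \<Rightarrow> real" where
  "wedge vs = (\<lambda>\<phi>s. if length \<phi>s = length vs
     then \<Sum>\<sigma> | \<sigma> permutes {..<length vs}.
       of_int (sign \<sigma>) * (\<Prod>i<length vs. \<phi>s ! i \<bullet> vs ! \<sigma> i)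
     else 0)"

definition ext_power :: "nat \<Rightarrow> 'a::euclidean_space set \<Rightarrow> ('a list \<Rightarrow> real) set" where
  "ext_power k S = span {wedge vs | vs. length vs = k \<and> set vs \<subseteq> S}"

text \<open>Note \<open>\<phi> v* g\<close> is the covector \<open>\<phi> \<circ> g\<close>, so that
  \<open>multivector_act g (v\<^sub>1 \<and> \<dots> \<and> v\<^sub>k) = g v\<^sub>1 \<and> \<dots> \<and> g v\<^sub>k\<close>.\<close>

definition multivector_act ::
  "real^'n^'n \<Rightarrow> ((real^'n) list \<Rightarrow> real) \<Rightarrow> (real^'n) list \<Rightarrow> real" where
  "multivector_act g T = (\<lambda>\<phi>s. T (map (\<lambda>\<phi>. \<phi> v* g) \<phi>s))"

definition form_act ::
  "real^'n^'n \<Rightarrow> ((real^'n) list \<Rightarrow> real) \<Rightarrow> (real^'n) list \<Rightarrow> real" where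
  "form_act g \<alpha> = (\<lambda>vs. \<alpha> (map (\<lambda>v. matrix_inv g *v v) vs))"

text \<open>The contraction of a \<open>(k+1)\<close>-vector \<open>T\<close> with a \<open>k\<close>-form \<open>\<alpha>\<close>; in index notation
  \<open>(T \<cdot> \<alpha>)\<^sup>i = (1/k!) T(e\<^sup>i, e\<^sup>j\<^sup>1, \<dots>, e\<^sup>j\<^sup>k) \<alpha>(e\<^sub>j\<^sub>1, \<dots>, e\<^sub>j\<^sub>k)\<close>, summed over all multi-indices.\<close>

definition contraction ::
  "nat \<Rightarrow> ((real^'n) list \<Rightarrow> real) \<Rightarrow> ((real^'n) list \<Rightarrow> real) \<Rightarrow> real^'n" where
  "contraction k T \<alpha> = (\<chi> i. (1 / fact k) *
     (\<Sum>js | length js = k.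
        T (axis i 1 # map (\<lambda>j. axis j 1) js) * \<alpha> (map (\<lambda>j. axis j 1) js)))"


section \<open>Linear evolution data\<close>

definition linear_evolution_data ::
  "nat \<Rightarrow> (real^'n) set \<Rightarrow> (real^'n \<Rightarrow> (real^'n) list \<Rightarrow> real) \<Rightarrow> bool" where
  "linear_evolution_data m P \<xi> \<longleftrightarrow>
     smooth_submanifold (m - 1) P \<and>
     linear \<xi> \<and> range \<xi> \<subseteq> ext_power (m - 1) UNIV \<and>
     (\<forall>p\<in>P. \<xi> p \<in> ext_power (m - 1) (tangent_space (top_of_set P) p) \<and> \<xi> p \<noteq> 0) \<and>
     (\<forall>S. subspace S \<and> S \<noteq> UNIV \<longrightarrow> \<not> P \<subseteq> S)"

text \<open>The action on \<open>(\<real>\<^sup>n)\<^sup>* \<otimes> \<Lambda>\<^sup>k\<real>\<^sup>n\<close>, viewed as linear maps from \<open>\<real>\<^sup>n\<close> to \<open>k\<close>-vectors.\<close>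

definition evolution_act ::
  "real^'n^'n \<Rightarrow> (real^'n \<Rightarrow> (real^'n) list \<Rightarrow> real) \<Rightarrow> real^'n \<Rightarrow> (real^'n) list \<Rightarrow> real" where
  "evolution_act g \<xi> = (\<lambda>p. multivector_act g (\<xi> (matrix_inv g *v p)))"

definition evolution_map ::
  "nat \<Rightarrow> (real^'n \<Rightarrow> (real^'n) list \<Rightarrow> real) \<Rightarrow> ((real^'n) list \<Rightarrow> real) \<Rightarrow> real^'n^'n" where
  "evolution_map m \<xi> \<alpha> = matrix (\<lambda>p. contraction (m - 2) (\<xi> p) \<alpha>)"

end

theory Submission
  imports Defs
begin

text \<open>For a form \<open>\<alpha>\<close> the linear vector field \<open>x \<mapsto> L \<alpha> *v x = \<xi> x \<cdot> \<alpha>\<close> is tangent to \<open>P\<close>, and such fields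
  span every tangent space of \<open>P\<close>. On \<open>P\<close> the multivector field \<open>\<xi>\<close> is dual to a volume form, and the
  constant form \<open>\<alpha>\<close> restricts to a closed form; so \<open>L \<alpha>\<close> is divergence free and the Lie derivative
  of \<open>\<xi>\<close> along it vanishes on \<open>P\<close>. This condition is linear in the point and \<open>P\<close> spans the space, hence
  \<open>mexp (L \<alpha>)\<close> fixes \<open>\<xi>\<close>. Since \<open>L\<close> depends naturally on \<open>\<xi>\<close>, it is then equivariant under these
  exponentials, and its image \<open>A\<close> is stable under conjugation by them. The group generated by
  \<open>mexp ` A\<close> is the required Lie subgroup. It need not be closed, so its topology is finer than the
  subspace topology: points are close if they are joined by short paths of exponentials.

  Flows of the fields \<open>L \<alpha>\<close> preserve \<open>P\<close> locally by Gronwall's inequality, and since they span the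
  tangent spaces, the orbits in \<open>P\<close> are open in \<open>P\<close>. So the connected set \<open>P\<close> lies in one orbit.\<close>

section \<open>Smooth maps and the inverse function theorem\<close>

text \<open>Equivariance of \<open>L\<close> under exponentials gives the Lie algebra property of
  \<open>A\<close> in integrated form, as stability under conjugation by \<open>mexp X\<close>; the
  group is built from that form directly. The obstacle is that the group may return to a small
  ambient open set on infinitely many sheets. Hence the local coordinates \<open>Psi\<close> carry a
  coordinate transverse to \<open>A\<close> that no path of exponentials inside the chart can
  change, and a sheet is a level of it. Products of one-parameter flows (\<open>Phi\<close> in the
  group, \<open>flow\<close> on the orbit) serve as coordinates instead of the exponential of a sum:
  the product rule and conjugation suffice to differentiate them. The divergence argument is carried
  out at one point \<open>q\<close> of \<open>P\<close>, without differential forms on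
  \<open>P\<close>. A tangential derivative of \<xi> at \<open>q\<close> is known up to a factor
  \<open>a\<close> and the second derivative \<open>h\<close> of a parametrization. Symmetry of
  \<open>h\<close> does the work of closedness: it removes the derivative terms in the trace of
  \<open>L \<alpha>\<close> and also settles the components along normal covectors.\<close>

lemma C_k_on_imp_continuous_on: "C_k_on k U f \<Longrightarrow> continuous_on U f"
proof (cases k)
  case (Suc j)
  assume "C_k_on k U f"
  then have "\<forall>x\<in>U. f differentiable (at x)" using Suc by simp
  then show ?thesis
    by (meson continuous_at_imp_continuous_on differentiable_imp_continuous_within)
qed simp

lemma C_k_on_SucD: "C_k_on (Suc k) U f \<Longrightarrow> C_k_on k U f"
proof (induction k arbitrary: f)
  case 0
  then show ?case by (metis C_k_on.simps(1) C_k_on_imp_continuous_on)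
next
  case (Suc k)
  then show ?case by (metis C_k_on.simps(2))
qed

lemma C_k_on_has_derivative:
  "C_k_on (Suc k) U f \<Longrightarrow> x \<in> U \<Longrightarrow> (f has_derivative frechet_derivative f (at x)) (at x)"
  by (simp add: frechet_derivative_works)

text \<open>Openness of \<open>U\<close> matters: \<open>frechet_derivative\<close> at a point of
  \<open>U\<close> is then determined by values in \<open>U\<close>, so equality passes to the
  derivatives and the induction continues.\<close>

lemma C_k_on_cong:
  fixes f g :: "'a::real_normed_vector \<Rightarrow> 'b::real_normed_vector"
  assumes "open U" and "\<And>x. x \<in> U \<Longrightarrow> f x = g x"
  shows "C_k_on k U f \<longleftrightarrow> C_k_on k U g"
  using assms(2)
proof (induction k arbitrary: f g)
  case 0
  then show ?case by (simp cong: continuous_on_cong)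
next
  case (Suc k)
  have *: "C_k_on (Suc k) U f'"
    if eq: "\<And>x. x \<in> U \<Longrightarrow> f' x = g' x" and g': "C_k_on (Suc k) U g'" for f' g' :: "'a \<Rightarrow> 'b"
  proof -
    have d: "(f' has_derivative frechet_derivative g' (at x)) (at x)" if "x \<in> U" for x
      using C_k_on_has_derivative[OF g' that]
      by (rule has_derivative_transform_within_open) (use \<open>open U\<close> that eq in auto)
    then have fd: "frechet_derivative f' (at x) = frechet_derivative g' (at x)" if "x \<in> U" for x
      using frechet_derivative_at that by metis
    have "C_k_on k U (\<lambda>x. frechet_derivative f' (at x) v)" for v
      using Suc.IH[of "\<lambda>x. frechet_derivative f' (at x) v" "\<lambda>x. frechet_derivative g' (at x) v"]
        fd g' by simp
    then show ?thesis
      using d by (auto simp: differentiable_def)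
  qed
  show ?case using *[of f g] *[of g f] Suc.prems by metis
qed

text \<open>Lets the derivative be supplied as an explicit formula \<open>f'\<close>; most closure
  rules below work by exhibiting one.\<close>

lemma C_k_on_SucI:
  assumes "open U" and d: "\<And>x. x \<in> U \<Longrightarrow> (f has_derivative f' x) (at x)"
    and k: "\<And>v. C_k_on k U (\<lambda>x. f' x v)"
  shows "C_k_on (Suc k) U f"
proof -
  have "frechet_derivative f (at x) = f' x" if "x \<in> U" for x
    using d[OF that] frechet_derivative_at by metis
  then have "C_k_on k U (\<lambda>x. frechet_derivative f (at x) v)" for v
    using k[of v] C_k_on_cong[OF \<open>open U\<close>, of "\<lambda>x. frechet_derivative f (at x) v" "\<lambda>x. f' x v"]
    by simp
  then show ?thesis
    using d by (auto simp: differentiable_def)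
qed

lemma C_k_on_const: "open U \<Longrightarrow> C_k_on k U (\<lambda>x. c)"
proof (induction k arbitrary: c)
  case (Suc k)
  show ?case
    by (rule C_k_on_SucI[where f' = "\<lambda>_ _. 0"]) (use Suc in auto)
qed simp

lemma C_k_on_bounded_linear:
  assumes "open U" and "bounded_linear f"
  shows "C_k_on k U f"
proof (cases k)
  case 0
  then show ?thesis using assms linear_continuous_on by auto
next
  case (Suc j)
  have "C_k_on (Suc j) U f"
    by (rule C_k_on_SucI[where f' = "\<lambda>_. f"])
      (use assms in \<open>auto intro: C_k_on_const bounded_linear_imp_has_derivative\<close>)
  then show ?thesis using Suc by simp
qed

lemma C_k_on_linear_compose:
  assumes "open U" and "bounded_linear h" and "C_k_on k U f"
  shows "C_k_on k U (\<lambda>x. h (f x))"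
  using assms(3)
proof (induction k arbitrary: f)
  case 0
  then show ?case
    by (simp add: assms(2) bounded_linear.continuous_on)
next
  case (Suc k)
  show ?case
  proof (rule C_k_on_SucI[where f' = "\<lambda>x v. h (frechet_derivative f (at x) v)"])
    show "((\<lambda>x. h (f x)) has_derivative (\<lambda>v. h (frechet_derivative f (at x) v))) (at x)"
      if "x \<in> U" for x
      using C_k_on_has_derivative[OF Suc.prems that]
      by (rule bounded_linear.has_derivative[OF assms(2)])
  qed (use assms Suc in auto)
qed

lemma C_k_on_add:
  assumes "open U" and "C_k_on k U f" and "C_k_on k U g"
  shows "C_k_on k U (\<lambda>x. f x + g x)"
  using assms(2,3)
proof (induction k arbitrary: f g)
  case 0
  then show ?case by (auto intro: continuous_on_add)
next
  case (Suc k)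
  show ?case
  proof (rule C_k_on_SucI[where
        f' = "\<lambda>x v. frechet_derivative f (at x) v + frechet_derivative g (at x) v"])
    show "((\<lambda>x. f x + g x) has_derivative
        (\<lambda>v. frechet_derivative f (at x) v + frechet_derivative g (at x) v)) (at x)"
      if "x \<in> U" for x
      using Suc.prems that by (intro has_derivative_add C_k_on_has_derivative)
  qed (use assms Suc in auto)
qed

lemma C_k_on_sum:
  assumes "open U" and "\<And>i. i \<in> I \<Longrightarrow> C_k_on k U (f i)"
  shows "C_k_on k U (\<lambda>x. \<Sum>i\<in>I. f i x)"
  using assms(2)
  by (induction I rule: infinite_finite_induct)
    (auto intro: C_k_on_const C_k_on_add assms(1))

lemma C_k_on_bilinear:
  assumes "open U" and "bounded_bilinear B" and "C_k_on k U f" and "C_k_on k U g"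
  shows "C_k_on k U (\<lambda>x. B (f x) (g x))"
  using assms(3,4)
proof (induction k arbitrary: f g)
  case 0
  then show ?case
    by (auto intro: bounded_bilinear.continuous_on[OF assms(2)])
next
  case (Suc k)
  show ?case
  proof (rule C_k_on_SucI[where
        f' = "\<lambda>x v. B (f x) (frechet_derivative g (at x) v)
          + B (frechet_derivative f (at x) v) (g x)"])
    show "((\<lambda>x. B (f x) (g x)) has_derivative
        (\<lambda>v. B (f x) (frechet_derivative g (at x) v)
          + B (frechet_derivative f (at x) v) (g x))) (at x)"
      if "x \<in> U" for x
      using Suc.prems that
      by (intro bounded_bilinear.FDERIV[OF assms(2)] C_k_on_has_derivative)
    show "C_k_on k U (\<lambda>x. B (f x) (frechet_derivative g (at x) v)
          + B (frechet_derivative f (at x) v) (g x))" for v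
      using Suc.prems C_k_on_SucD[OF Suc.prems(1)] C_k_on_SucD[OF Suc.prems(2)]
      by (intro C_k_on_add assms Suc.IH) auto
  qed (use assms in auto)
qed

text \<open>The chain rule differentiates \<open>f\<close> in a direction that varies with the
  point, whereas \<open>C_k_on\<close> speaks of fixed directions. Expanding the direction in
  \<open>Basis\<close> leaves a sum of products to which the induction hypothesis applies.\<close>

lemma C_k_on_compose:
  fixes f :: "'b::euclidean_space \<Rightarrow> 'c::real_normed_vector"
    and g :: "'a::real_normed_vector \<Rightarrow> 'b"
  assumes "open U" and "open V" and "g ` U \<subseteq> V" and "C_k_on k U g" and "C_k_on k V f"
  shows "C_k_on k U (\<lambda>x. f (g x))"
  using assms(4,5)
proof (induction k arbitrary: f)
  case 0
  then show ?case
    using assms(3) continuous_on_compose2 by (metis C_k_on.simps(1))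
next
  case (Suc k)
  let ?f' = "\<lambda>x v. \<Sum>b\<in>Basis. (frechet_derivative g (at x) v \<bullet> b) *\<^sub>R
    frechet_derivative f (at (g x)) b"
  show ?case
  proof (rule C_k_on_SucI[where f' = ?f'])
    show "((\<lambda>x. f (g x)) has_derivative ?f' x) (at x)" if "x \<in> U" for x
    proof -
      have gx: "g x \<in> V" using that assms(3) by auto
      have df: "(f has_derivative frechet_derivative f (at (g x))) (at (g x))"
        using Suc.prems(2) gx by (rule C_k_on_has_derivative)
      have dg: "(g has_derivative frechet_derivative g (at x)) (at x)"
        using Suc.prems(1) that by (rule C_k_on_has_derivative)
      have "frechet_derivative f (at (g x)) (frechet_derivative g (at x) v) = ?f' x v" for v
      proof -
        interpret linear "frechet_derivative f (at (g x))"
          using df has_derivative_linear by blast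
        have "frechet_derivative f (at (g x)) (frechet_derivative g (at x) v) =
          frechet_derivative f (at (g x))
            (\<Sum>b\<in>Basis. (frechet_derivative g (at x) v \<bullet> b) *\<^sub>R b)"
          by (simp add: euclidean_representation)
        then show ?thesis by (simp add: sum scale)
      qed
      then have "(\<lambda>v. frechet_derivative f (at (g x)) (frechet_derivative g (at x) v)) = ?f' x" ..
      then show ?thesis
        using has_derivative_compose[OF dg df] by metis
    qed
    show "C_k_on k U (\<lambda>x. ?f' x v)" for v
    proof (intro C_k_on_sum C_k_on_bilinear[OF _ bounded_bilinear_scaleR] assms)
      fix b :: 'b assume "b \<in> Basis"
      show "C_k_on k U (\<lambda>x. frechet_derivative g (at x) v \<bullet> b)"
        using Suc.prems
        by (intro C_k_on_linear_compose[where h = "\<lambda>y. y \<bullet> b"] assms bounded_linear_inner_left) simp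
      show "C_k_on k U (\<lambda>x. frechet_derivative f (at (g x)) b)"
        using Suc.prems(2) by (intro Suc.IH[OF C_k_on_SucD[OF Suc.prems(1)]]) simp
    qed
  qed (use assms in auto)
qed

lemma C_k_on_subset: "C_k_on k U f \<Longrightarrow> V \<subseteq> U \<Longrightarrow> C_k_on k V f"
  by (induction k arbitrary: f) (auto intro: continuous_on_subset)

text \<open>Since \<open>f x = 0\<close>, \<open>f y\<close> is of the order of
  \<open>norm (y - x)\<close>, so continuity of \<open>g\<close> already makes
  \<open>f y *\<^sub>R (g y - g x)\<close> of smaller order. This differentiates the inverse
  Jacobian below at a stage where only its continuity is known.\<close>

lemma has_derivative_mult_vanishing:
  fixes f :: "'a::real_normed_vector \<Rightarrow> real" and g :: "'a \<Rightarrow> 'b::real_normed_vector"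
  assumes f: "(f has_derivative f') (at x)" and "f x = 0" and g: "isCont g x"
  shows "((\<lambda>y. f y *\<^sub>R g y) has_derivative (\<lambda>h. f' h *\<^sub>R g x)) (at x)"
proof -
  have bl: "bounded_linear f'" using f by (rule has_derivative_bounded_linear)
  have "((\<lambda>y. f y *\<^sub>R (g y - g x)) has_derivative (\<lambda>h. 0)) (at x)"
    unfolding has_derivative_at_within
  proof (intro conjI)
    obtain K where K: "K > 0" "\<And>h. norm (f' h) \<le> norm h * K"
      using bounded_linear.pos_bounded[OF bl] by blast
    have rem: "((\<lambda>y. (f y - f x - f' (y - x)) /\<^sub>R norm (y - x)) \<longlongrightarrow> 0) (at x)"
      using f unfolding has_derivative_at_within by auto
    have bound: "\<forall>\<^sub>F y in at x. norm (f y / norm (y - x)) \<le> 1 + K"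
    proof -
      have "\<forall>\<^sub>F y in at x. norm ((f y - f x - f' (y - x)) /\<^sub>R norm (y - x)) < 1"
        using tendstoD[OF rem, of 1] by simp
      then show ?thesis
      proof (rule eventually_mp[rotated], intro eventuallyI impI)
        fix y assume a: "norm ((f y - f x - f' (y - x)) /\<^sub>R norm (y - x)) < 1"
        show "norm (f y / norm (y - x)) \<le> 1 + K"
        proof (cases "y = x")
          case False
          then have n: "norm (y - x) > 0" by simp
          have "\<bar>f y - f' (y - x)\<bar> < norm (y - x)"
            using a n \<open>f x = 0\<close> by (simp add: field_simps)
          moreover have "\<bar>f' (y - x)\<bar> \<le> norm (y - x) * K" using K(2)[of "y - x"] by simp
          ultimately have "\<bar>f y\<bar> \<le> norm (y - x) * (1 + K)" by (simp add: algebra_simps)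
          then show ?thesis using n by (simp add: field_simps)
        qed (use K in simp)
      qed
    qed
    have "((\<lambda>y. (1 + K) * norm (g y - g x)) \<longlongrightarrow> 0) (at x)"
      using g by (intro tendsto_mult_right_zero tendsto_norm_zero) (simp add: isCont_def LIM_zero)
    then have "((\<lambda>y. (f y / norm (y - x)) *\<^sub>R (g y - g x)) \<longlongrightarrow> 0) (at x)"
    proof (rule Lim_null_comparison[rotated])
      show "\<forall>\<^sub>F y in at x. norm ((f y / norm (y - x)) *\<^sub>R (g y - g x)) \<le> (1 + K) * norm (g y - g x)"
        using bound by eventually_elim (simp only: norm_scaleR real_norm_def, rule mult_right_mono, auto)
    qed
    then show "((\<lambda>y. (f y *\<^sub>R (g y - g x) - f x *\<^sub>R (g x - g x) - 0) /\<^sub>R norm (y - x)) \<longlongrightarrow> 0) (at x)"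
      by (simp add: \<open>f x = 0\<close> divide_inverse mult.commute)
  qed simp
  moreover have "((\<lambda>y. f y *\<^sub>R g x) has_derivative (\<lambda>h. f' h *\<^sub>R g x)) (at x)"
    using f by (rule has_derivative_scaleR_left)
  ultimately have "((\<lambda>y. f y *\<^sub>R (g y - g x) + f y *\<^sub>R g x) has_derivative (\<lambda>h. 0 + f' h *\<^sub>R g x)) (at x)"
    by (rule has_derivative_add)
  then show ?thesis by (simp add: scaleR_diff_right)
qed


text \<open>For \<open>w = J z v - J y v\<close> one has
  \<open>A z w = - ((A z - A y) (J y v))\<close>, so \<open>w\<close> is small once the inverse of
  \<open>A z\<close> is bounded near \<open>y\<close>. The bound comes from comparing with
  \<open>A y\<close>: the distance \<open>1 / (2 * M)\<close> lets half of \<open>norm w\<close> be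
  absorbed.\<close>

lemma tendsto_inverse_blinfun:
  fixes A :: "'b::topological_space \<Rightarrow> ('a::real_normed_vector \<Rightarrow>\<^sub>L 'a)"
  assumes A: "(A \<longlongrightarrow> A y) (at y)"
    and V: "open V" "y \<in> V"
    and inv: "\<And>z u. z \<in> V \<Longrightarrow> J z (A z u) = u" "\<And>z u. z \<in> V \<Longrightarrow> A z (J z u) = u"
    and lin: "bounded_linear (J y)"
  shows "((\<lambda>z. J z v) \<longlongrightarrow> J y v) (at y)"
proof -
  obtain M where M: "M > 0" "\<And>u. norm (J y u) \<le> norm u * M"
    using bounded_linear.pos_bounded[OF lin] by blast
  have "\<forall>\<^sub>F z in at y. dist (A z) (A y) < 1 / (2 * M)"
    using tendstoD[OF A, of "1 / (2 * M)"] M by simp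
  moreover have "\<forall>\<^sub>F z in at y. z \<in> V"
    using V by (simp add: eventually_at_topological) blast
  ultimately have "\<forall>\<^sub>F z in at y. norm (J z v - J y v) \<le> (2 * M * norm (J y v)) * norm (A z - A y)"
  proof eventually_elim
    case (elim z)
    define w where "w = J z v - J y v"
    have eq: "A z w = - ((A z - A y) (J y v))"
      using elim inv V by (simp add: w_def blinfun.diff_right blinfun.diff_left)
    have "norm w = norm (J y (A y w))" using inv V by simp
    also have "\<dots> \<le> norm (A y w) * M" by (rule M)
    also have "A y w = A z w - (A z - A y) w" by (simp add: blinfun.diff_left)
    also have "norm \<dots> \<le> norm (A z w) + norm (A z - A y) * norm w"
      using norm_triangle_ineq4[of "A z w" "(A z - A y) w"] norm_blinfun[of "A z - A y" w] by linarith
    also have "\<dots> \<le> norm (A z w) + 1 / (2 * M) * norm w"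
      using elim by (intro add_mono mult_right_mono) (auto simp: dist_norm)
    finally have "norm w \<le> norm (A z w) * M + norm w / 2"
      using M by (simp add: field_simps)
    then have "norm w \<le> 2 * M * norm (A z w)" by (simp add: field_simps)
    also have "norm (A z w) \<le> norm (A z - A y) * norm (J y v)"
      unfolding eq norm_minus_cancel by (rule norm_blinfun)
    finally show ?case using M by (simp add: w_def mult_ac)
  qed
  moreover have "((\<lambda>z. (2 * M * norm (J y v)) * norm (A z - A y)) \<longlongrightarrow> 0) (at y)"
    using A by (intro tendsto_mult_right_zero tendsto_norm_zero) (simp add: LIM_zero)
  ultimately have "((\<lambda>z. J z v - J y v) \<longlongrightarrow> 0) (at y)"
    by (rule Lim_null_comparison)
  then show ?thesis by (rule LIM_zero_cancel)
qed

text \<open>\<open>inverse_function_theorem\<close> supplies a differentiable inverse; the work is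
  in bootstrapping its smoothness. The derivative at \<open>x0\<close> is normalised to the
  identity, as is the case for the coordinate map \<open>Psi\<close>.\<close>

theorem smooth_inverse_function:
  fixes f :: "'a::euclidean_space \<Rightarrow> 'a"
  assumes U: "open U" "x0 \<in> U" and f: "smooth_on U f"
    and id: "(f has_derivative (\<lambda>h. h)) (at x0)"
  obtains U' V g where "open U'" "U' \<subseteq> U" "x0 \<in> U'" "open V" "homeomorphism U' V f g"
    "smooth_on V g"
proof -
  have fk: "C_k_on k U f" for k using f by (simp add: smooth_on_def)
  define f' where "f' x = Blinfun (frechet_derivative f (at x))" for x
  have der: "(f has_derivative frechet_derivative f (at x)) (at x)" if "x \<in> U" for x
    using fk[of 1] that C_k_on_has_derivative by (metis One_nat_def)
  have f'_apply: "blinfun_apply (f' x) = frechet_derivative f (at x)" if "x \<in> U" for x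
    using der[OF that] unfolding f'_def by (intro bounded_linear_Blinfun_apply has_derivative_bounded_linear)
  have Dk: "C_k_on k U (\<lambda>x. frechet_derivative f (at x) v)" for k v
    using fk[of "Suc k"] by simp
  have contf: "continuous_on U f'"
  proof (rule continuous_on_blinfun_componentwise)
    fix i :: 'a
    show "continuous_on U (\<lambda>x. f' x i)"
      using Dk[of 0 i] by (simp add: f'_apply cong: continuous_on_cong)
  qed
  have "f' x0 = id_blinfun"
    using frechet_derivative_at[OF id] f'_apply[OF U(2)] by (intro blinfun_eqI) (metis blinfun_apply_id_blinfun id_apply)
  then have inv0: "id_blinfun o\<^sub>L f' x0 = id_blinfun"
    by (simp add: blinfun_eqI)
  have derf': "(f has_derivative blinfun_apply (f' x)) (at x)" if "x \<in> U" for x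
    using der[OF that] f'_apply[OF that] by simp
  obtain U' V g g' where ob: "open U'" "U' \<subseteq> U" "x0 \<in> U'" "open V" "homeomorphism U' V f g"
    and g: "\<And>y. y \<in> V \<Longrightarrow> (g has_derivative (g' y)) (at y)"
    and g': "\<And>y. y \<in> V \<Longrightarrow> g' y = inv (blinfun_apply (f'(g y)))"
    and bij: "\<And>y. y \<in> V \<Longrightarrow> bij (blinfun_apply (f'(g y)))"
    apply (rule inverse_function_theorem[OF U(1) derf' contf U(2) inv0])
     apply assumption
    subgoal premises p by (rule p(1)[OF p(2-5,7-10)])
    done
  have gU: "g y \<in> U" if "y \<in> V" for y
    using ob(2,5) that by (auto simp: homeomorphism_def)
  define A where "A y = f' (g y)" for y
  have inv: "g' y (A y u) = u" "A y (g' y u) = u" if "y \<in> V" for y u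
    using g'[OF that] bij[OF that] by (auto simp: A_def bij_is_inj bij_is_surj surj_f_inv_f)
  have blg: "bounded_linear (g' y)" if "y \<in> V" for y
    using g[OF that] by (rule has_derivative_bounded_linear)
  have contg: "continuous_on V g"
    using ob(5) by (simp add: homeomorphism_def)
  have contJ: "continuous_on V (\<lambda>y. g' y v)" for v
  proof -
    have cA: "continuous_on V A"
      unfolding A_def by (rule continuous_on_compose2[OF contf contg]) (use gU in auto)
    have "((\<lambda>z. g' z v) \<longlongrightarrow> g' y v) (at y)" if y: "y \<in> V" for y
    proof (rule tendsto_inverse_blinfun[where J = g' and A = A, OF _ ob(4) y inv blg[OF y]])
      show "(A \<longlongrightarrow> A y) (at y)"
        using cA ob(4) y by (simp add: continuous_on_eq_continuous_at isCont_def)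
    qed
    then show ?thesis
      using ob(4) by (simp add: continuous_on_eq_continuous_at isCont_def)
  qed
  \<comment> \<open>\<open>g\<close> and its Jacobian \<open>g'\<close> advance together:
    \<open>g'\<close> of class \<open>k\<close> gives \<open>g\<close> of class
    \<open>Suc k\<close>, then the coefficients \<open>G\<close> of \<open>A\<close> are of class
    \<open>Suc k\<close>, and these give the same for \<open>g'\<close>.\<close>
  have step: "C_k_on k V g \<and> (\<forall>v. C_k_on k V (\<lambda>y. g' y v))" for k
  proof (induction k)
    case 0
    then show ?case using contg contJ by simp
  next
    case (Suc k)
    have gS: "C_k_on (Suc k) V g"
      by (rule C_k_on_SucI[OF ob(4) g]) (use Suc in auto)
    define G where "G b c y = frechet_derivative f (at (g y)) b \<bullet> c" for b c y
    have GS: "C_k_on (Suc k) V (G b c)" for b c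
      unfolding G_def
      by (intro C_k_on_linear_compose[where h = "\<lambda>y. y \<bullet> c"] bounded_linear_inner_left
          C_k_on_compose[where f = "\<lambda>x. frechet_derivative f (at x) b", OF ob(4) U(1) _ gS Dk] ob(4))
         (use gU in auto)
    define J' where "J' v y h = - (\<Sum>c\<in>Basis. (\<Sum>b\<in>Basis. (g' y v \<bullet> b) * frechet_derivative (G b c) (at y) h)
        *\<^sub>R g' y c)" for v y h
    have "C_k_on (Suc k) V (\<lambda>y. g' y v)" for v
    proof (rule C_k_on_SucI[OF ob(4), where f' = "J' v"])
      fix y assume y: "y \<in> V"
      define w where "w c z = (\<Sum>b\<in>Basis. (g' y v \<bullet> b) * (G b c z - G b c y))" for c z
      have w: "w c z = (A z (g' y v) - v) \<bullet> c" if z: "z \<in> V" for c z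
      proof -
        have *: "A x u \<bullet> c = (\<Sum>b\<in>Basis. (u \<bullet> b) * G b c x)" if x: "x \<in> V" for x u
        proof -
          have "A x u \<bullet> c = blinfun_apply (A x) (\<Sum>b\<in>Basis. (u \<bullet> b) *\<^sub>R b) \<bullet> c"
            by (simp add: euclidean_representation)
          also have "\<dots> = (\<Sum>b\<in>Basis. (u \<bullet> b) * (A x b \<bullet> c))"
            by (simp only: blinfun.sum_right blinfun.scaleR_right inner_sum_left inner_scaleR_left)
          also have "\<dots> = (\<Sum>b\<in>Basis. (u \<bullet> b) * G b c x)"
            using f'_apply[OF gU[OF x]] by (simp add: G_def A_def)
          finally show ?thesis .
        qed
        show ?thesis
          using *[OF z, of "g' y v"] *[OF y, of "g' y v"] inv(2)[OF y, of v]
          by (simp add: w_def right_diff_distrib sum_subtractf inner_diff_left)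
      qed
      \<comment> \<open>With composition of operators understood, this is
        \<open>g' z - g' y = - g' z (A z - A y) g' y\<close> for fixed \<open>y\<close>. The factor
        \<open>w c z\<close> vanishes at \<open>z = y\<close>, so
        \<open>has_derivative_mult_vanishing\<close> asks no more of \<open>g'\<close> than
        continuity.\<close>
      have rep: "g' y v - (\<Sum>c\<in>Basis. w c z *\<^sub>R g' z c) = g' z v" if z: "z \<in> V" for z
      proof -
        interpret linear "g' z" using blg[OF z] by (rule bounded_linear.linear)
        have "(\<Sum>c\<in>Basis. w c z *\<^sub>R g' z c) = g' z (\<Sum>c\<in>Basis. ((A z (g' y v) - v) \<bullet> c) *\<^sub>R c)"
          by (simp add: w[OF z] linear_sum[OF linear_axioms] linear_scale[OF linear_axioms])
        also have "\<dots> = g' z (A z (g' y v) - v)" by (simp add: euclidean_representation)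
        also have "\<dots> = g' y v - g' z v"
          using inv(1)[OF z] by (simp add: linear_diff[OF linear_axioms])
        finally show ?thesis by simp
      qed
      have "((\<lambda>z. g' y v - (\<Sum>c\<in>Basis. w c z *\<^sub>R g' z c)) has_derivative
          (\<lambda>h. 0 - (\<Sum>c\<in>Basis. (\<Sum>b\<in>Basis. (g' y v \<bullet> b) * (frechet_derivative (G b c) (at y) h - 0))
             *\<^sub>R g' y c))) (at y)"
      proof (intro has_derivative_diff has_derivative_const has_derivative_sum has_derivative_mult_vanishing)
        fix c :: 'a assume "c \<in> Basis"
        show "(w c has_derivative
            (\<lambda>h. \<Sum>b\<in>Basis. (g' y v \<bullet> b) * (frechet_derivative (G b c) (at y) h - 0))) (at y)"
          unfolding w_def
          by (intro has_derivative_sum has_derivative_mult_right has_derivative_diff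
              has_derivative_const C_k_on_has_derivative[OF GS y])
        show "w c y = 0" by (simp add: w_def)
        show "isCont (\<lambda>z. g' z c) y"
          using contJ[of c] ob(4) y by (simp add: continuous_on_eq_continuous_at)
      qed
      then show "((\<lambda>y. g' y v) has_derivative J' v y) (at y)"
        unfolding J'_def diff_0 diff_zero
        by (rule has_derivative_transform_within_open[OF _ ob(4) y]) (rule rep)
    next
      fix h
      show "C_k_on k V (\<lambda>y. J' v y h)"
        unfolding J'_def
      proof (intro C_k_on_linear_compose[where h = uminus] bounded_linear_minus bounded_linear_ident
          C_k_on_sum C_k_on_bilinear[OF _ bounded_bilinear_scaleR] C_k_on_bilinear[OF _ bounded_bilinear_mult] ob(4))
        show "C_k_on k V (\<lambda>y. g' y v \<bullet> b)" for b
          using Suc by (intro C_k_on_linear_compose[where h = "\<lambda>y. y \<bullet> b"] bounded_linear_inner_left ob(4)) auto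
        show "C_k_on k V (\<lambda>y. frechet_derivative (G b c) (at y) h)" for b c
          using GS by simp
        show "C_k_on k V (\<lambda>y. g' y c)" for c using Suc by auto
      qed
    qed
    then show ?case using gS by auto
  qed
  then have "smooth_on V g" by (simp add: smooth_on_def)
  with ob that show ?thesis by blast
qed

text \<open>The mean value theorem, used in direction \<open>v\<close> on a difference in direction
  \<open>w\<close> and then in direction \<open>w\<close>, turns the quotient into the mixed
  derivative at some point of the parallelogram; continuity of that derivative gives the
  limit.\<close>

lemma second_difference_tendsto:
  fixes f :: "'a::real_normed_vector \<Rightarrow> real"
  assumes "open U" and z: "z \<in> U" and f: "C_k_on (Suc (Suc 0)) U f"
  shows "((\<lambda>t. (f (z + t *\<^sub>R v + t *\<^sub>R w) - f (z + t *\<^sub>R v) - f (z + t *\<^sub>R w) + f z) / (t * t))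
     \<longlongrightarrow> frechet_derivative (\<lambda>x. frechet_derivative f (at x) v) (at z) w) (at_right 0)"
proof (rule tendstoI)
  fix e :: real assume "e > 0"
  define D where "D x = frechet_derivative f (at x) v" for x
  define DD where "DD x = frechet_derivative D (at x) w" for x
  have f1: "(f has_derivative frechet_derivative f (at x)) (at x)" if "x \<in> U" for x
    using f that by (rule C_k_on_has_derivative)
  have D: "C_k_on (Suc 0) U D" using f unfolding D_def by simp
  have D1: "(D has_derivative frechet_derivative D (at x)) (at x)" if "x \<in> U" for x
    using D that by (rule C_k_on_has_derivative)
  have "continuous_on U DD" using D unfolding DD_def by simp
  then have "isCont DD z" using assms by (simp add: continuous_on_eq_continuous_at)
  then obtain d1 where d1: "d1 > 0" "\<And>x. dist x z < d1 \<Longrightarrow> dist (DD x) (DD z) < e"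
    using \<open>e > 0\<close> unfolding continuous_at_eps_delta by meson
  obtain d2 where d2: "d2 > 0" "\<And>x. dist x z < d2 \<Longrightarrow> x \<in> U"
    using \<open>open U\<close> z by (metis open_dist)
  \<comment> \<open>For \<open>t < d\<close> the parallelogram with sides
    \<open>t *\<^sub>R v\<close> and \<open>t *\<^sub>R w\<close> stays within
    \<open>min d1 d2\<close> of \<open>z\<close>; the summand 1 keeps the denominator
    positive.\<close>
  define d where "d = min d1 d2 / (norm v + norm w + 1)"
  have "d > 0" using d1 d2 by (simp add: d_def add_nonneg_pos)
  have near: "dist (z + s *\<^sub>R v + r *\<^sub>R w) z < min d1 d2" if "0 \<le> s" "s \<le> t" "0 \<le> r" "r \<le> t" "t < d" for s r t
  proof -
    have "norm (s *\<^sub>R v + r *\<^sub>R w) \<le> s * norm v + r * norm w"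
      using norm_triangle_ineq[of "s *\<^sub>R v" "r *\<^sub>R w"] that by simp
    also have "\<dots> \<le> t * norm v + t * norm w"
      using that by (intro add_mono mult_right_mono) auto
    also have "\<dots> \<le> t * (norm v + norm w + 1)" using that by (simp add: algebra_simps)
    also have "\<dots> < d * (norm v + norm w + 1)"
      using that by (intro mult_strict_right_mono) (auto simp: add_nonneg_pos)
    also have "\<dots> = min d1 d2"
    proof -
      have "norm v + norm w + 1 \<noteq> 0" using norm_ge_zero[of v] norm_ge_zero[of w] by linarith
      then show ?thesis unfolding d_def by simp
    qed
    finally show ?thesis by (simp add: dist_norm add.assoc)
  qed
  have inU: "z + s *\<^sub>R v + r *\<^sub>R w \<in> U" if "0 \<le> s" "s \<le> t" "0 \<le> r" "r \<le> t" "t < d" for s r t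
    using near[OF that] d2 by simp
  have "dist ((f (z + t *\<^sub>R v + t *\<^sub>R w) - f (z + t *\<^sub>R v) - f (z + t *\<^sub>R w) + f z) / (t * t)) (DD z) < e"
    if t: "0 < t" "t < d" for t
  proof -
    define \<phi> where "\<phi> s = f (z + s *\<^sub>R v + t *\<^sub>R w) - f (z + s *\<^sub>R v)" for s
    have "\<exists>s. 0 < s \<and> s < t \<and> \<phi> t - \<phi> 0 = (t - 0) * (D (z + s *\<^sub>R v + t *\<^sub>R w) - D (z + s *\<^sub>R v))"
    proof (rule MVT2[OF t(1)])
      fix s assume s: "0 \<le> s" "s \<le> t"
      have 1: "((\<lambda>s. f (z + s *\<^sub>R v + r *\<^sub>R w)) has_derivative
          (\<lambda>h. frechet_derivative f (at (z + s *\<^sub>R v + r *\<^sub>R w)) (h *\<^sub>R v))) (at s)"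
        if r: "0 \<le> r" "r \<le> t" for r
        by (rule has_derivative_compose[where f = "\<lambda>s. z + s *\<^sub>R v + r *\<^sub>R w", OF _ f1[OF inU[OF s r t(2)]]])
           (auto intro!: derivative_eq_intros)
      have lin: "linear (frechet_derivative f (at x))" if "x \<in> U" for x
        using f1[OF that] has_derivative_linear by blast
      have "((\<lambda>s. f (z + s *\<^sub>R v + r *\<^sub>R w)) has_real_derivative D (z + s *\<^sub>R v + r *\<^sub>R w)) (at s)"
        if r: "0 \<le> r" "r \<le> t" for r
        using 1[OF r] linear_scale[OF lin[OF inU[OF s r t(2)]]]
        by (simp add: has_field_derivative_def D_def mult_commute_abs)
      from DERIV_diff[OF this[of t] this[of 0]] show
        "(\<phi> has_real_derivative (D (z + s *\<^sub>R v + t *\<^sub>R w) - D (z + s *\<^sub>R v))) (at s)"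
        using t unfolding \<phi>_def by simp
    qed
    then obtain s where s: "0 < s" "s < t"
      and 1: "\<phi> t - \<phi> 0 = t * (D (z + s *\<^sub>R v + t *\<^sub>R w) - D (z + s *\<^sub>R v))" by auto
    have "\<exists>r. 0 < r \<and> r < t \<and> D (z + s *\<^sub>R v + t *\<^sub>R w) - D (z + s *\<^sub>R v + 0 *\<^sub>R w) =
       (t - 0) * DD (z + s *\<^sub>R v + r *\<^sub>R w)"
    proof (rule MVT2[OF t(1)])
      fix r assume r: "0 \<le> r" "r \<le> t"
      have U: "z + s *\<^sub>R v + r *\<^sub>R w \<in> U" using inU[of s t r] s r t by simp
      have 1: "((\<lambda>r. D (z + s *\<^sub>R v + r *\<^sub>R w)) has_derivative
          (\<lambda>h. frechet_derivative D (at (z + s *\<^sub>R v + r *\<^sub>R w)) (h *\<^sub>R w))) (at r)"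
        by (rule has_derivative_compose[where f = "\<lambda>r. z + s *\<^sub>R v + r *\<^sub>R w", OF _ D1[OF U]]) (auto intro!: derivative_eq_intros)
      have "linear (frechet_derivative D (at (z + s *\<^sub>R v + r *\<^sub>R w)))"
        using D1[OF U] has_derivative_linear by blast
      then show "((\<lambda>r. D (z + s *\<^sub>R v + r *\<^sub>R w)) has_real_derivative DD (z + s *\<^sub>R v + r *\<^sub>R w)) (at r)"
        using 1 by (simp add: has_field_derivative_def DD_def linear_scale mult_commute_abs)
    qed
    then obtain r where r: "0 < r" "r < t"
      and 2: "D (z + s *\<^sub>R v + t *\<^sub>R w) - D (z + s *\<^sub>R v) = t * DD (z + s *\<^sub>R v + r *\<^sub>R w)" by auto
    have "f (z + t *\<^sub>R v + t *\<^sub>R w) - f (z + t *\<^sub>R v) - f (z + t *\<^sub>R w) + f z = \<phi> t - \<phi> 0"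
      by (simp add: \<phi>_def)
    then have "(f (z + t *\<^sub>R v + t *\<^sub>R w) - f (z + t *\<^sub>R v) - f (z + t *\<^sub>R w) + f z) / (t * t)
       = DD (z + s *\<^sub>R v + r *\<^sub>R w)"
      using 1 2 t by simp
    then show ?thesis
      using d1(2)[of "z + s *\<^sub>R v + r *\<^sub>R w"] near[of s t r] s r t by simp
  qed
  then show "\<forall>\<^sub>F t in at_right 0. dist ((f (z + t *\<^sub>R v + t *\<^sub>R w) - f (z + t *\<^sub>R v) - f (z + t *\<^sub>R w) + f z) / (t * t))
     (frechet_derivative (\<lambda>x. frechet_derivative f (at x) v) (at z) w) < e"
    using \<open>d > 0\<close> unfolding eventually_at_right_field DD_def D_def by blast
qed

lemma frechet_derivative_inner:
  assumes "(f has_derivative f') (at x)"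
  shows "frechet_derivative (\<lambda>x. f x \<bullet> b) (at x) v = f' v \<bullet> b"
  using frechet_derivative_at[OF has_derivative_inner_left[OF assms, of b]] by metis

text \<open>The second difference quotient is symmetric in \<open>v\<close> and \<open>w\<close>, so
  both mixed derivatives are its limit; vector values are treated by components.\<close>

lemma mixed_derivatives_commute:
  fixes f :: "'a::real_normed_vector \<Rightarrow> 'b::euclidean_space"
  assumes "open U" and z: "z \<in> U" and f: "C_k_on (Suc (Suc 0)) U f"
  shows "frechet_derivative (\<lambda>x. frechet_derivative f (at x) v) (at z) w =
    frechet_derivative (\<lambda>x. frechet_derivative f (at x) w) (at z) v"
proof (rule euclidean_eqI)
  fix b :: 'b assume "b \<in> Basis"
  define g where "g x = f x \<bullet> b" for x
  have g: "C_k_on (Suc (Suc 0)) U g"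
    unfolding g_def using assms
    by (intro C_k_on_linear_compose[where h = "\<lambda>y. y \<bullet> b"] bounded_linear_inner_left)
  have D: "frechet_derivative g (at x) v = frechet_derivative f (at x) v \<bullet> b" if "x \<in> U" for x v
    unfolding g_def using C_k_on_has_derivative[OF f that] by (rule frechet_derivative_inner)
  have DD: "frechet_derivative (\<lambda>x. frechet_derivative g (at x) v) (at z) w =
      frechet_derivative (\<lambda>x. frechet_derivative f (at x) v) (at z) w \<bullet> b" for v w
  proof -
    have "C_k_on (Suc 0) U (\<lambda>x. frechet_derivative f (at x) v)" using f by simp
    then have "((\<lambda>x. frechet_derivative f (at x) v) has_derivative
        frechet_derivative (\<lambda>x. frechet_derivative f (at x) v) (at z)) (at z)"
      using z by (rule C_k_on_has_derivative)
    then have "((\<lambda>x. frechet_derivative f (at x) v \<bullet> b) has_derivative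
        (\<lambda>w. frechet_derivative (\<lambda>x. frechet_derivative f (at x) v) (at z) w \<bullet> b)) (at z)"
      by (rule has_derivative_inner_left)
    then have "((\<lambda>x. frechet_derivative g (at x) v) has_derivative
        (\<lambda>w. frechet_derivative (\<lambda>x. frechet_derivative f (at x) v) (at z) w \<bullet> b)) (at z)"
      by (rule has_derivative_transform_within_open[OF _ \<open>open U\<close> z]) (simp add: D)
    then show ?thesis using frechet_derivative_at by metis
  qed
  have "frechet_derivative (\<lambda>x. frechet_derivative g (at x) v) (at z) w =
    frechet_derivative (\<lambda>x. frechet_derivative g (at x) w) (at z) v"
  proof (rule tendsto_unique[OF _ second_difference_tendsto[OF assms(1) z g]])
    show "((\<lambda>t. (g (z + t *\<^sub>R v + t *\<^sub>R w) - g (z + t *\<^sub>R v) - g (z + t *\<^sub>R w) + g z) / (t * t))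
     \<longlongrightarrow> frechet_derivative (\<lambda>x. frechet_derivative g (at x) w) (at z) v) (at_right 0)"
      using second_difference_tendsto[OF assms(1) z g, of w v]
      by (simp add: algebra_simps)
  qed simp
  then show "frechet_derivative (\<lambda>x. frechet_derivative f (at x) v) (at z) w \<bullet> b =
    frechet_derivative (\<lambda>x. frechet_derivative f (at x) w) (at z) v \<bullet> b"
    using DD by metis
qed

section \<open>The exponential of matrices\<close>

interpretation matrix_mult:
  bounded_bilinear "(**) :: real^'n^'m \<Rightarrow> real^'p^'n \<Rightarrow> real^'p^'m"
proof -
  have "bilinear ((**) :: real^'n^'m \<Rightarrow> real^'p^'n \<Rightarrow> real^'p^'m)"
    by (auto simp: bilinear_def linear_iff matrix_matrix_mult_def vec_eq_iff sum.distrib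
        sum_distrib_left algebra_simps)
  then show "bounded_bilinear ((**) :: real^'n^'m \<Rightarrow> real^'p^'n \<Rightarrow> real^'p^'m)"
    by (simp add: bilinear_conv_bounded_bilinear)
qed

interpretation matrix_vector:
  bounded_bilinear "(*v) :: real^'n^'m \<Rightarrow> real^'n \<Rightarrow> real^'m"
proof -
  have "bilinear ((*v) :: real^'n^'m \<Rightarrow> real^'n \<Rightarrow> real^'m)"
    by (auto simp: bilinear_def linear_iff matrix_vector_mult_def vec_eq_iff sum.distrib
        sum_distrib_left algebra_simps)
  then show "bounded_bilinear ((*v) :: real^'n^'m \<Rightarrow> real^'n \<Rightarrow> real^'m)"
    by (simp add: bilinear_conv_bounded_bilinear)
qed

text \<open>The algebra of endomorphisms carries the operator norm, which unlike the Euclidean norm of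
  the library on \<^typ>\<open>real^'n^'n\<close> makes it a Banach algebra, so that \<^const>\<open>exp\<close> applies.\<close>

typedef 'n endo = "UNIV :: ((real^'n) \<Rightarrow>\<^sub>L (real^'n)) set" ..

setup_lifting type_definition_endo

instantiation endo :: (finite) real_normed_algebra_1
begin

lift_definition zero_endo :: "'a endo" is 0 .
lift_definition one_endo :: "'a endo" is id_blinfun .
lift_definition plus_endo :: "'a endo \<Rightarrow> 'a endo \<Rightarrow> 'a endo" is "(+)" .
lift_definition minus_endo :: "'a endo \<Rightarrow> 'a endo \<Rightarrow> 'a endo" is "(-)" .
lift_definition uminus_endo :: "'a endo \<Rightarrow> 'a endo" is uminus .
lift_definition times_endo :: "'a endo \<Rightarrow> 'a endo \<Rightarrow> 'a endo" is "(o\<^sub>L)" .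
lift_definition scaleR_endo :: "real \<Rightarrow> 'a endo \<Rightarrow> 'a endo" is "(*\<^sub>R)" .
lift_definition norm_endo :: "'a endo \<Rightarrow> real" is norm .
definition dist_endo :: "'a endo \<Rightarrow> 'a endo \<Rightarrow> real" where "dist_endo x y = norm (x - y)"
definition sgn_endo :: "'a endo \<Rightarrow> 'a endo" where "sgn_endo x = scaleR (inverse (norm x)) x"
definition uniformity_endo :: "('a endo \<times> 'a endo) filter"
  where "uniformity_endo = (INF e\<in>{0<..}. principal {(x, y). dist x y < e})"
definition open_endo :: "'a endo set \<Rightarrow> bool"
  where "open_endo U \<longleftrightarrow> (\<forall>x\<in>U. eventually (\<lambda>(x', y). x' = x \<longrightarrow> y \<in> U) uniformity)"

instance
proof
  fix x y z :: "'a endo" and a b :: real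
  show "x + y + z = x + (y + z)" by transfer (simp add: add.assoc)
  show "x + y = y + x" by transfer (simp add: add.commute)
  show "0 + x = x" by transfer simp
  show "- x + x = 0" by transfer simp
  show "x - y = x + - y" by transfer simp
  show "a *\<^sub>R (x + y) = a *\<^sub>R x + a *\<^sub>R y" by transfer (simp add: scaleR_add_right)
  show "(a + b) *\<^sub>R x = a *\<^sub>R x + b *\<^sub>R x" by transfer (simp add: scaleR_add_left)
  show "a *\<^sub>R b *\<^sub>R x = (a * b) *\<^sub>R x" by transfer simp
  show "1 *\<^sub>R x = x" by transfer simp
  show "x * y * z = x * (y * z)" by transfer (simp add: blinfun_eqI)
  show "(x + y) * z = x * z + y * z"
    by transfer (auto intro: blinfun_eqI simp: blinfun.add_left)
  show "x * (y + z) = x * y + x * z"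
    by transfer (auto intro: blinfun_eqI simp: blinfun.add_left blinfun.add_right)
  show "a *\<^sub>R x * y = a *\<^sub>R (x * y)" by transfer (simp add: blinfun_eqI blinfun.scaleR_left)
  show "x * a *\<^sub>R y = a *\<^sub>R (x * y)"
    by transfer (simp add: blinfun_eqI blinfun.scaleR_left blinfun.scaleR_right)
  show "1 * x = x" by transfer (simp add: blinfun_eqI)
  show "x * 1 = x" by transfer (simp add: blinfun_eqI)
  show "(0 :: 'a endo) \<noteq> 1"
  proof transfer
    show "(0 :: (real^'a) \<Rightarrow>\<^sub>L (real^'a)) \<noteq> id_blinfun"
      by (metis norm_blinfun_id norm_zero zero_neq_one)
  qed
  show "dist x y = norm (x - y)" by (rule dist_endo_def)
  show "sgn x = inverse (norm x) *\<^sub>R x" by (rule sgn_endo_def)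
  show "uniformity = (INF e\<in>{0<..}. principal {(x :: 'a endo, y). dist x y < e})"
    by (rule uniformity_endo_def)
  show "open U \<longleftrightarrow> (\<forall>x\<in>U. eventually (\<lambda>(x', y). x' = x \<longrightarrow> y \<in> U) uniformity)" for U :: "'a endo set"
    by (rule open_endo_def)
  show "norm x = 0 \<longleftrightarrow> x = 0" by transfer simp
  show "norm (x + y) \<le> norm x + norm y" by transfer (rule norm_triangle_ineq)
  show "norm (a *\<^sub>R x) = \<bar>a\<bar> * norm x" by transfer simp
  show "norm (x * y) \<le> norm x * norm y" by transfer (rule norm_blinfun_compose)
  show "norm (1 :: 'a endo) = 1" by transfer (rule norm_blinfun_id)
qed

end

instance endo :: (finite) banach
proof
  fix X :: "nat \<Rightarrow> 'a endo"
  have d: "dist x y = dist (Rep_endo x) (Rep_endo y)" for x y :: "'a endo"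
    by (simp add: dist_norm norm_endo.rep_eq minus_endo.rep_eq)
  assume "Cauchy X"
  then have "Cauchy (\<lambda>n. Rep_endo (X n))" by (simp add: Cauchy_def d)
  then obtain L where "(\<lambda>n. Rep_endo (X n)) \<longlonglongrightarrow> L"
    using Cauchy_convergent convergent_def by blast
  then have "X \<longlonglongrightarrow> Abs_endo L"
    unfolding tendsto_iff d by (simp add: Abs_endo_inverse)
  then show "convergent X" by (auto simp: convergent_def)
qed

definition endo_of_matrix :: "real^'n^'n \<Rightarrow> 'n endo" where
  "endo_of_matrix A = Abs_endo (Blinfun ((*v) A))"

definition matrix_of_endo :: "'n::finite endo \<Rightarrow> real^'n^'n" where
  "matrix_of_endo x = matrix (blinfun_apply (Rep_endo x))"

definition mexp :: "real^'n^'n \<Rightarrow> real^'n^'n" where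
  "mexp A = matrix_of_endo (exp (endo_of_matrix A))"

lemma Rep_endo_of_matrix: "blinfun_apply (Rep_endo (endo_of_matrix A)) = (*v) A"
  by (simp add: endo_of_matrix_def Abs_endo_inverse bounded_linear_Blinfun_apply
      matrix_vector_mul_bounded_linear)

lemma endo_eqI: "(\<And>v. blinfun_apply (Rep_endo x) v = blinfun_apply (Rep_endo y) v) \<Longrightarrow> x = y"
  by (simp add: Rep_endo_inject[symmetric] blinfun_eqI)

lemma matrix_of_endo_vector: "matrix_of_endo x *v v = blinfun_apply (Rep_endo x) v"
  unfolding matrix_of_endo_def
  by (simp add: blinfun.bounded_linear_right bounded_linear.linear matrix_works)

lemma matrix_of_endo_of_matrix [simp]: "matrix_of_endo (endo_of_matrix A) = A"
  by (simp add: matrix_eq matrix_of_endo_vector Rep_endo_of_matrix)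

lemma matrix_of_endo_mult: "matrix_of_endo (x * y) = matrix_of_endo x ** matrix_of_endo y"
  by (simp add: matrix_eq matrix_of_endo_vector times_endo.rep_eq
      flip: matrix_vector_mul_assoc)

lemma matrix_of_endo_one [simp]: "matrix_of_endo 1 = mat 1"
  by (simp add: matrix_eq matrix_of_endo_vector one_endo.rep_eq)

lemma endo_of_matrix_mult: "endo_of_matrix (A ** B) = endo_of_matrix A * endo_of_matrix B"
  by (rule endo_eqI) (simp add: Rep_endo_of_matrix times_endo.rep_eq matrix_vector_mul_assoc)

lemma endo_of_matrix_add: "endo_of_matrix (A + B) = endo_of_matrix A + endo_of_matrix B"
  by (rule endo_eqI)
    (simp add: Rep_endo_of_matrix plus_endo.rep_eq blinfun.add_left matrix_vector_mult_add_rdistrib)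

lemma endo_of_matrix_scaleR: "endo_of_matrix (c *\<^sub>R A) = c *\<^sub>R endo_of_matrix A"
  by (rule endo_eqI)
    (simp add: Rep_endo_of_matrix scaleR_endo.rep_eq blinfun.scaleR_left scaleR_matrix_vector_assoc)

lemma bounded_linear_matrix_of_endo: "bounded_linear (matrix_of_endo :: 'n::finite endo \<Rightarrow> real^'n^'n)"
proof (rule bounded_linear_intro)
  fix x y :: "'n endo" and c :: real
  show "matrix_of_endo (x + y) = matrix_of_endo x + matrix_of_endo y"
    by (simp add: matrix_eq matrix_of_endo_vector plus_endo.rep_eq blinfun.add_left
        matrix_vector_mult_add_rdistrib)
  show "matrix_of_endo (c *\<^sub>R x) = c *\<^sub>R matrix_of_endo x"
    by (simp add: matrix_eq matrix_of_endo_vector scaleR_endo.rep_eq blinfun.scaleR_left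
        flip: scaleR_matrix_vector_assoc)
  have "norm (matrix_of_endo x) \<le> (\<Sum>i\<in>UNIV. norm (matrix_of_endo x $ i))"
    unfolding norm_vec_def by (rule L2_set_le_sum) simp
  also have "\<dots> \<le> (\<Sum>i\<in>(UNIV :: 'n set). \<Sum>j\<in>(UNIV :: 'n set). \<bar>matrix_of_endo x $ i $ j\<bar>)"
    by (intro sum_mono norm_le_l1_cart)
  also have "\<dots> \<le> (\<Sum>i\<in>(UNIV :: 'n set). \<Sum>j\<in>(UNIV :: 'n set). norm x)"
  proof (intro sum_mono)
    fix i j :: 'n
    have "\<bar>matrix_of_endo x $ i $ j\<bar> = \<bar>blinfun_apply (Rep_endo x) (axis j 1) $ i\<bar>"
      by (simp add: matrix_of_endo_def matrix_def)
    also have "\<dots> \<le> norm (blinfun_apply (Rep_endo x) (axis j 1))" by (rule component_le_norm_cart)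
    also have "\<dots> \<le> norm (Rep_endo x) * norm (axis j (1::real))" by (rule norm_blinfun)
    finally show "\<bar>matrix_of_endo x $ i $ j\<bar> \<le> norm x" by (simp add: norm_endo.rep_eq)
  qed
  finally show "norm (matrix_of_endo x) \<le> norm x * (of_nat CARD('n) * of_nat CARD('n))"
    by (simp add: mult_ac)
qed

lemma mexp_zero [simp]: "mexp (0 :: real^'n^'n) = mat 1"
  using endo_of_matrix_scaleR[of 0 "0 :: real^'n^'n"] by (simp add: mexp_def)

lemma mexp_add: "A ** B = B ** A \<Longrightarrow> mexp (A + B) = mexp A ** mexp B"
  by (simp add: mexp_def endo_of_matrix_add exp_add_commuting matrix_of_endo_mult
      flip: endo_of_matrix_mult)

lemma mexp_scaleR_add: "mexp ((s + t) *\<^sub>R A) = mexp (s *\<^sub>R A) ** mexp (t *\<^sub>R A)"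
  unfolding scaleR_add_left
  by (rule mexp_add) (simp add: matrix_mult.scaleR_left matrix_mult.scaleR_right mult.commute)

lemma mexp_minus: "mexp A ** mexp (- A) = mat 1" "mexp (- A) ** mexp A = mat 1"
  using mexp_scaleR_add[of 1 "-1" A] mexp_scaleR_add[of "-1" 1 A] by simp_all

lemma mexp_has_vector_derivative:
  "((\<lambda>t. mexp (t *\<^sub>R A)) has_vector_derivative A ** mexp (t *\<^sub>R A)) (at t within S)"
proof -
  have "((\<lambda>t. matrix_of_endo (exp (t *\<^sub>R endo_of_matrix A))) has_vector_derivative
     matrix_of_endo (endo_of_matrix A * exp (t *\<^sub>R endo_of_matrix A))) (at t)"
    by (rule bounded_linear.has_vector_derivative[OF bounded_linear_matrix_of_endo
          exp_scaleR_has_vector_derivative_left])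
  then show ?thesis
    by (simp add: has_vector_derivative_at_within mexp_def endo_of_matrix_scaleR matrix_of_endo_mult)
qed

lemma mexp_commute: "A ** mexp (t *\<^sub>R A) = mexp (t *\<^sub>R A) ** A"
proof -
  have "matrix_of_endo (endo_of_matrix A * exp (t *\<^sub>R endo_of_matrix A)) =
    matrix_of_endo (exp (t *\<^sub>R endo_of_matrix A) * endo_of_matrix A)"
    by (simp add: exp_times_scaleR_commute)
  then show ?thesis
    by (simp add: mexp_def endo_of_matrix_scaleR matrix_of_endo_mult)
qed

text \<open>The integrating factor \<open>mexp (t *\<^sub>R (- X))\<close> makes its product with
  \<open>c\<close> constant.\<close>

lemma mexp_ode_unique:
  fixes c :: "real \<Rightarrow> real^'n^'n"
  assumes c: "\<And>t. (c has_vector_derivative X ** c t) (at t)"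
  shows "c t = mexp (t *\<^sub>R X) ** c 0"
proof -
  define u where "u t = mexp (t *\<^sub>R (- X)) ** c t" for t
  have "(u has_vector_derivative 0) (at t)" for t
  proof -
    have "(u has_vector_derivative
       (mexp (t *\<^sub>R (- X)) ** (X ** c t) + ((- X) ** mexp (t *\<^sub>R (- X))) ** c t)) (at t)"
      unfolding u_def
      by (rule matrix_mult.has_vector_derivative[OF mexp_has_vector_derivative c])
    moreover have "((- X) ** mexp (t *\<^sub>R (- X))) ** c t = - (mexp (t *\<^sub>R (- X)) ** (X ** c t))"
      unfolding mexp_commute
      by (simp add: matrix_mult.minus_left matrix_mult.minus_right matrix_mul_assoc)
    ultimately show ?thesis by simp
  qed
  then obtain k where "\<And>t. u t = k"
    using has_vector_derivative_zero_constant[of UNIV u] by auto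
  then have "u t = u 0" by simp
  then have "mexp (t *\<^sub>R X) ** u t = mexp (t *\<^sub>R X) ** c 0" by (simp add: u_def)
  moreover have "mexp (t *\<^sub>R X) ** u t = c t"
    using mexp_minus(1)[of "t *\<^sub>R X"] by (simp add: u_def matrix_mul_assoc)
  ultimately show ?thesis by simp
qed

text \<open>With \<open>X\<close> scaled by \<open>t\<close>, both sides solve the same linear
  differential equation and start at \<open>mat 1\<close>; time 1 gives the claim.\<close>

lemma mexp_conj:
  fixes g h X :: "real^'n^'n"
  assumes gh: "g ** h = mat 1"
  shows "mexp (g ** X ** h) = g ** mexp X ** h"
proof -
  have hg: "h ** g = mat 1" using gh matrix_left_right_inverse by blast
  define c where "c t = g ** mexp (t *\<^sub>R X) ** h" for t
  have "(c has_vector_derivative (g ** X ** h) ** c t) (at t)" for t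
  proof -
    have "(c has_vector_derivative g ** (X ** mexp (t *\<^sub>R X)) ** h) (at t)"
      unfolding c_def
      by (intro bounded_linear.has_vector_derivative[OF matrix_mult.bounded_linear_left]
         bounded_linear.has_vector_derivative[OF matrix_mult.bounded_linear_right]
          mexp_has_vector_derivative)
    moreover have "(g ** X ** h) ** c t = g ** X ** (h ** g) ** mexp (t *\<^sub>R X) ** h"
      by (simp add: c_def matrix_mul_assoc)
    ultimately show ?thesis by (simp add: hg matrix_mul_assoc)
  qed
  from mexp_ode_unique[OF this, of 1] show ?thesis by (simp add: c_def gh)
qed

lemma continuous_on_mexp: "continuous_on S (\<lambda>t. mexp (t *\<^sub>R A))"
  using has_vector_derivative_continuous[OF mexp_has_vector_derivative]
  by (metis continuous_on_eq_continuous_within)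

lemma C_k_on_mexp: "C_k_on k UNIV (\<lambda>t. mexp (t *\<^sub>R A))"
proof -
  \<comment> \<open>The constant left factor makes the family closed under differentiation, which
    merely replaces \<open>B\<close> by \<open>B ** A\<close>.\<close>
  have "C_k_on k UNIV (\<lambda>t. B ** mexp (t *\<^sub>R A))" for B
  proof (induction k arbitrary: B)
    case 0
    then show ?case
      by (simp, intro matrix_mult.continuous_on continuous_on_const continuous_on_mexp)
  next
    case (Suc k)
    show ?case
    proof (rule C_k_on_SucI)
      show "((\<lambda>t. B ** mexp (t *\<^sub>R A)) has_derivative (\<lambda>h. h *\<^sub>R ((B ** A) ** mexp (t *\<^sub>R A)))) (at t)" for t
        using bounded_linear.has_vector_derivative[OF matrix_mult.bounded_linear_right
            mexp_has_vector_derivative[of A t UNIV], of B]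
        by (simp add: has_vector_derivative_def matrix_mul_assoc)
      show "C_k_on k UNIV (\<lambda>t. h *\<^sub>R ((B ** A) ** mexp (t *\<^sub>R A)))" for h
        by (intro C_k_on_linear_compose[where h = "\<lambda>x. h *\<^sub>R x"] bounded_linear_scaleR_right Suc.IH) simp
    qed simp
  qed
  from this[of "mat 1"] show ?thesis by simp
qed

lemma matrix_inv_eqI:
  fixes A B :: "real^'n^'n"
  shows "A ** B = mat 1 \<Longrightarrow> matrix_inv A = B"
  unfolding matrix_inv_def
proof (rule some_equality)
  assume "A ** B = mat 1"
  then show "A ** B = mat 1 \<and> B ** A = mat 1"
    using matrix_left_right_inverse by blast
  show "C = B" if "A ** C = mat 1 \<and> C ** A = mat 1" for C
    using that \<open>A ** B = mat 1\<close> by (metis matrix_mul_assoc matrix_mul_lid matrix_mul_rid)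
qed

lemma matrix_inv_mexp: "matrix_inv (mexp A) = mexp (- A)"
  by (rule matrix_inv_eqI) (rule mexp_minus)

section \<open>The Lie subgroup generated by a Lie algebra of matrices\<close>

lemma matrix_inv_mult:
  fixes g :: "real^'n^'n"
  assumes "invertible g"
  shows "g ** matrix_inv g = mat 1" "matrix_inv g ** g = mat 1"
  using assms matrix_inv_eqI unfolding invertible_def by metis+

lemma invertibleI: "(g :: real^'n^'n) ** h = mat 1 \<Longrightarrow> invertible g"
  using matrix_left_right_inverse unfolding invertible_def by blast

lemma matrix_inv_matrix_inv:
  fixes g :: "real^'n^'n"
  shows "invertible g \<Longrightarrow> matrix_inv (matrix_inv g) = g"
  by (simp add: matrix_inv_eqI matrix_inv_mult)

lemma matrix_inv_prod:
  fixes g h :: "real^'n^'n"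
  assumes "invertible g" "invertible h"
  shows "matrix_inv (g ** h) = matrix_inv h ** matrix_inv g" "invertible (g ** h)"
proof -
  have "(g ** h) ** (matrix_inv h ** matrix_inv g) = g ** (h ** matrix_inv h) ** matrix_inv g"
    by (simp add: matrix_mul_assoc)
  also have "\<dots> = mat 1" using assms by (simp add: matrix_inv_mult)
  finally show "matrix_inv (g ** h) = matrix_inv h ** matrix_inv g" "invertible (g ** h)"
    by (auto intro: matrix_inv_eqI invertibleI)
qed

text \<open>The difference of the inverses is
  \<open>- (matrix_inv x ** (x - g) ** matrix_inv g)\<close>. The unknown
  \<open>norm (matrix_inv x)\<close> is at most \<open>c + y\<close>, with \<open>y\<close> the
  distance to be estimated, and the part with \<open>y\<close> is absorbed. \<open>K\<close> is the
  constant of continuity of the matrix product.\<close>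

lemma matrix_inv_close:
  fixes g :: "real^'n^'n"
  assumes g: "invertible g" and "e > 0"
  obtains d where "d > 0"
    "\<And>x. invertible x \<Longrightarrow> dist x g < d \<Longrightarrow> dist (matrix_inv x) (matrix_inv g) < e"
proof -
  obtain K where K: "K > 0" "\<And>(a :: real^'n^'n) (b :: real^'n^'n). norm (a ** b) \<le> norm a * norm b * K"
    using matrix_mult.pos_bounded by blast
  define c where "c = norm (matrix_inv g) + 1"
  have c: "c > 0" "norm (matrix_inv g) \<le> c" by (auto simp: c_def add_nonneg_pos)
  \<comment> \<open>The first bound makes the coefficient of \<open>y\<close> at most 1/2; the
    second then leaves \<open>y\<close> below \<open>e / 2\<close>.\<close>
  define d where "d = min (1 / (2 * K * K * c)) (e / (4 * K * K * c * c))"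
  show ?thesis
  proof
    show "d > 0" using K c \<open>e > 0\<close> by (simp add: d_def)
    fix x assume x: "invertible x" "dist x g < d"
    define y where "y = norm (matrix_inv x - matrix_inv g)"
    have "matrix_inv x ** (x - g) ** matrix_inv g =
        matrix_inv x ** x ** matrix_inv g - matrix_inv x ** (g ** matrix_inv g)"
      by (simp add: matrix_mult.diff_left matrix_mult.diff_right matrix_mul_assoc)
    then have "matrix_inv x - matrix_inv g = - (matrix_inv x ** (x - g) ** matrix_inv g)"
      using x g by (simp add: matrix_inv_mult)
    then have "y = norm (matrix_inv x ** (x - g) ** matrix_inv g)"
      unfolding y_def by (simp only: norm_minus_cancel)
    also have "\<dots> \<le> norm (matrix_inv x ** (x - g)) * norm (matrix_inv g) * K"
      using K(2)[of "matrix_inv x ** (x - g)" "matrix_inv g"] by simp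
    also have "\<dots> \<le> (norm (matrix_inv x) * norm (x - g) * K) * c * K"
      using K c by (intro mult_right_mono mult_mono) auto
    also have "\<dots> = norm (matrix_inv x) * (norm (x - g) * (K * K * c))" by (simp add: mult_ac)
    also have "norm (matrix_inv x) \<le> c + y"
      using norm_triangle_ineq[of "matrix_inv g" "matrix_inv x - matrix_inv g"] c by (simp add: y_def)
    finally have 1: "y \<le> (c + y) * (norm (x - g) * (K * K * c))"
      using K c by (simp add: mult_right_mono)
    have dx: "norm (x - g) \<le> 1 / (2 * K * K * c)" "norm (x - g) < e / (4 * K * K * c * c)"
      using x by (auto simp: d_def dist_norm)
    then have half: "norm (x - g) * (K * K * c) \<le> 1 / 2"
      using K c by (simp add: field_simps)
    have "y \<ge> 0" by (simp add: y_def)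
    then have "y * (norm (x - g) * (K * K * c)) \<le> y * (1 / 2)"
      using half by (intro mult_left_mono) auto
    then have "y \<le> 2 * (c * (norm (x - g) * (K * K * c)))" using 1 by (simp add: algebra_simps)
    also have "\<dots> < e" using dx K c \<open>e > 0\<close> by (simp add: field_simps)
    finally show "dist (matrix_inv x) (matrix_inv g) < e" by (simp add: dist_norm y_def)
  qed
qed

text \<open>The intrinsic topology of the group generated by \<open>mexp ` A\<close> is defined by reachability:
  a neighbourhood of \<open>h\<close> consists of the points that can be reached from \<open>h\<close> inside an open
  set of the ambient space by finitely many steps \<open>k \<mapsto> mexp X ** k\<close> with \<open>X\<close> in the Lie algebra.\<close>

locale lie_matrices =
  fixes bs :: "(real^'n^'n) list" and A :: "(real^'n^'n) set"
  assumes distinct: "distinct bs"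
    and orthonormal: "\<And>b c. b \<in> set bs \<Longrightarrow> c \<in> set bs \<Longrightarrow> b \<bullet> c = (if b = c then 1 else 0)"
    and A_eq: "A = span (set bs)"
    and Ad: "\<And>X Y. X \<in> A \<Longrightarrow> Y \<in> A \<Longrightarrow> mexp X ** Y ** mexp (- X) \<in> A"
begin

lemma subspace_A: "subspace A"
  by (simp add: A_eq subspace_span)

lemmas A_closed = subspace_add[OF subspace_A] subspace_scale[OF subspace_A]
  subspace_neg[OF subspace_A] subspace_diff[OF subspace_A] subspace_0[OF subspace_A]

text \<open>The whole segment of a step has to lie in \<open>Om\<close>, not only its ends: if the
  group meets \<open>Om\<close> in many sheets, this keeps the reached points on the sheet of
  \<open>h\<close>.\<close>

inductive reach :: "(real^'n^'n) set \<Rightarrow> real^'n^'n \<Rightarrow> real^'n^'n \<Rightarrow> bool" for Om where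
  refl: "reach Om h h"
| step: "reach Om h k \<Longrightarrow> X \<in> A \<Longrightarrow> (\<And>t. 0 \<le> t \<Longrightarrow> t \<le> 1 \<Longrightarrow> mexp (t *\<^sub>R X) ** k \<in> Om)
    \<Longrightarrow> reach Om h (mexp X ** k)"

lemma reach_step: "X \<in> A \<Longrightarrow> (\<And>t. 0 \<le> t \<Longrightarrow> t \<le> 1 \<Longrightarrow> mexp (t *\<^sub>R X) ** k \<in> Om)
    \<Longrightarrow> reach Om k (mexp X ** k)"
  by (rule reach.step[OF reach.refl])

lemma reach_trans: "reach Om k l \<Longrightarrow> reach Om h k \<Longrightarrow> reach Om h l"
  by (induction rule: reach.induct) (auto intro: reach.intros)

lemma reach_mono: "reach Om h k \<Longrightarrow> Om \<subseteq> Om' \<Longrightarrow> reach Om' h k"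
  by (induction rule: reach.induct) (auto intro!: reach.intros)

lemma reach_sym: "reach Om h k \<Longrightarrow> reach Om k h"
proof (induction rule: reach.induct)
  case (step h k X)
  have "reach Om (mexp X ** k) (mexp (- X) ** (mexp X ** k))"
  proof (rule reach_step)
    show "- X \<in> A" using step A_closed by auto
    fix t :: real assume t: "0 \<le> t" "t \<le> 1"
    have "mexp (t *\<^sub>R - X) ** (mexp X ** k) = mexp ((1 - t) *\<^sub>R X) ** k"
      using mexp_scaleR_add[of "-t" 1 X] by (simp add: matrix_mul_assoc)
    then show "mexp (t *\<^sub>R - X) ** (mexp X ** k) \<in> Om" using step.hyps(3)[of "1 - t"] t by simp
  qed
  moreover have "mexp (- X) ** (mexp X ** k) = k" by (simp add: matrix_mul_assoc mexp_minus)
  ultimately show ?case using step.IH reach_trans by metis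
qed (rule reach.refl)

lemma reach_in: "reach Om h k \<Longrightarrow> h \<in> Om \<Longrightarrow> k \<in> Om"
proof (induction rule: reach.induct)
  case (step h k X)
  show ?case using step.hyps(3)[of 1] by simp
qed

text \<open>Steps multiply on the left, so they commute with right translations.\<close>

lemma reach_right:
  "reach Om h k \<Longrightarrow> (\<And>x. x \<in> Om \<Longrightarrow> x ** g \<in> Om') \<Longrightarrow> reach Om' (h ** g) (k ** g)"
proof (induction rule: reach.induct)
  case (step h k X)
  have "reach Om' (h ** g) (mexp X ** (k ** g))"
    using step by (intro reach.step) (auto simp: matrix_mul_assoc)
  then show ?case by (simp add: matrix_mul_assoc)
qed (rule reach.refl)

definition carrier :: "(real^'n^'n) set" where
  "carrier = {g. reach UNIV (mat 1) g}"

lemma carrier_one: "mat 1 \<in> carrier"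
  by (simp add: carrier_def reach.refl)

lemma carrier_step: "X \<in> A \<Longrightarrow> g \<in> carrier \<Longrightarrow> mexp X ** g \<in> carrier"
  by (simp add: carrier_def reach.step)

lemma mexp_carrier: "X \<in> A \<Longrightarrow> mexp X \<in> carrier"
  using carrier_step[OF _ carrier_one] by simp

lemma carrier_induct [consumes 1, case_names one step]:
  assumes "g \<in> carrier" and "P (mat 1)"
    and "\<And>X g. X \<in> A \<Longrightarrow> g \<in> carrier \<Longrightarrow> P g \<Longrightarrow> P (mexp X ** g)"
  shows "P g"
proof -
  have "reach UNIV h g \<Longrightarrow> h = mat 1 \<Longrightarrow> P g" for h
    by (induction rule: reach.induct) (use assms in \<open>auto simp: carrier_def\<close>)
  then show ?thesis using assms(1) by (simp add: carrier_def)
qed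

lemma carrier_reach: "reach Om h k \<Longrightarrow> h \<in> carrier \<Longrightarrow> k \<in> carrier"
  unfolding carrier_def using reach_mono reach_trans by blast

lemma carrier_invertible: "g \<in> carrier \<Longrightarrow> invertible g"
proof (induction rule: carrier_induct)
  case one
  show ?case by (rule invertibleI[of _ "mat 1"]) simp
next
  case (step X g)
  then show ?case
    by (intro matrix_inv_prod(2)) (auto intro: invertibleI mexp_minus)
qed

lemma carrier_mult: "g \<in> carrier \<Longrightarrow> h \<in> carrier \<Longrightarrow> g ** h \<in> carrier"
proof (induction g rule: carrier_induct)
  case (step X g)
  then show ?case using carrier_step by (simp flip: matrix_mul_assoc)
qed simp

lemma carrier_inv: "g \<in> carrier \<Longrightarrow> matrix_inv g \<in> carrier"
proof -
  assume g: "g \<in> carrier"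
  then have "reach UNIV (mat 1 ** matrix_inv g) (g ** matrix_inv g)"
    by (intro reach_right[of UNIV]) (auto simp: carrier_def)
  then have "reach UNIV (mat 1) (matrix_inv g)"
    using g by (simp add: carrier_invertible matrix_inv_mult reach_sym)
  then show ?thesis by (simp add: carrier_def)
qed

lemma carrier_Ad: "g \<in> carrier \<Longrightarrow> Y \<in> A \<Longrightarrow> g ** Y ** matrix_inv g \<in> A"
proof (induction rule: carrier_induct)
  case one
  have "matrix_inv (mat 1 :: real^'n^'n) = mat 1" by (rule matrix_inv_eqI) simp
  then show ?case using one by simp
next
  case (step X g)
  have "mexp X ** g ** Y ** matrix_inv (mexp X ** g) = mexp X ** (g ** Y ** matrix_inv g) ** mexp (- X)"
    using step carrier_invertible
    by (simp add: matrix_inv_prod matrix_inv_mexp matrix_mul_assoc invertibleI[OF mexp_minus(1)])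
  then show ?case using step Ad by simp
qed

lemma carrier_Ad': "g \<in> carrier \<Longrightarrow> Y \<in> A \<Longrightarrow> matrix_inv g ** Y ** g \<in> A"
  using carrier_Ad[OF carrier_inv] by (simp add: carrier_invertible matrix_inv_matrix_inv)

lemma mexp_conj_carrier:
  "g \<in> carrier \<Longrightarrow> mexp (g ** X ** matrix_inv g) ** (g ** k) = g ** (mexp X ** k)"
  using mexp_conj[of g "matrix_inv g" X]
  by (simp add: carrier_invertible matrix_inv_mult matrix_mul_assoc[symmetric])
    (simp add: carrier_invertible matrix_inv_mult matrix_mul_assoc)

text \<open>Left translation by \<open>g\<close> turns the step along \<open>X\<close> into the step
  along \<open>g ** X ** matrix_inv g\<close>, which \<open>carrier_Ad\<close> keeps in
  \<open>A\<close>.\<close>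

lemma reach_left:
  assumes g: "g \<in> carrier"
  shows "reach Om h k \<Longrightarrow> (\<And>x. x \<in> Om \<Longrightarrow> g ** x \<in> Om') \<Longrightarrow> reach Om' (g ** h) (g ** k)"
proof (induction rule: reach.induct)
  case (step h k X)
  have *: "mexp (t *\<^sub>R (g ** X ** matrix_inv g)) ** (g ** k) = g ** (mexp (t *\<^sub>R X) ** k)" for t
    using mexp_conj_carrier[OF g, of "t *\<^sub>R X" k]
    by (simp add: matrix_mult.scaleR_left matrix_mult.scaleR_right)
  have "reach Om' (g ** h) (mexp (g ** X ** matrix_inv g) ** (g ** k))"
    using step by (intro reach.step carrier_Ad[OF g]) (auto simp: *)
  then show ?case using *[of 1] by simp
qed (rule reach.refl)

text \<open>The first factor moves by right translation with \<open>h\<close> fixed, then the second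
  by left translation with \<open>g'\<close> fixed.\<close>

lemma reach_mult:
  assumes "g \<in> carrier" "h \<in> Om2" and "reach Om1 g g'" and "reach Om2 h h'" and "g \<in> Om1"
    and sub: "\<And>x y. x \<in> Om1 \<Longrightarrow> y \<in> Om2 \<Longrightarrow> x ** y \<in> Om"
  shows "reach Om (g ** h) (g' ** h')"
proof (rule reach_trans)
  show "reach Om (g ** h) (g' ** h)"
    by (rule reach_right[OF assms(3)]) (use assms in auto)
  show "reach Om (g' ** h) (g' ** h')"
    by (rule reach_left[OF carrier_reach[OF assms(3,1)] assms(4)])
       (use sub reach_in[OF assms(3,5)] in auto)
qed

lemma reach_inverse:
  assumes g: "g \<in> carrier"
    and sub: "\<And>x. x \<in> carrier \<Longrightarrow> x \<in> Om \<Longrightarrow> matrix_inv x \<in> Om'"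
  shows "reach Om g k \<Longrightarrow> reach Om' (matrix_inv g) (matrix_inv k)"
proof -
  have "reach Om h k \<Longrightarrow> h = g \<Longrightarrow> reach Om' (matrix_inv h) (matrix_inv k)" for h
  proof (induction rule: reach.induct)
    case (step h k X)
    have k: "k \<in> carrier" using step g carrier_reach by blast
    \<comment> \<open>Inverting a left step along \<open>X\<close> at \<open>k\<close> multiplies
      \<open>matrix_inv k\<close> on the right by \<open>mexp (- X)\<close>, and this is the left
      step along the conjugate \<open>Y\<close>.\<close>
    define Y where "Y = - (matrix_inv k ** X ** k)"
    have Y: "Y \<in> A" unfolding Y_def using k step carrier_Ad' A_closed by auto
    have *: "mexp (t *\<^sub>R Y) ** matrix_inv k = matrix_inv (mexp (t *\<^sub>R X) ** k)" for t
    proof -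
      have "mexp (t *\<^sub>R Y) = matrix_inv k ** mexp (- (t *\<^sub>R X)) ** k"
        using mexp_conj[of "matrix_inv k" k "- (t *\<^sub>R X)"] k
        by (simp add: Y_def carrier_invertible matrix_inv_mult matrix_mult.scaleR_left
            matrix_mult.scaleR_right matrix_mult.minus_left matrix_mult.minus_right)
      then show ?thesis
        using k by (simp add: matrix_inv_prod matrix_inv_mexp carrier_invertible matrix_inv_mult
            invertibleI[OF mexp_minus(1)] flip: matrix_mul_assoc)
    qed
    have "reach Om' (matrix_inv h) (mexp Y ** matrix_inv k)"
    proof (rule reach.step)
      show "reach Om' (matrix_inv h) (matrix_inv k)" using step by simp
      show "Y \<in> A" by fact
      show "mexp (t *\<^sub>R Y) ** matrix_inv k \<in> Om'" if "0 \<le> t" "t \<le> 1" for t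
        unfolding * using step k that A_closed
        by (intro sub carrier_step) auto
    qed
    then show ?case using *[of 1] by simp
  qed (rule reach.refl)
  then show "reach Om g k \<Longrightarrow> reach Om' (matrix_inv g) (matrix_inv k)" by simp
qed

section \<open>The intrinsic topology and continuity of the group operations\<close>

definition lie_top :: "(real^'n^'n) topology" where
  "lie_top = topology (\<lambda>W. W \<subseteq> carrier \<and>
     (\<forall>h\<in>W. \<exists>Om. open Om \<and> h \<in> Om \<and> (\<forall>k. reach Om h k \<longrightarrow> k \<in> W)))"

lemma openin_lie_top:
  "openin lie_top W \<longleftrightarrow> W \<subseteq> carrier \<and>
     (\<forall>h\<in>W. \<exists>Om. open Om \<and> h \<in> Om \<and> (\<forall>k. reach Om h k \<longrightarrow> k \<in> W))"
proof -
  define Q where "Q W \<longleftrightarrow> W \<subseteq> carrier \<and>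
     (\<forall>h\<in>W. \<exists>Om. open Om \<and> h \<in> Om \<and> (\<forall>k. reach Om h k \<longrightarrow> k \<in> W))" for W
  have "istopology Q"
    unfolding istopology_def
  proof (intro conjI allI impI)
    fix S T assume "Q S" "Q T"
    show "Q (S \<inter> T)"
      unfolding Q_def
    proof (intro conjI ballI)
      show "S \<inter> T \<subseteq> carrier" using \<open>Q S\<close> by (auto simp: Q_def)
      fix h assume "h \<in> S \<inter> T"
      then obtain O1 O2 where "open O1" "h \<in> O1" "\<And>k. reach O1 h k \<Longrightarrow> k \<in> S"
        "open O2" "h \<in> O2" "\<And>k. reach O2 h k \<Longrightarrow> k \<in> T"
        using \<open>Q S\<close> \<open>Q T\<close> unfolding Q_def by (metis IntD1 IntD2)
      then show "\<exists>Om. open Om \<and> h \<in> Om \<and> (\<forall>k. reach Om h k \<longrightarrow> k \<in> S \<inter> T)"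
        by (intro exI[of _ "O1 \<inter> O2"]) (auto intro: reach_mono)
    qed
  next
    fix \<K> assume "\<forall>K\<in>\<K>. Q K"
    then show "Q (\<Union> \<K>)"
      unfolding Q_def by (smt (verit) Sup_least UnionE UnionI)
  qed
  then have "openin (topology Q) = Q" by simp
  then show ?thesis unfolding lie_top_def Q_def by simp
qed

text \<open>By transitivity the same \<open>Om\<close> witnesses openness at every reached point.
  These sets are the neighbourhoods used from here on.\<close>

lemma openin_reach:
  assumes "open Om" "h \<in> Om" "h \<in> carrier"
  shows "openin lie_top {k. reach Om h k}"
  unfolding openin_lie_top
proof (intro conjI ballI)
  show "{k. reach Om h k} \<subseteq> carrier" using assms carrier_reach by blast
  show "\<exists>Om'. open Om' \<and> k \<in> Om' \<and> (\<forall>l. reach Om' k l \<longrightarrow> l \<in> {k. reach Om h k})"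
    if "k \<in> {k. reach Om h k}" for k
    using assms that reach_in reach_trans by (intro exI[of _ Om]) blast
qed

lemma topspace_lie_top [simp]: "topspace lie_top = carrier"
proof
  show "topspace lie_top \<subseteq> carrier"
    using openin_lie_top[of "topspace lie_top"] openin_topspace[of lie_top] by blast
  have "openin lie_top carrier"
    unfolding openin_lie_top using carrier_reach by blast
  then show "carrier \<subseteq> topspace lie_top" by (rule openin_subset)
qed

lemma openin_ambient: "open Om \<Longrightarrow> openin lie_top (Om \<inter> carrier)"
  unfolding openin_lie_top
proof (intro conjI ballI)
  fix h assume "open Om" and h: "h \<in> Om \<inter> carrier"
  then show "\<exists>Om'. open Om' \<and> h \<in> Om' \<and> (\<forall>k. reach Om' h k \<longrightarrow> k \<in> Om \<inter> carrier)"
    using carrier_reach[of Om h] reach_in[of Om h] by (intro exI[of _ Om]) auto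
qed auto

lemma open_nbhds_mult:
  fixes g h :: "real^'n^'n"
  assumes "open Om" "g ** h \<in> Om"
  obtains O1 O2 where "open O1" "open O2" "g \<in> O1" "h \<in> O2"
    "\<And>x y. x \<in> O1 \<Longrightarrow> y \<in> O2 \<Longrightarrow> x ** y \<in> Om"
proof -
  have "continuous_on UNIV (\<lambda>z :: (real^'n^'n) \<times> (real^'n^'n). fst z ** snd z)"
    by (intro matrix_mult.continuous_on continuous_intros)
  then have "open ((\<lambda>z :: (real^'n^'n) \<times> (real^'n^'n). fst z ** snd z) -` Om)"
    using assms(1) by (simp add: open_vimage)
  moreover have "(g, h) \<in> (\<lambda>z. fst z ** snd z) -` Om" using assms(2) by simp
  ultimately obtain O1 O2 where "open O1" "open O2" "(g, h) \<in> O1 \<times> O2"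
      "O1 \<times> O2 \<subseteq> (\<lambda>z. fst z ** snd z) -` Om"
    by (rule open_prod_elim)
  then show ?thesis using that[of O1 O2] by (auto simp: subset_iff)
qed

lemma continuous_map_mult:
  "continuous_map (prod_topology lie_top lie_top) lie_top (\<lambda>(g, h). g ** h)"
  unfolding continuous_map_def
proof (intro conjI allI impI)
  show "(\<lambda>(g, h). g ** h) \<in> topspace (prod_topology lie_top lie_top) \<rightarrow> topspace lie_top"
    using carrier_mult by auto
  fix W assume W: "openin lie_top W"
  show "openin (prod_topology lie_top lie_top)
     {x \<in> topspace (prod_topology lie_top lie_top). (case x of (g, h) \<Rightarrow> g ** h) \<in> W}"
    unfolding openin_prod_topology_alt
  proof (intro allI impI)
    fix g h assume "(g, h) \<in> {x \<in> topspace (prod_topology lie_top lie_top). (case x of (g, h) \<Rightarrow> g ** h) \<in> W}"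
    then have gh: "g \<in> carrier" "h \<in> carrier" "g ** h \<in> W" by auto
    then obtain Om where Om: "open Om" "g ** h \<in> Om" "\<And>k. reach Om (g ** h) k \<Longrightarrow> k \<in> W"
      using W unfolding openin_lie_top by meson
    then obtain O1 O2 where O: "open O1" "open O2" "g \<in> O1" "h \<in> O2"
      "\<And>x y. x \<in> O1 \<Longrightarrow> y \<in> O2 \<Longrightarrow> x ** y \<in> Om"
      using open_nbhds_mult by metis
    have "{k. reach O1 g k} \<times> {k. reach O2 h k} \<subseteq>
        {x \<in> topspace (prod_topology lie_top lie_top). (case x of (g, h) \<Rightarrow> g ** h) \<in> W}"
      using gh O Om(3) carrier_reach reach_mult[of g h O2 O1] by auto
    then show "\<exists>U V. openin lie_top U \<and> openin lie_top V \<and> g \<in> U \<and> h \<in> V \<and>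
        U \<times> V \<subseteq> {x \<in> topspace (prod_topology lie_top lie_top). (case x of (g, h) \<Rightarrow> g ** h) \<in> W}"
      by (intro exI[of _ "{k. reach O1 g k}"] exI[of _ "{k. reach O2 h k}"])
        (use O gh in \<open>simp add: openin_reach reach.refl\<close>)
  qed
qed

lemma continuous_map_inverse: "continuous_map lie_top lie_top matrix_inv"
  unfolding continuous_map_def
proof (intro conjI allI impI)
  show "matrix_inv \<in> topspace lie_top \<rightarrow> topspace lie_top" using carrier_inv by auto
  fix W assume W: "openin lie_top W"
  show "openin lie_top {x \<in> topspace lie_top. matrix_inv x \<in> W}"
    unfolding openin_lie_top
  proof (intro conjI ballI)
    fix g assume "g \<in> {x \<in> topspace lie_top. matrix_inv x \<in> W}"
    then have g: "g \<in> carrier" "matrix_inv g \<in> W" by auto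
    then obtain Om where Om: "open Om" "matrix_inv g \<in> Om" "\<And>k. reach Om (matrix_inv g) k \<Longrightarrow> k \<in> W"
      using W unfolding openin_lie_top by meson
    obtain e where e: "e > 0" "ball (matrix_inv g) e \<subseteq> Om"
      using Om openE by blast
    obtain d where d: "d > 0"
      "\<And>x. invertible x \<Longrightarrow> dist x g < d \<Longrightarrow> dist (matrix_inv x) (matrix_inv g) < e"
      using matrix_inv_close[OF carrier_invertible[OF g(1)] e(1)] by blast
    have "k \<in> carrier \<and> matrix_inv k \<in> W" if "reach (ball g d) g k" for k
      using that g Om(3) e d carrier_invertible carrier_reach reach_inverse[OF g(1), of "ball g d" Om k]
      by (auto simp: dist_commute subset_iff)
    then show "\<exists>Om. open Om \<and> g \<in> Om \<and>
        (\<forall>k. reach Om g k \<longrightarrow> k \<in> {x \<in> topspace lie_top. matrix_inv x \<in> W})"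
      using d(1) by (intro exI[of _ "ball g d"]) auto
  qed auto
qed

text \<open>A short piece of the path lying in \<open>Om\<close> is itself a step, so nearby
  parameters give points reachable inside \<open>Om\<close>. This is continuity for the finer
  topology, which continuity as a map into matrices would not give.\<close>

lemma continuous_map_path:
  assumes X: "X \<in> A" and h: "h \<in> carrier"
  shows "continuous_map euclideanreal lie_top (\<lambda>t. mexp (t *\<^sub>R X) ** h)"
  unfolding continuous_map_def
proof (intro conjI allI impI)
  have car: "mexp (t *\<^sub>R X) ** h \<in> carrier" for t
    using X h A_closed by (intro carrier_step) auto
  then show "(\<lambda>t. mexp (t *\<^sub>R X) ** h) \<in> topspace euclideanreal \<rightarrow> topspace lie_top" by simp
  fix W assume W: "openin lie_top W"
  have "open {t. mexp (t *\<^sub>R X) ** h \<in> W}"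
    unfolding open_dist
  proof
    fix t assume "t \<in> {t. mexp (t *\<^sub>R X) ** h \<in> W}"
    then obtain Om where Om: "open Om" "mexp (t *\<^sub>R X) ** h \<in> Om"
      "\<And>k. reach Om (mexp (t *\<^sub>R X) ** h) k \<Longrightarrow> k \<in> W"
      using W unfolding openin_lie_top by force
    have "continuous_on UNIV (\<lambda>t. mexp (t *\<^sub>R X) ** h)"
      by (intro matrix_mult.continuous_on continuous_on_mexp continuous_on_const)
    then have "open ((\<lambda>t. mexp (t *\<^sub>R X) ** h) -` Om)" using Om by (simp add: open_vimage)
    moreover have "t \<in> (\<lambda>t. mexp (t *\<^sub>R X) ** h) -` Om" using Om(2) by simp
    ultimately obtain e where e: "e > 0" "\<And>s. dist s t < e \<Longrightarrow> mexp (s *\<^sub>R X) ** h \<in> Om"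
      unfolding open_dist by (metis vimage_eq)
    have "mexp (s *\<^sub>R X) ** h \<in> W" if s: "dist s t < e" for s
    proof -
      have *: "mexp (r *\<^sub>R (s - t) *\<^sub>R X) ** (mexp (t *\<^sub>R X) ** h) = mexp ((t + r * (s - t)) *\<^sub>R X) ** h" for r
        using mexp_scaleR_add[of "r * (s - t)" t X] by (simp add: matrix_mul_assoc add.commute)
      have "reach Om (mexp (t *\<^sub>R X) ** h) (mexp ((s - t) *\<^sub>R X) ** (mexp (t *\<^sub>R X) ** h))"
      proof (rule reach_step)
        show "(s - t) *\<^sub>R X \<in> A" using X A_closed by auto
        fix r :: real assume r: "0 \<le> r" "r \<le> 1"
        have "\<bar>r * (s - t)\<bar> \<le> \<bar>s - t\<bar>" using r by (simp add: abs_mult mult_left_le_one_le)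
        then show "mexp (r *\<^sub>R (s - t) *\<^sub>R X) ** (mexp (t *\<^sub>R X) ** h) \<in> Om"
          unfolding * using s by (intro e) (simp add: dist_real_def)
      qed
      then show ?thesis using Om(3) *[of 1] by simp
    qed
    then show "\<exists>e>0. \<forall>s. dist s t < e \<longrightarrow> s \<in> {t. mexp (t *\<^sub>R X) ** h \<in> W}" using e(1) by auto
  qed
  then show "openin euclideanreal {t \<in> topspace euclideanreal. mexp (t *\<^sub>R X) ** h \<in> W}" by simp
qed

lemma connected_space_lie_top: "connected_space lie_top"
proof -
  have "path_component_of lie_top (mat 1) g" if "g \<in> carrier" for g
    using that
  proof (induction rule: carrier_induct)
    case one
    then show ?case using carrier_one by (simp add: path_component_of_refl)
  next
    case (step X g)
    have "path_component_of lie_top g (mexp X ** g)"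
      unfolding path_component_of_def pathin_def
      using continuous_map_from_subtopology[OF continuous_map_path[OF step(1,2)], of "{0..1}"]
      by (intro exI[of _ "\<lambda>t. mexp (t *\<^sub>R X) ** g"]) simp
    then show ?case using step path_component_of_trans by metis
  qed
  then have "path_connected_space lie_top"
    unfolding path_connected_space_iff_path_component
    by (metis path_component_of_sym path_component_of_trans topspace_lie_top)
  then show ?thesis by (rule path_connected_imp_connected_space)
qed

end

text \<open>Difference quotients stay in \<open>S\<close>, and a subspace of a finite-dimensional
  space is closed.\<close>

lemma has_vector_derivative_imp_subspace:
  fixes x :: "real \<Rightarrow> 'a::euclidean_space"
  assumes S: "subspace S" and d: "(x has_vector_derivative x') (at t)"
    and x: "\<And>s. \<bar>s - t\<bar> < e \<Longrightarrow> x s \<in> S" and "e > 0"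
  shows "x' \<in> S"
proof -
  have "((\<lambda>h. norm (x (t + h) - x t - h *\<^sub>R x') / norm h) \<longlongrightarrow> 0) (at 0)"
    using d unfolding has_vector_derivative_def has_derivative_at by blast
  moreover have "\<forall>\<^sub>F h in at 0. norm (x (t + h) - x t - h *\<^sub>R x') / norm h
      = norm ((x (t + h) - x t) /\<^sub>R h - x')"
  proof (rule eventually_at_filter[THEN iffD2], intro always_eventually allI impI)
    fix h :: real assume "h \<noteq> 0"
    then have "(x (t + h) - x t) /\<^sub>R h - x' = (x (t + h) - x t - h *\<^sub>R x') /\<^sub>R h"
      by (simp add: scaleR_diff_right)
    then show "norm (x (t + h) - x t - h *\<^sub>R x') / norm h = norm ((x (t + h) - x t) /\<^sub>R h - x')"
      by (simp add: divide_inverse mult.commute)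
  qed
  ultimately have "((\<lambda>h. norm ((x (t + h) - x t) /\<^sub>R h - x')) \<longlongrightarrow> 0) (at 0)"
    using Lim_transform_eventually by force
  then have lim: "((\<lambda>h. (x (t + h) - x t) /\<^sub>R h) \<longlongrightarrow> x') (at 0)"
    by (simp add: LIM_zero_iff tendsto_norm_zero_iff)
  have "\<forall>\<^sub>F h in at 0. (x (t + h) - x t) /\<^sub>R h \<in> S"
    unfolding eventually_at using \<open>e > 0\<close> x[of "t + _"] x[of t]
    by (intro exI[of _ e]) (auto simp: dist_real_def intro!: subspace_scale[OF S] subspace_diff[OF S] x)
  then show ?thesis
    using Lim_in_closed_set[OF closed_subspace[OF S] _ _ lim] by simp
qed

lemmas C_k_on_matrix_mult = C_k_on_bilinear[OF _ matrix_mult.bounded_bilinear_axioms]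

context lie_matrices
begin

section \<open>Coordinates near the identity adapted to the Lie algebra\<close>

definition proj :: "real^'n^'n \<Rightarrow> real^'n^'n" where
  "proj x = (\<Sum>b\<in>set bs. (x \<bullet> b) *\<^sub>R b)"

lemma bounded_linear_proj: "bounded_linear proj"
  unfolding proj_def
  by (intro bounded_linear_sum bounded_linear_compose[OF bounded_linear_scaleR_left]
      bounded_linear_inner_left)

interpretation proj: bounded_linear proj
  by (rule bounded_linear_proj)

lemma proj_in: "proj x \<in> A"
  unfolding proj_def A_eq by (intro span_sum span_scale span_base)

lemma proj_id: "x \<in> A \<Longrightarrow> proj x = x"
proof -
  assume "x \<in> A"
  have "proj x = x" if "x \<in> span (set bs)" for x
    using that
  proof (induction rule: span_induct_alt)
    case (step c b y)
    have "proj b = (\<Sum>c\<in>set bs. if c = b then b else 0)"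
      unfolding proj_def using step by (intro sum.cong) (auto simp: orthonormal)
    then have "proj b = b" using step by simp
    then show ?case using step by (simp add: proj.add proj.scaleR)
  qed simp
  then show ?thesis using \<open>x \<in> A\<close> A_eq by simp
qed

lemma proj_proj [simp]: "proj (proj x) = proj x"
  by (rule proj_id[OF proj_in])

text \<open>Canonical coordinates of the second kind: a product of one-parameter subgroups, one for
  each basis vector.\<close>

primrec Phi :: "(real^'n^'n) list \<Rightarrow> real^'n^'n \<Rightarrow> real^'n^'n" where
  "Phi [] x = mat 1"
| "Phi (b # cs) x = mexp ((x \<bullet> b) *\<^sub>R b) ** Phi cs x"

lemma Phi_carrier: "set cs \<subseteq> A \<Longrightarrow> Phi cs x \<in> carrier"
  by (induction cs) (auto intro!: carrier_one carrier_step A_closed)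

lemma continuous_map_Phi: "set cs \<subseteq> A \<Longrightarrow> continuous_map euclidean lie_top (Phi cs)"
proof (induction cs)
  case Nil
  then show ?case using carrier_one by simp
next
  case (Cons b cs)
  have "continuous_map euclidean euclideanreal (\<lambda>x. x \<bullet> b)"
    by (simp add: continuous_on_inner)
  moreover have "continuous_map euclideanreal lie_top (\<lambda>t. mexp (t *\<^sub>R b))"
    using continuous_map_path[of b "mat 1"] Cons carrier_one by simp
  ultimately have "continuous_map euclidean lie_top ((\<lambda>t. mexp (t *\<^sub>R b)) \<circ> (\<lambda>x. x \<bullet> b))"
    by (rule continuous_map_compose)
  then have "continuous_map euclidean (prod_topology lie_top lie_top)
      (\<lambda>x. (mexp ((x \<bullet> b) *\<^sub>R b), Phi cs x))"
    using Cons by (intro continuous_map_pairedI) (auto simp: o_def)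
  from continuous_map_compose[OF this continuous_map_mult] show ?case
    by (simp add: o_def)
qed

lemma C_k_on_Phi: "C_k_on k UNIV (Phi cs)"
proof (induction cs)
  case (Cons b cs)
  have "C_k_on k UNIV (\<lambda>x. mexp ((x \<bullet> b) *\<^sub>R b))"
    by (rule C_k_on_compose[where f = "\<lambda>t. mexp (t *\<^sub>R b)" and V = UNIV])
      (auto intro: C_k_on_mexp C_k_on_bounded_linear bounded_linear_inner_left)
  then have "C_k_on k UNIV (\<lambda>x. mexp ((x \<bullet> b) *\<^sub>R b) ** Phi cs x)"
    using Cons by (rule C_k_on_matrix_mult[OF open_UNIV])
  then show ?case by simp
qed (simp add: C_k_on_const)

lemma mexp_inner_has_vector_derivative:
  assumes "(x has_vector_derivative x') (at t)"
  shows "((\<lambda>t. mexp ((x t \<bullet> b) *\<^sub>R b)) has_vector_derivative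
    ((x' \<bullet> b) *\<^sub>R b) ** mexp ((x t \<bullet> b) *\<^sub>R b)) (at t)"
proof -
  have "((\<lambda>t. x t \<bullet> b) has_vector_derivative x' \<bullet> b) (at t)"
    by (rule bounded_linear.has_vector_derivative[OF bounded_linear_inner_left assms])
  from vector_diff_chain_at[OF this mexp_has_vector_derivative[of b _ UNIV]]
  show ?thesis by (simp add: o_def matrix_mult.scaleR_left)
qed

text \<open>Differentiating the first factor contributes a multiple of \<open>b\<close>;
  differentiating the others contributes an element of \<open>A\<close> conjugated by the first
  factor, again in \<open>A\<close> by \<open>carrier_Ad\<close>. So the logarithmic derivative of
  \<open>Phi\<close> along any curve lies in \<open>A\<close>.\<close>

lemma Phi_has_vector_derivative:
  assumes "set cs \<subseteq> A" and x: "(x has_vector_derivative x') (at t)"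
  shows "\<exists>w\<in>A. ((\<lambda>t. Phi cs (x t)) has_vector_derivative w ** Phi cs (x t)) (at t)"
  using assms(1)
proof (induction cs)
  case Nil
  have "((\<lambda>t. Phi [] (x t)) has_vector_derivative 0 ** Phi [] (x t)) (at t)"
    by (simp add: matrix_mult.zero_left)
  then show ?case using A_closed by blast
next
  case (Cons b cs)
  define g where "g = mexp ((x t \<bullet> b) *\<^sub>R b)"
  obtain w where w: "w \<in> A" "((\<lambda>t. Phi cs (x t)) has_vector_derivative w ** Phi cs (x t)) (at t)"
    using Cons by auto
  have g: "g \<in> carrier"
    unfolding g_def using Cons.prems by (intro mexp_carrier A_closed) auto
  define w' where "w' = g ** w ** matrix_inv g + (x' \<bullet> b) *\<^sub>R b"
  have "w' \<in> A"
    unfolding w'_def using Cons.prems w carrier_Ad[OF g] by (intro A_closed) auto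
  moreover have "((\<lambda>t. mexp ((x t \<bullet> b) *\<^sub>R b) ** Phi cs (x t)) has_vector_derivative
     g ** (w ** Phi cs (x t)) + ((x' \<bullet> b) *\<^sub>R b ** g) ** Phi cs (x t)) (at t)"
    unfolding g_def
    by (rule matrix_mult.has_vector_derivative[OF mexp_inner_has_vector_derivative[OF x] w(2)])
  moreover have "g ** (w ** Phi cs (x t)) + ((x' \<bullet> b) *\<^sub>R b ** g) ** Phi cs (x t) = w' ** (g ** Phi cs (x t))"
  proof -
    have "g ** w ** matrix_inv g ** (g ** Phi cs (x t)) = g ** w ** (matrix_inv g ** g) ** Phi cs (x t)"
      by (simp add: matrix_mul_assoc)
    then show ?thesis
      using g by (simp add: w'_def matrix_mult.add_left matrix_inv_mult carrier_invertible matrix_mul_assoc)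
  qed
  ultimately show ?case by (auto simp: g_def)
qed

lemma Phi_zero [simp]: "Phi cs 0 = mat 1"
  by (induction cs) auto

lemma Phi_has_derivative_zero:
  "(Phi cs has_derivative (\<lambda>h. \<Sum>b\<leftarrow>cs. (h \<bullet> b) *\<^sub>R b)) (at 0)"
proof (induction cs)
  case (Cons b cs)
  have "((\<lambda>t. mexp (t *\<^sub>R b)) has_derivative (\<lambda>h. h *\<^sub>R b)) (at ((0 :: real^'n^'n) \<bullet> b))"
    using mexp_has_vector_derivative[of b 0 UNIV] by (simp add: has_vector_derivative_def)
  from has_derivative_compose[where f = "\<lambda>x. x \<bullet> b", OF has_derivative_inner_left[OF has_derivative_ident] this]
  have "((\<lambda>x. mexp ((x \<bullet> b) *\<^sub>R b)) has_derivative (\<lambda>h. (h \<bullet> b) *\<^sub>R b)) (at 0)"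
    by simp
  from matrix_mult.FDERIV[OF this Cons] show ?case by (simp add: add.commute)
qed simp

text \<open>Extends \<open>Phi bs\<close> from \<open>A\<close> to a local diffeomorphism of the
  matrix space. The component orthogonal to \<open>A\<close> enters through a factor on the right,
  out of the way of the left multiplications that make up steps.\<close>

definition Psi :: "real^'n^'n \<Rightarrow> real^'n^'n" where
  "Psi x = Phi bs x ** (mat 1 + (x - proj x))"

lemma bs_A: "set bs \<subseteq> A"
  using A_eq span_superset by blast

lemma Psi_A: "x \<in> A \<Longrightarrow> Psi x = Phi bs x"
  by (simp add: Psi_def proj_id)

lemma C_k_on_Psi: "C_k_on k UNIV Psi"
proof -
  have "C_k_on k UNIV (\<lambda>x. mat 1 + (x - proj x))"
    by (intro C_k_on_add C_k_on_const C_k_on_bounded_linear bounded_linear_sub bounded_linear_ident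
        bounded_linear_proj) auto
  from C_k_on_matrix_mult[OF open_UNIV C_k_on_Phi this] show ?thesis
    by (simp add: Psi_def[abs_def])
qed

lemma Psi_has_derivative_zero: "(Psi has_derivative (\<lambda>h. h)) (at 0)"
proof -
  have P: "(Phi bs has_derivative proj) (at 0)"
    using Phi_has_derivative_zero[of bs] distinct
    by (simp add: proj_def[abs_def] sum_list_distinct_conv_sum_set)
  have "((\<lambda>x. mat 1 + (x - proj x)) has_derivative (\<lambda>h. 0 + (h - proj h))) (at 0)"
    by (intro has_derivative_add has_derivative_const has_derivative_diff has_derivative_ident
        bounded_linear_imp_has_derivative bounded_linear_proj)
  from matrix_mult.FDERIV[OF P this] show ?thesis
    by (simp add: Psi_def[abs_def] proj.zero)
qed

definition chart ::
  "(real^'n^'n) set \<Rightarrow> (real^'n^'n) set \<Rightarrow> (real^'n^'n \<Rightarrow> real^'n^'n) \<Rightarrow> bool" where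
  "chart U V \<gamma> \<longleftrightarrow> open U \<and> 0 \<in> U \<and> open V \<and> homeomorphism U V Psi \<gamma> \<and> smooth_on V \<gamma> \<and>
    (\<gamma> has_derivative (\<lambda>h. h)) (at (mat 1)) \<and>
    (\<forall>k\<in>Psi ` (U \<inter> A). \<forall>Y\<in>A. (\<forall>t. 0 \<le> t \<longrightarrow> t \<le> 1 \<longrightarrow> mexp (t *\<^sub>R Y) ** k \<in> V)
      \<longrightarrow> mexp Y ** k \<in> Psi ` (U \<inter> A))"

text \<open>If \<open>c\<close> solves \<open>c' = Y ** c\<close> and \<open>c = Phi bs x ** (mat 1 + s)\<close> with \<open>s = x - proj x\<close>, then
  \<open>s' = z ** (mat 1 + s)\<close> for some \<open>z \<in> A\<close>. Applying \<open>proj\<close>, which annihilates \<open>s'\<close>, gives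
  \<open>z = - proj (z ** s)\<close>, and this forces \<open>z = 0\<close> once \<open>s\<close> is small. So the complementary
  coordinate \<open>s\<close> is constant along the flow.\<close>

lemma chart_exists: obtains U V \<gamma> where "chart U V \<gamma>"
proof -
  obtain K1 where K1: "K1 > 0" "\<And>(a :: real^'n^'n) (b :: real^'n^'n). norm (a ** b) \<le> norm a * norm b * K1"
    using matrix_mult.pos_bounded by blast
  obtain K2 where K2: "K2 > 0" "\<And>a. norm (proj a) \<le> norm a * K2"
    using proj.pos_bounded by blast
  define K where "K = K1 * K2"
  have K: "K > 0" "norm (proj (a ** b)) \<le> norm a * norm b * K" for a b :: "real^'n^'n"
  proof -
    have "norm (proj (a ** b)) \<le> norm (a ** b) * K2" by (rule K2)
    also have "\<dots> \<le> norm a * norm b * K1 * K2" using K1 K2 by (intro mult_right_mono) auto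
    finally show "norm (proj (a ** b)) \<le> norm a * norm b * K" by (simp add: K_def mult_ac)
  qed (use K1 K2 in \<open>simp add: K_def\<close>)
  \<comment> \<open>On \<open>D\<close> the map sending \<open>z\<close> to
    \<open>- proj (z ** s)\<close> shrinks norms strictly, so 0 is its only fixed point.\<close>
  define D where "D = {x. norm (x - proj x) * K < 1}"
  have "open D"
    unfolding D_def
    by (intro open_Collect_less continuous_intros proj.continuous_on)
  have small: "z = 0" if "z \<in> A" "norm s * K < 1" "z + proj (z ** s) = 0" for z s
  proof (rule ccontr)
    assume "z \<noteq> 0"
    have "norm z = norm (proj (z ** s))"
      using that by (metis add_eq_0_iff norm_minus_cancel)
    also have "\<dots> \<le> norm z * (norm s * K)" using K(2)[of z s] by (simp add: mult_ac)
    also have "\<dots> < norm z * 1"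
      using that \<open>z \<noteq> 0\<close> by (intro mult_strict_left_mono) auto
    finally show False by simp
  qed
  have "0 \<in> D" by (simp add: D_def proj.zero)
  moreover have "smooth_on D Psi"
    unfolding smooth_on_def using C_k_on_Psi C_k_on_subset by blast
  ultimately obtain U V \<gamma> where UV: "open U" "U \<subseteq> D" "0 \<in> U" "open V"
    and hom: "homeomorphism U V Psi \<gamma>" and sm: "smooth_on V \<gamma>"
    using smooth_inverse_function[OF \<open>open D\<close> _ _ Psi_has_derivative_zero] by metis
  have der\<gamma>: "(\<gamma> has_derivative frechet_derivative \<gamma> (at y)) (at y)" if "y \<in> V" for y
    using sm that C_k_on_has_derivative[of 0 V \<gamma>] unfolding smooth_on_def by blast
  have Psi0: "Psi 0 = mat 1" by (simp add: Psi_def proj.zero)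
  have leaf: "mexp Y ** k \<in> Psi ` (U \<inter> A)"
    if k: "k \<in> Psi ` (U \<inter> A)" and Y: "Y \<in> A"
      and path: "\<And>t. 0 \<le> t \<Longrightarrow> t \<le> 1 \<Longrightarrow> mexp (t *\<^sub>R Y) ** k \<in> V" for k Y
  proof -
    define c where "c t = mexp (t *\<^sub>R Y) ** k" for t
    define x where "x t = \<gamma> (c t)" for t
    define s where "s t = x t - proj (x t)" for t
    have c: "(c has_vector_derivative Y ** c t) (at t)" for t
      unfolding c_def
      using bounded_linear.has_vector_derivative[OF matrix_mult.bounded_linear_left
          mexp_has_vector_derivative[of Y t UNIV], of k]
      by (simp add: matrix_mul_assoc)
    have cont: "continuous_on UNIV c"
      unfolding c_def by (intro matrix_mult.continuous_on continuous_on_mexp continuous_on_const)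
    have "(s has_vector_derivative 0) (at t)" if t: "t \<in> {0..1}" for t
    proof -
      have cV: "c t \<in> V" using path t by (simp add: c_def)
      define x' where "x' = frechet_derivative \<gamma> (at (c t)) (Y ** c t)"
      have x: "(x has_vector_derivative x') (at t)"
        unfolding x_def[abs_def] x'_def
        using vector_derivative_diff_chain_within[of c "Y ** c t" t UNIV \<gamma>] c der\<gamma>[OF cV]
        by (auto simp: o_def intro: has_derivative_at_withinI)
      obtain w where w: "w \<in> A" "((\<lambda>t. Phi bs (x t)) has_vector_derivative w ** Phi bs (x t)) (at t)"
        using Phi_has_vector_derivative[OF bs_A x] by blast
      define s' where "s' = x' - proj x'"
      have s: "(s has_vector_derivative s') (at t)"
        unfolding s_def[abs_def] s'_def
        by (intro has_vector_derivative_diff x proj.has_vector_derivative)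
      have "((\<lambda>t. mat 1 + s t) has_vector_derivative 0 + s') (at t)"
        by (intro has_vector_derivative_add has_vector_derivative_const s)
      from matrix_mult.has_vector_derivative[OF w(2) this]
      have d1: "((\<lambda>t. Phi bs (x t) ** (mat 1 + s t)) has_vector_derivative
         Phi bs (x t) ** s' + w ** Phi bs (x t) ** (mat 1 + s t)) (at t)"
        by simp
      have op: "open (c -` V)" using cont UV by (simp add: open_vimage)
      have eq: "Phi bs (x u) ** (mat 1 + s u) = c u" if "u \<in> c -` V" for u
        using that hom by (simp add: s_def x_def homeomorphism_def flip: Psi_def)
      have "(c has_vector_derivative
         Phi bs (x t) ** s' + w ** Phi bs (x t) ** (mat 1 + s t)) (at t)"
        by (rule has_vector_derivative_transform_within_open[OF d1 op]) (use cV eq in auto)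
      then have "Phi bs (x t) ** s' + w ** Phi bs (x t) ** (mat 1 + s t) = Y ** c t"
        using c vector_derivative_unique_at by blast
      then have e1: "Phi bs (x t) ** s' = (Y - w) ** Phi bs (x t) ** (mat 1 + s t)"
      proof -
        have "Y ** c t = Y ** Phi bs (x t) ** (mat 1 + s t)"
          using eq[of t] cV by (metis matrix_mul_assoc vimage_eq)
        then show ?thesis
          using \<open>Phi bs (x t) ** s' + w ** Phi bs (x t) ** (mat 1 + s t) = Y ** c t\<close>
          by (simp add: matrix_mult.diff_left eq_diff_eq)
      qed
      \<comment> \<open>\<open>w\<close> is the logarithmic derivative of
        \<open>Phi bs (x t)\<close>. The discrepancy \<open>Y - w\<close> is moved to the other side
        of \<open>Phi bs (x t)\<close> by conjugation and stays in \<open>A\<close>.\<close>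
      define z where "z = matrix_inv (Phi bs (x t)) ** (Y - w) ** Phi bs (x t)"
      have ph: "Phi bs (x t) \<in> carrier" using Phi_carrier[OF bs_A] .
      have "z \<in> A" unfolding z_def using ph Y w by (intro carrier_Ad' A_closed)
      have "s' = matrix_inv (Phi bs (x t)) ** (Phi bs (x t) ** s')"
        using ph by (simp add: matrix_mul_assoc matrix_inv_mult carrier_invertible)
      also have "\<dots> = z + z ** s t"
        unfolding e1 z_def by (simp add: matrix_mul_assoc matrix_mult.add_right)
      finally have s'z: "s' = z + z ** s t" .
      have "proj s' = 0" by (simp add: s'_def proj.diff)
      then have "z + proj (z ** s t) = 0"
        using \<open>z \<in> A\<close> by (simp add: s'z proj.add proj_id)
      moreover have "x t \<in> D"
        using hom cV UV by (auto simp: x_def homeomorphism_def)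
      ultimately have "z = 0"
        using small[OF \<open>z \<in> A\<close>, of "s t"] by (simp add: D_def s_def)
      then show ?thesis using s s'z by (simp add: matrix_mult.zero_left)
    qed
    then have "\<And>t. t \<in> {0..1} \<Longrightarrow> (s has_vector_derivative 0) (at t within {0..1})"
      using has_vector_derivative_at_within by blast
    then obtain c0 where "\<And>t. t \<in> {0..1} \<Longrightarrow> s t = c0"
      using has_vector_derivative_zero_constant[of "{0..1}" s] by auto
    then have "s 1 = s 0" by simp
    obtain x0 where x0: "x0 \<in> U" "x0 \<in> A" "k = Psi x0" using k by blast
    have "x 0 = x0" using hom x0 by (simp add: x_def c_def homeomorphism_def)
    then have "s 1 = 0" using \<open>s 1 = s 0\<close> x0 by (simp add: s_def proj_id)
    then have "x 1 \<in> A" using proj_in[of "x 1"] by (simp add: s_def)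
    moreover have "c 1 \<in> V" using path[of 1] by (simp add: c_def)
    then have "x 1 \<in> U" "Psi (x 1) = c 1"
      using hom by (auto simp: x_def homeomorphism_def)
    ultimately show ?thesis by (metis IntI c_def imageI scaleR_one)
  qed
  have "mat 1 \<in> V" using hom UV Psi0 by (metis homeomorphism_def imageI)
  have der1: "(\<gamma> has_derivative (\<lambda>h. h)) (at (mat 1))"
  proof -
    have g0: "\<gamma> (mat 1) = 0" using hom UV Psi0 unfolding homeomorphism_def by metis
    have "(Psi has_derivative (\<lambda>h. h)) (at (\<gamma> (mat 1)))"
      using Psi_has_derivative_zero g0 by simp
    from has_derivative_compose[OF der\<gamma>[OF \<open>mat 1 \<in> V\<close>] this]
    have "((\<lambda>y. Psi (\<gamma> y)) has_derivative frechet_derivative \<gamma> (at (mat 1))) (at (mat 1))" .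
    moreover have "((\<lambda>y. Psi (\<gamma> y)) has_derivative (\<lambda>h. h)) (at (mat 1))"
      by (rule has_derivative_transform_within_open[OF has_derivative_ident UV(4) \<open>mat 1 \<in> V\<close>])
         (use hom in \<open>simp add: homeomorphism_def\<close>)
    ultimately have "frechet_derivative \<gamma> (at (mat 1)) = (\<lambda>h. h)"
      using has_derivative_unique by blast
    then show ?thesis using der\<gamma>[OF \<open>mat 1 \<in> V\<close>] by simp
  qed
  have "chart U V \<gamma>"
    unfolding chart_def using UV(1,3,4) hom sm der1 leaf by blast
  then show ?thesis by (rule that)
qed

end

context lie_matrices
begin

section \<open>Submanifold structure of the generated group\<close>

lemma chart_reach:
  assumes "chart U V \<gamma>"
  shows "reach V k l \<Longrightarrow> k \<in> Psi ` (U \<inter> A) \<Longrightarrow> l \<in> Psi ` (U \<inter> A)"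
  by (induction rule: reach.induct) (use assms in \<open>auto simp: chart_def\<close>)

lemma chart_carrier: "Psi ` (U \<inter> A) \<subseteq> carrier"
  using Phi_carrier[OF bs_A] by (auto simp: Psi_A)

lemma chart_one:
  assumes "chart U V \<gamma>"
  shows "mat 1 \<in> Psi ` (U \<inter> A)" "mat 1 \<in> V"
proof -
  have "Psi 0 = mat 1" using A_closed by (simp add: Psi_A)
  then show "mat 1 \<in> Psi ` (U \<inter> A)" "mat 1 \<in> V"
    using assms A_closed unfolding chart_def homeomorphism_def by (metis IntI imageI)+
qed

lemma right_translation_vimage:
  fixes h :: "real^'n^'n" and S :: "(real^'n^'n) set"
  assumes "invertible h"
  shows "(\<lambda>x. x ** h) ` S = {y. y ** matrix_inv h \<in> S}"
proof -
  have "x ** h ** matrix_inv h = x" "x ** matrix_inv h ** h = x" for x :: "real^'n^'n"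
    using assms by (simp_all add: matrix_inv_mult flip: matrix_mul_assoc)
  then show ?thesis by (auto simp: image_iff) metis
qed

lemma open_right_translation:
  fixes h :: "real^'n^'n" and S :: "(real^'n^'n) set"
  assumes "invertible h" "open S"
  shows "open ((\<lambda>x. x ** h) ` S)"
proof -
  have "continuous_on UNIV (\<lambda>y :: real^'n^'n. y ** matrix_inv h)"
    by (intro matrix_mult.continuous_on continuous_on_id continuous_on_const)
  then have "open ((\<lambda>y :: real^'n^'n. y ** matrix_inv h) -` S)"
    using assms(2) by (simp add: open_vimage)
  then show ?thesis by (simp add: right_translation_vimage[OF assms(1)] vimage_def)
qed

text \<open>Right translation by \<open>h\<close> commutes with steps, so the chart at the identity
  serves at every \<open>h\<close>. The slice is open for \<open>lie_top\<close> because steps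
  inside \<open>Om\<close> cannot leave it.\<close>

lemma chart_neighbourhood:
  assumes ch: "chart U V \<gamma>" and h: "h \<in> carrier"
  defines "W \<equiv> (\<lambda>x. x ** h) ` Psi ` (U \<inter> A)"
  shows "openin lie_top W" "h \<in> W" "smooth_submanifold (dim A) W"
    "subtopology lie_top W = top_of_set W"
proof -
  have inv: "invertible h" using h by (rule carrier_invertible)
  have hh: "x ** h ** matrix_inv h = x" "x ** matrix_inv h ** h = x" for x :: "real^'n^'n"
    using inv by (simp_all add: matrix_inv_mult flip: matrix_mul_assoc)
  have UV: "open U" "open V" "homeomorphism U V Psi \<gamma>" "smooth_on V \<gamma>"
    using ch by (auto simp: chart_def)
  have PU: "Psi ` U = V" and gV: "\<gamma> ` V = U" and gP: "\<And>x. x \<in> U \<Longrightarrow> \<gamma> (Psi x) = x"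
    and Pg: "\<And>y. y \<in> V \<Longrightarrow> Psi (\<gamma> y) = y" and contg: "continuous_on V \<gamma>" and contP: "continuous_on U Psi"
    using UV(3) by (auto simp: homeomorphism_def)
  define Om :: "(real^'n^'n) set" where "Om = (\<lambda>x. x ** h) ` V"
  have Om: "open Om" unfolding Om_def using inv UV(2) by (rule open_right_translation)
  have Om_iff: "y \<in> Om \<longleftrightarrow> y ** matrix_inv h \<in> V" for y
    unfolding Om_def right_translation_vimage[OF inv] by simp
  have W_iff: "y \<in> W \<longleftrightarrow> y ** matrix_inv h \<in> Psi ` (U \<inter> A)" for y
    unfolding W_def right_translation_vimage[OF inv] by simp
  have WOm: "W \<subseteq> Om" using PU by (auto simp: W_def Om_def)
  have Wcar: "W \<subseteq> carrier"
    unfolding W_def using chart_carrier h carrier_mult by blast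
  show W: "openin lie_top W"
    unfolding openin_lie_top
  proof (intro conjI ballI Wcar)
    fix k assume k: "k \<in> W"
    have "l \<in> W" if "reach Om k l" for l
    proof -
      have "reach V (k ** matrix_inv h) (l ** matrix_inv h)"
        using that by (rule reach_right) (simp add: Om_iff)
      then show ?thesis using chart_reach[OF ch] k by (simp add: W_iff)
    qed
    then show "\<exists>Om. open Om \<and> k \<in> Om \<and> (\<forall>l. reach Om k l \<longrightarrow> l \<in> W)"
      using Om k WOm by blast
  qed
  show "h \<in> W" using chart_one[OF ch] inv by (simp add: W_iff matrix_inv_mult)
  define \<phi> where "\<phi> y = \<gamma> (y ** matrix_inv h)" for y :: "real^'n^'n"
  define \<psi> where "\<psi> x = Psi x ** h" for x
  have cont\<phi>: "continuous_on Om \<phi>"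
    unfolding \<phi>_def
    by (rule continuous_on_compose2[OF contg])
       (auto simp: Om_iff intro!: matrix_mult.continuous_on continuous_on_id continuous_on_const)
  have cont\<psi>: "continuous_on U \<psi>"
    unfolding \<psi>_def by (intro matrix_mult.continuous_on contP continuous_on_const)
  have hom: "homeomorphism Om U \<phi> \<psi>"
    unfolding homeomorphism_def
  proof (intro conjI ballI cont\<phi> cont\<psi>)
    show "\<phi> ` Om = U"
      unfolding Om_def image_image \<phi>_def hh by (rule gV)
    show "\<psi> ` U = Om" using PU by (auto simp: \<psi>_def Om_def)
    show "\<psi> (\<phi> x) = x" if "x \<in> Om" for x using that Pg by (simp add: \<phi>_def \<psi>_def Om_iff hh)
    show "\<phi> (\<psi> x) = x" if "x \<in> U" for x using that gP by (simp add: \<phi>_def \<psi>_def hh)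
  qed
  have chart: "\<phi> ` (Om \<inter> W) = U \<inter> A"
  proof -
    have "Om \<inter> W = \<psi> ` (U \<inter> A)" using WOm by (auto simp: W_def \<psi>_def image_image)
    moreover have "\<phi> ` \<psi> ` (U \<inter> A) = U \<inter> A"
    proof -
      have "(\<lambda>x. \<phi> (\<psi> x)) ` (U \<inter> A) = (\<lambda>x. x) ` (U \<inter> A)"
        using hom unfolding homeomorphism_def by (intro image_cong) auto
      then show ?thesis by (simp add: image_image)
    qed
    ultimately show ?thesis by simp
  qed
  have sm: "smooth_on Om \<phi>" "smooth_on U \<psi>"
  proof -
    have "C_k_on k Om \<phi>" for k
      unfolding \<phi>_def[abs_def]
    proof (rule C_k_on_compose[where g = "\<lambda>y. y ** matrix_inv h", OF Om UV(2)])
      show "C_k_on k Om (\<lambda>y :: real^'n^'n. y ** matrix_inv h)"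
        by (intro C_k_on_bounded_linear Om matrix_mult.bounded_linear_left)
      show "C_k_on k V \<gamma>" using UV(4) by (simp add: smooth_on_def)
    qed (auto simp: Om_iff)
    then show "smooth_on Om \<phi>" by (simp add: smooth_on_def)
    have "C_k_on k U \<psi>" for k
      unfolding \<psi>_def[abs_def]
      by (intro C_k_on_linear_compose[where h = "\<lambda>x. x ** h"] UV matrix_mult.bounded_linear_left
          C_k_on_subset[OF C_k_on_Psi]) auto
    then show "smooth_on U \<psi>" by (simp add: smooth_on_def)
  qed
  show "smooth_submanifold (dim A) W"
    unfolding smooth_submanifold_def
  proof
    fix p assume "p \<in> W"
    then show "\<exists>U V \<phi> \<psi> (E :: (real^'n^'n) set).
        open U \<and> p \<in> U \<and> open V \<and>
        homeomorphism U V \<phi> \<psi> \<and> smooth_on U \<phi> \<and> smooth_on V \<psi> \<and>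
        subspace E \<and> dim E = dim A \<and> \<phi> ` (U \<inter> W) = V \<inter> E"
      using Om UV(1) WOm hom sm chart subspace_A by blast
  qed
  show "subtopology lie_top W = top_of_set W"
    unfolding topology_eq
  proof (intro allI iffI)
    fix S assume "openin (top_of_set W) S"
    then obtain T where T: "open T" "S = W \<inter> T" by (auto simp: openin_open)
    then have "S = (T \<inter> carrier) \<inter> W" using Wcar by blast
    then show "openin (subtopology lie_top W) S"
      using openin_ambient[OF T(1)] by (auto simp: openin_subtopology)
  next
    fix S assume "openin (subtopology lie_top W) S"
    then obtain T where T: "openin lie_top T" "S = T \<inter> W" by (auto simp: openin_subtopology)
    \<comment> \<open>\<open>F\<close> inverts \<open>\<phi>\<close> on \<open>W\<close> and is
      continuous into \<open>lie_top\<close>. Hence on a single slice the intrinsic topology is no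
      finer than the subspace topology.\<close>
    define F where "F x = Phi bs x ** h" for x
    have "continuous_map euclidean (prod_topology lie_top lie_top) (\<lambda>x. (Phi bs x, h))"
      using continuous_map_Phi[OF bs_A] h by (intro continuous_map_pairedI) auto
    from continuous_map_compose[OF this continuous_map_mult]
    have "continuous_map euclidean lie_top F" by (simp add: o_def F_def[abs_def])
    then have "openin euclidean {x \<in> topspace euclidean. F x \<in> T}"
      using T(1) by (rule openin_continuous_map_preimage)
    then have "open {x. F x \<in> T}" by simp
    then have "open (Om \<inter> \<phi> -` {x. F x \<in> T})"
      by (rule continuous_open_preimage[OF cont\<phi> Om])
    moreover have "S = W \<inter> (Om \<inter> \<phi> -` {x. F x \<in> T})"
    proof -
      have "F (\<phi> y) = y" if y: "y \<in> W" for y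
      proof -
        obtain x where x: "x \<in> U" "x \<in> A" "y = \<psi> x" using y by (auto simp: W_def \<psi>_def)
        then have "\<phi> y = x" using hom by (simp add: homeomorphism_def)
        then show ?thesis using x by (simp add: F_def \<psi>_def Psi_A)
      qed
      then show ?thesis using T WOm by auto
    qed
    ultimately show "openin (top_of_set W) S" by (auto simp: openin_open)
  qed
qed

section \<open>Second countability of the intrinsic topology\<close>

definition word :: "(real \<times> (real^'n^'n)) list \<Rightarrow> real^'n^'n" where
  "word l = foldr (\<lambda>(r, b) M. mexp (r *\<^sub>R b) ** M) l (mat 1)"

lemma word_simps [simp]: "word [] = mat 1" "word ((r, b) # l) = mexp (r *\<^sub>R b) ** word l"
  by (simp_all add: word_def)

lemma word_append: "word (l @ l') = word l ** word l'"
  by (induction l) (auto simp: matrix_mul_assoc)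

lemma word_carrier: "l \<in> lists (UNIV \<times> set bs) \<Longrightarrow> word l \<in> carrier"
proof (induction l)
  case (Cons p l)
  obtain r b where p: "p = (r, b)" by (cases p)
  then have "b \<in> A" using Cons.prems bs_A by auto
  then show ?case using Cons p by (auto intro!: carrier_step A_closed)
qed (simp add: carrier_one)

lemma Phi_word: "set cs \<subseteq> set bs \<Longrightarrow> Phi cs x \<in> word ` lists (UNIV \<times> set bs)"
proof (induction cs)
  case Nil
  show ?case by (rule image_eqI[of _ _ "[]"]) auto
next
  case (Cons b cs)
  then obtain l where "l \<in> lists (UNIV \<times> set bs)" "Phi cs x = word l" by auto
  then show ?case
    using Cons.prems by (intro image_eqI[of _ _ "(x \<bullet> b, b) # l"]) auto
qed

text \<open>Elements of the carrier are products of \<open>mexp X\<close> with arbitrary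
  \<open>X\<close> in \<open>A\<close>. A small fraction \<open>Y\<close> of \<open>X\<close> keeps
  its segment inside a chart, where \<open>mexp Y\<close> is a value of \<open>Phi bs\<close> and so
  a word in basis directions; a power of it recovers \<open>mexp X\<close>.\<close>

lemma carrier_word: "g \<in> carrier \<Longrightarrow> g \<in> word ` lists (UNIV \<times> set bs)"
proof (induction rule: carrier_induct)
  case one
  show ?case by (rule image_eqI[of _ _ "[]"]) auto
next
  case (step X k)
  obtain U V \<gamma> where ch: "chart U V \<gamma>" by (rule chart_exists)
  have "continuous_on UNIV (\<lambda>t. mexp (t *\<^sub>R X))" by (rule continuous_on_mexp)
  then have "open ((\<lambda>t. mexp (t *\<^sub>R X)) -` V)" using ch by (simp add: open_vimage chart_def)
  moreover have "0 \<in> (\<lambda>t. mexp (t *\<^sub>R X)) -` V" using chart_one[OF ch] by simp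
  ultimately obtain e where e: "e > 0" "ball 0 e \<subseteq> (\<lambda>t. mexp (t *\<^sub>R X)) -` V"
    using openE by blast
  obtain m where m: "inverse (real (Suc m)) < e" using reals_Archimedean[OF e(1)] by blast
  define Y where "Y = inverse (real (Suc m)) *\<^sub>R X"
  have Y: "Y \<in> A" unfolding Y_def using step A_closed by auto
  have "mexp Y ** mat 1 \<in> Psi ` (U \<inter> A)"
  proof (rule chart_reach[OF ch])
    show "reach V (mat 1) (mexp Y ** mat 1)"
    proof (rule reach_step[OF Y])
      fix t :: real assume t: "0 \<le> t" "t \<le> 1"
      have "t * inverse (real (Suc m)) \<le> 1 * inverse (real (Suc m))"
        using t by (intro mult_right_mono) auto
      then have "t * inverse (real (Suc m)) < e" using m by linarith
      then have "mexp ((t * inverse (real (Suc m))) *\<^sub>R X) \<in> V"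
        using e(2) t by (auto simp: subset_iff)
      then show "mexp (t *\<^sub>R Y) ** mat 1 \<in> V" by (simp add: Y_def)
    qed
  qed (rule chart_one[OF ch])
  then obtain x where "mexp Y = Phi bs x" by (auto simp: Psi_A)
  then obtain l where l: "l \<in> lists (UNIV \<times> set bs)" "mexp Y = word l"
    using Phi_word[of bs x] by auto
  have pow: "mexp (real j *\<^sub>R Y) ** k \<in> word ` lists (UNIV \<times> set bs)" for j
  proof (induction j)
    case 0
    then show ?case using step by simp
  next
    case (Suc j)
    then obtain l' where l': "l' \<in> lists (UNIV \<times> set bs)" "mexp (real j *\<^sub>R Y) ** k = word l'" by auto
    have "mexp (real (Suc j) *\<^sub>R Y) ** k = mexp Y ** (mexp (real j *\<^sub>R Y) ** k)"
      using mexp_scaleR_add[of 1 "real j" Y] by (simp add: matrix_mul_assoc add.commute)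
    then show ?case
      using l l' by (intro image_eqI[of _ _ "l @ l'"]) (auto simp: word_append)
  qed
  have "real (Suc m) *\<^sub>R Y = X" by (simp add: Y_def)
  then show ?case using pow[of "Suc m"] by simp
qed

text \<open>The density is for the intrinsic topology: each exponent moves to a rational one along
  its own one-parameter path inside a prescribed open set, and \<open>reach_mult\<close> combines
  the factors.\<close>

lemma rational_word_dense:
  "l \<in> lists (UNIV \<times> set bs) \<Longrightarrow> open Om \<Longrightarrow> word l \<in> Om \<Longrightarrow>
    \<exists>l'\<in>lists (\<rat> \<times> set bs). reach Om (word l) (word l')"
proof (induction l arbitrary: Om)
  case Nil
  then show ?case by (intro bexI[of _ "[]"]) (auto intro: reach.refl)
next
  case (Cons p l)
  obtain r b where p: "p = (r, b)" by (cases p)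
  have b: "b \<in> set bs" "b \<in> A" using Cons.prems(1) bs_A p by auto
  obtain O1 O2 where O: "open O1" "open O2" "mexp (r *\<^sub>R b) \<in> O1" "word l \<in> O2"
    "\<And>x y. x \<in> O1 \<Longrightarrow> y \<in> O2 \<Longrightarrow> x ** y \<in> Om"
    using open_nbhds_mult[OF Cons.prems(2), of "mexp (r *\<^sub>R b)" "word l"] Cons.prems(3) p by auto
  obtain l' where l': "l' \<in> lists (\<rat> \<times> set bs)" "reach O2 (word l) (word l')"
    using Cons.IH[OF _ O(2,4)] Cons.prems by auto
  have car: "mexp (r *\<^sub>R b) \<in> carrier" using b by (intro mexp_carrier A_closed)
  have path: "continuous_map euclideanreal lie_top (\<lambda>t. mexp (t *\<^sub>R b))"
    using continuous_map_path[OF b(2) carrier_one] by simp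
  have "open {t. reach O1 (mexp (r *\<^sub>R b)) (mexp (t *\<^sub>R b))}"
    using openin_continuous_map_preimage[OF path openin_reach[OF O(1,3) car]] by simp
  moreover have "r \<in> {t. reach O1 (mexp (r *\<^sub>R b)) (mexp (t *\<^sub>R b))}" by (simp add: reach.refl)
  ultimately obtain e where e: "e > 0" "ball r e \<subseteq> {t. reach O1 (mexp (r *\<^sub>R b)) (mexp (t *\<^sub>R b))}"
    using openE by blast
  obtain q where q: "q \<in> \<rat>" "r < q" "q < r + e" using Rats_dense_in_real[of r "r + e"] e(1) by auto
  then have "reach O1 (mexp (r *\<^sub>R b)) (mexp (q *\<^sub>R b))"
    using e(2) by (auto simp: subset_iff dist_real_def)
  then have "reach Om (mexp (r *\<^sub>R b) ** word l) (mexp (q *\<^sub>R b) ** word l')"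
    using reach_mult[OF car O(4) _ l'(2) O(3)] O(5) by blast
  then show ?case
    using q b l' p by (intro bexI[of _ "(q, b) # l'"]) auto
qed

lemma second_countable_lie_top: "second_countable lie_top"
proof -
  obtain B :: "(real^'n^'n) set set" where B: "countable B" "topological_basis B"
    using ex_countable_basis by blast
  define Q where "Q = word ` lists (\<rat> \<times> set bs)"
  have "countable ((\<rat> :: real set) \<times> set bs)"
    by (intro countable_SIGMA countable_rat countable_finite) simp
  then have "countable Q" unfolding Q_def by (intro countable_image countable_lists)
  have "Q \<subseteq> carrier" unfolding Q_def using word_carrier by (auto simp: lists_eq_set subset_iff)
  \<comment> \<open>A base set is determined by an ambient basic open set and a rational word in it.
    Such a word \<open>q\<close> is found by reaching it from \<open>h\<close>, and symmetry of
    \<open>reach\<close> puts \<open>h\<close> into the set around \<open>q\<close>.\<close>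
  define \<B> where "\<B> = (\<lambda>(Om, q). {k. reach Om q k}) ` {(Om, q). Om \<in> B \<and> q \<in> Q \<and> q \<in> Om}"
  have "countable (B \<times> Q)" using B \<open>countable Q\<close> by simp
  then have "countable \<B>"
    unfolding \<B>_def by (intro countable_image) (rule countable_subset[rotated], auto)
  moreover have "openin lie_top S" if "S \<in> \<B>" for S
    using that \<open>Q \<subseteq> carrier\<close> B(2) topological_basis_open
    by (auto simp: \<B>_def intro!: openin_reach)
  moreover have "\<exists>S\<in>\<B>. h \<in> S \<and> S \<subseteq> W" if W: "openin lie_top W" "h \<in> W" for W h
  proof -
    obtain Om where Om: "open Om" "h \<in> Om" "\<And>k. reach Om h k \<Longrightarrow> k \<in> W"
      using W unfolding openin_lie_top by meson
    obtain b where b: "b \<in> B" "h \<in> b" "b \<subseteq> Om" using topological_basisE[OF B(2) Om(1,2)] by blast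
    have "open b" using b B topological_basis_open by blast
    have "h \<in> carrier" using W openin_lie_top by blast
    then obtain l where "l \<in> lists (UNIV \<times> set bs)" "h = word l" using carrier_word by blast
    then obtain q where q: "q \<in> Q" "reach b h q"
      using rational_word_dense[OF _ \<open>open b\<close>] b(2) unfolding Q_def by blast
    have "q \<in> b" using reach_in q b by blast
    then have "{k. reach b q k} \<in> \<B>" using q b by (auto simp: \<B>_def)
    moreover have "h \<in> {k. reach b q k}" using reach_sym q by simp
    moreover have "{k. reach b q k} \<subseteq> W"
      using Om(3) reach_trans q(2) reach_mono[OF _ b(3)] by blast
    ultimately show ?thesis by blast
  qed
  ultimately show ?thesis unfolding second_countable_def by blast
qed

lemma GL_lie_subgroup_lie_top: "GL_lie_subgroup lie_top"
proof -
  obtain U V \<gamma> where ch: "chart U V \<gamma>" by (rule chart_exists)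
  have "immersed_submanifold (dim A) lie_top"
    unfolding immersed_submanifold_def
    using second_countable_lie_top chart_neighbourhood[OF ch] by (metis topspace_lie_top)
  then show ?thesis
    unfolding GL_lie_subgroup_def
    using carrier_invertible carrier_one continuous_map_mult continuous_map_inverse by auto
qed

text \<open>Continuity of a curve for the intrinsic topology confines it near time 0 to the slice
  through the identity. There \<open>\<gamma>\<close> maps it into \<open>A\<close>, and
  \<open>\<gamma>\<close> does not change its velocity because its derivative at the identity is the
  identity.\<close>

lemma lie_algebra_lie_top: "lie_algebra lie_top = A"
proof (intro subset_antisym subsetI)
  fix X assume X: "X \<in> A"
  have "continuous_map (top_of_set {-1<..<1}) lie_top (\<lambda>t. mexp (t *\<^sub>R X))"
    using continuous_map_path[OF X carrier_one] by (simp add: continuous_map_from_subtopology)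
  moreover have "smooth_on {-1<..<1} (\<lambda>t. mexp (t *\<^sub>R X))"
    unfolding smooth_on_def using C_k_on_mexp C_k_on_subset by blast
  moreover have "((\<lambda>t. mexp (t *\<^sub>R X)) has_vector_derivative X) (at 0)"
    using mexp_has_vector_derivative[of X 0 UNIV] by simp
  ultimately show "X \<in> lie_algebra lie_top"
    unfolding lie_algebra_def tangent_space_def
    by (intro CollectI exI[of _ "1 :: real"] exI[of _ "\<lambda>t. mexp (t *\<^sub>R X)"] conjI) simp_all
next
  fix X assume "X \<in> lie_algebra lie_top"
  then obtain \<epsilon> c where c: "\<epsilon> > 0" "continuous_map (top_of_set {-\<epsilon><..<\<epsilon>}) lie_top c"
    "c 0 = mat 1" "(c has_vector_derivative X) (at 0)"
    unfolding lie_algebra_def tangent_space_def by auto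
  obtain U V \<gamma> where ch: "chart U V \<gamma>" by (rule chart_exists)
  define N where "N = Psi ` (U \<inter> A)"
  have N: "openin lie_top N" "mat 1 \<in> N"
    using chart_neighbourhood(1,2)[OF ch carrier_one] by (simp_all add: N_def)
  have "openin (top_of_set {-\<epsilon><..<\<epsilon>}) {t \<in> topspace (top_of_set {-\<epsilon><..<\<epsilon>}). c t \<in> N}"
    by (rule openin_continuous_map_preimage[OF c(2) N(1)])
  then have "open {t \<in> {-\<epsilon><..<\<epsilon>}. c t \<in> N}"
    by (simp add: openin_open_eq)
  moreover have "0 \<in> {t \<in> {-\<epsilon><..<\<epsilon>}. c t \<in> N}" using c N by simp
  ultimately obtain e where e: "e > 0" "ball 0 e \<subseteq> {t \<in> {-\<epsilon><..<\<epsilon>}. c t \<in> N}"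
    using openE by blast
  have "(\<gamma> has_derivative (\<lambda>h. h)) (at (c 0))" using ch c(3) by (simp add: chart_def)
  then have "((\<gamma> \<circ> c) has_vector_derivative X) (at 0)"
    using vector_derivative_diff_chain_within[of c X 0 UNIV \<gamma> "\<lambda>h. h"] c(4)
    by (simp add: has_derivative_at_withinI)
  then show "X \<in> A"
  proof (rule has_vector_derivative_imp_subspace[OF subspace_A _ _ e(1)])
    fix s :: real assume "\<bar>s - 0\<bar> < e"
    then have "c s \<in> N" using e(2) by (auto simp: subset_iff)
    then show "(\<gamma> \<circ> c) s \<in> A"
      using ch by (auto simp: N_def chart_def homeomorphism_def)
  qed
qed

end

section \<open>Submanifolds and linear flows\<close>

lemma orthogonal_projection_exists:
  fixes E :: "'a::euclidean_space set"
  assumes E: "subspace E"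
  obtains B pr where "finite B" "B \<subseteq> E"
    "pr = (\<lambda>x. \<Sum>b\<in>B. (x \<bullet> b) *\<^sub>R b)" "bounded_linear pr" "\<And>x. pr x \<in> E"
    "\<And>x. x \<in> E \<Longrightarrow> pr x = x" "\<And>x y. y \<in> E \<Longrightarrow> (x - pr x) \<bullet> y = 0" "\<And>x. norm (pr x) \<le> norm x"
proof -
  obtain B where B: "B \<subseteq> E" "pairwise orthogonal B" "\<And>x. x \<in> B \<Longrightarrow> norm x = 1"
    "independent B" "card B = dim E" "span B = E"
    using orthonormal_basis_subspace[OF E] by metis
  have fin: "finite B" using B(4) by (rule independent_imp_finite)
  have on: "b \<bullet> c = (if b = c then 1 else 0)" if "b \<in> B" "c \<in> B" for b c
    using B(2,3) that by (auto simp: pairwise_def orthogonal_def norm_eq_1)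
  define pr where "pr = (\<lambda>x. \<Sum>b\<in>B. (x \<bullet> b) *\<^sub>R b)"
  have lin: "bounded_linear pr"
    unfolding pr_def
    by (intro bounded_linear_sum bounded_linear_compose[OF bounded_linear_scaleR_left]
        bounded_linear_inner_left)
  have in_E: "pr x \<in> E" for x
    unfolding pr_def using B(1) by (intro subspace_sum[OF E] subspace_scale[OF E]) auto
  have id: "pr x = x" if "x \<in> E" for x
    unfolding pr_def using orthonormal_basis_expand[OF B(2,3) _ fin] that B(6) by auto
  have perp_B: "(x - pr x) \<bullet> b = 0" if "b \<in> B" for x b
  proof -
    have "pr x \<bullet> b = (\<Sum>c\<in>B. if c = b then x \<bullet> b else 0)"
      unfolding pr_def inner_sum_left using on that by (intro sum.cong) auto
    then show ?thesis using fin that by (simp add: inner_diff_left)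
  qed
  have perp: "(x - pr x) \<bullet> y = 0" if "y \<in> E" for x y
  proof -
    have "y \<in> span B" using that B by simp
    then show ?thesis
      by (induction rule: span_induct_alt) (auto simp: inner_add_right perp_B)
  qed
  have "norm (pr x) \<le> norm x" for x
  proof -
    have "pr x \<bullet> pr x \<le> pr x \<bullet> pr x + (x - pr x) \<bullet> (x - pr x)" by simp
    also have "\<dots> = x \<bullet> x"
      using perp[OF in_E, of x x] by (simp add: inner_diff_left inner_diff_right inner_commute)
    finally show ?thesis by (simp add: norm_le)
  qed
  with that[of B pr] fin B(1) pr_def lin in_E id perp show ?thesis by blast
qed

section \<open>Tangent spaces of a submanifold in a chart\<close>

locale submanifold_chart =
  fixes M U V :: "'a::euclidean_space set" and \<phi> \<psi> :: "'a \<Rightarrow> 'a" and E :: "'a set"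
  assumes open_U: "open U" and open_V: "open V" and hom: "homeomorphism U V \<phi> \<psi>"
    and smooth_\<phi>: "smooth_on U \<phi>" and smooth_\<psi>: "smooth_on V \<psi>"
    and E: "subspace E" and chart: "\<phi> ` (U \<inter> M) = V \<inter> E"
begin

lemma \<phi>_V: "x \<in> U \<Longrightarrow> \<phi> x \<in> V" and \<psi>_U: "z \<in> V \<Longrightarrow> \<psi> z \<in> U"
  and \<psi>_\<phi> [simp]: "x \<in> U \<Longrightarrow> \<psi> (\<phi> x) = x" and \<phi>_\<psi> [simp]: "z \<in> V \<Longrightarrow> \<phi> (\<psi> z) = z"
  and cont_\<phi>: "continuous_on U \<phi>" and cont_\<psi>: "continuous_on V \<psi>"
  using hom by (auto simp: homeomorphism_def)

lemma \<phi>_E: "x \<in> U \<Longrightarrow> x \<in> M \<Longrightarrow> \<phi> x \<in> E"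
  using chart by blast

lemma \<psi>_M: "z \<in> V \<Longrightarrow> z \<in> E \<Longrightarrow> \<psi> z \<in> M"
proof -
  assume "z \<in> V" "z \<in> E"
  then obtain x where "x \<in> U" "x \<in> M" "z = \<phi> x" using chart by blast
  then show ?thesis by simp
qed

lemma C_k_\<phi>: "C_k_on k U \<phi>" and C_k_\<psi>: "C_k_on k V \<psi>"
  using smooth_\<phi> smooth_\<psi> by (auto simp: smooth_on_def)

abbreviation D\<phi> where "D\<phi> x \<equiv> frechet_derivative \<phi> (at x)"
abbreviation D\<psi> where "D\<psi> z \<equiv> frechet_derivative \<psi> (at z)"

lemma der_\<phi>: "x \<in> U \<Longrightarrow> (\<phi> has_derivative D\<phi> x) (at x)"
  using C_k_on_has_derivative[OF C_k_\<phi>] .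

lemma der_\<psi>: "z \<in> V \<Longrightarrow> (\<psi> has_derivative D\<psi> z) (at z)"
  using C_k_on_has_derivative[OF C_k_\<psi>] .

lemma linear_D\<phi>: "x \<in> U \<Longrightarrow> linear (D\<phi> x)" and linear_D\<psi>: "z \<in> V \<Longrightarrow> linear (D\<psi> z)"
  using der_\<phi> der_\<psi> has_derivative_linear by blast+

lemma D\<phi>_D\<psi>: "z \<in> V \<Longrightarrow> D\<phi> (\<psi> z) (D\<psi> z h) = h"
proof -
  assume z: "z \<in> V"
  have "((\<lambda>z. \<phi> (\<psi> z)) has_derivative (\<lambda>h. D\<phi> (\<psi> z) (D\<psi> z h))) (at z)"
    by (rule has_derivative_compose[OF der_\<psi>[OF z] der_\<phi>[OF \<psi>_U[OF z]]])
  moreover have "((\<lambda>z. \<phi> (\<psi> z)) has_derivative (\<lambda>h. h)) (at z)"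
    by (rule has_derivative_transform_within_open[OF has_derivative_ident open_V z]) simp
  ultimately show ?thesis using has_derivative_unique by metis
qed

lemma D\<psi>_D\<phi>: "x \<in> U \<Longrightarrow> D\<psi> (\<phi> x) (D\<phi> x h) = h"
proof -
  assume x: "x \<in> U"
  have "((\<lambda>x. \<psi> (\<phi> x)) has_derivative (\<lambda>h. D\<psi> (\<phi> x) (D\<phi> x h))) (at x)"
    by (rule has_derivative_compose[OF der_\<phi>[OF x] der_\<psi>[OF \<phi>_V[OF x]]])
  moreover have "((\<lambda>x. \<psi> (\<phi> x)) has_derivative (\<lambda>h. h)) (at x)"
    by (rule has_derivative_transform_within_open[OF has_derivative_ident open_U x]) simp
  ultimately show ?thesis using has_derivative_unique by metis
qed

lemma line_has_vector_derivative:
  "((\<lambda>t. z + t *\<^sub>R \<eta>) has_vector_derivative \<eta>) (at t)"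
  by (auto intro!: derivative_eq_intros)

text \<open>\<open>\<phi>\<close> carries a curve in \<open>M\<close> into \<open>E\<close>, hence
  its velocity too; conversely the images under \<open>\<psi>\<close> of straight lines in
  \<open>E\<close> realise every vector on the right. In particular the set of velocities is a
  subspace.\<close>

lemma tangent_space_eq:
  assumes p: "p \<in> M" "p \<in> U"
  shows "tangent_space (top_of_set M) p = D\<psi> (\<phi> p) ` E"
proof (intro subset_antisym subsetI)
  fix v assume "v \<in> tangent_space (top_of_set M) p"
  then obtain \<epsilon> c where c: "\<epsilon> > 0" "continuous_map (top_of_set {-\<epsilon><..<\<epsilon>}) (top_of_set M) c"
    "c 0 = p" "(c has_vector_derivative v) (at 0)"
    unfolding tangent_space_def by auto
  have cM: "c t \<in> M" if "\<bar>t\<bar> < \<epsilon>" for t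
  proof -
    have "t \<in> {-\<epsilon><..<\<epsilon>}" using that by auto
    then show ?thesis using c(2) unfolding continuous_map_in_subtopology by (auto simp: Pi_iff)
  qed
  have "isCont c 0" using c(4) by (rule has_vector_derivative_continuous)
  then have "(c \<longlongrightarrow> c 0) (nhds 0)" by (simp only: isCont_def tendsto_at_iff_tendsto_nhds)
  from topological_tendstoD[OF this open_U] have "\<forall>\<^sub>F t in nhds 0. c t \<in> U"
    using p(2) c(3) by simp
  then obtain e where e: "e > 0" "\<And>t. \<bar>t\<bar> < e \<Longrightarrow> c t \<in> U"
    unfolding eventually_nhds_metric by (auto simp: dist_real_def)
  have "((\<phi> \<circ> c) has_vector_derivative D\<phi> p v) (at 0)"
    using vector_derivative_diff_chain_within[of c v 0 UNIV \<phi> "D\<phi> p"] c(3,4) der_\<phi>[OF p(2)]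
    by (simp add: has_derivative_at_withinI)
  then have "D\<phi> p v \<in> E"
  proof (rule has_vector_derivative_imp_subspace[OF E])
    show "min e \<epsilon> > 0" using e c by simp
    show "(\<phi> \<circ> c) s \<in> E" if "\<bar>s - 0\<bar> < min e \<epsilon>" for s
      using that e(2) cM \<phi>_E by simp
  qed
  then show "v \<in> D\<psi> (\<phi> p) ` E" using D\<psi>_D\<phi>[OF p(2), of v] by (metis image_eqI)
next
  fix v assume "v \<in> D\<psi> (\<phi> p) ` E"
  then obtain \<eta> where \<eta>: "\<eta> \<in> E" "v = D\<psi> (\<phi> p) \<eta>" by blast
  define z where "z = \<phi> p"
  have z: "z \<in> V" "z \<in> E" using p \<phi>_V \<phi>_E by (auto simp: z_def)
  define l where "l t = z + t *\<^sub>R \<eta>" for t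
  have "open (l -` V)" unfolding l_def[abs_def] using open_V by (intro open_vimage continuous_intros)
  moreover have "0 \<in> l -` V" using z by (simp add: l_def)
  ultimately obtain e where e: "e > 0" "ball 0 e \<subseteq> l -` V" using openE by blast
  have lV: "l t \<in> V" if "t \<in> {-e<..<e}" for t using e(2) that by (auto simp: subset_iff dist_real_def)
  have "l t \<in> E" for t unfolding l_def using z \<eta> by (intro subspace_add[OF E] subspace_scale[OF E])
  then have "\<psi> (l t) \<in> M" if "t \<in> {-e<..<e}" for t using lV[OF that] \<psi>_M by blast
  moreover have Ck: "C_k_on k {-e<..<e} (\<lambda>t. \<psi> (l t))" for k
  proof (rule C_k_on_compose[where f = \<psi> and g = l, OF _ open_V])
    show "C_k_on k {-e<..<e} l"
      unfolding l_def[abs_def]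
      by (intro C_k_on_add C_k_on_const C_k_on_bounded_linear bounded_linear_scaleR_left) auto
    show "C_k_on k V \<psi>" by (rule C_k_\<psi>)
  qed (use lV in auto)
  moreover have "((\<lambda>t. \<psi> (l t)) has_vector_derivative v) (at 0)"
    using vector_derivative_diff_chain_within[OF line_has_vector_derivative[of z \<eta> 0], of \<psi> "D\<psi> z"] der_\<psi>[OF z(1)]
    by (simp add: has_derivative_at_withinI o_def l_def \<eta> z_def)
  ultimately show "v \<in> tangent_space (top_of_set M) p"
    unfolding tangent_space_def using e(1) p C_k_on_imp_continuous_on[OF Ck]
    by (intro CollectI exI[of _ e] exI[of _ "\<lambda>t. \<psi> (l t)"])
       (auto simp: smooth_on_def l_def z_def continuous_map_in_subtopology)
qed

lemma subspace_tangent_space: "p \<in> M \<Longrightarrow> p \<in> U \<Longrightarrow> subspace (tangent_space (top_of_set M) p)"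
  using tangent_space_eq linear_D\<psi>[OF \<phi>_V] E by (simp add: linear_subspace_image)

lemma dim_tangent_space: "p \<in> M \<Longrightarrow> p \<in> U \<Longrightarrow> dim (tangent_space (top_of_set M) p) = dim E"
proof -
  assume p: "p \<in> M" "p \<in> U"
  have "inj (D\<psi> (\<phi> p))"
    using D\<phi>_D\<psi>[OF \<phi>_V[OF p(2)]] by (metis injI)
  then show ?thesis
    unfolding tangent_space_eq[OF p]
    by (metis linear_D\<psi>[OF \<phi>_V[OF p(2)]] dim_image_eq inj_on_subset subset_UNIV)
qed

end

lemma smooth_submanifold_chart:
  assumes "smooth_submanifold d M" and "p \<in> M"
  obtains U V \<phi> \<psi> E where "submanifold_chart M U V \<phi> \<psi> E" "p \<in> U" "dim E = d"
proof -
  obtain U V \<phi> \<psi> and E :: "'a set" where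
    "open U" "p \<in> U" "open V" "homeomorphism U V \<phi> \<psi>" "smooth_on U \<phi>" "smooth_on V \<psi>"
    "subspace E" "dim E = d" "\<phi> ` (U \<inter> M) = V \<inter> E"
    using assms unfolding smooth_submanifold_def by metis
  then show ?thesis by (intro that[of U V \<phi> \<psi> E]) (simp_all add: submanifold_chart_def)
qed

text \<open>Compactness of the ball bounds the derivative, and convexity turns this into a Lipschitz
  bound.\<close>

lemma C_k_on_lipschitz:
  fixes f :: "'a::euclidean_space \<Rightarrow> 'b::real_normed_vector"
  assumes f: "C_k_on (Suc 0) V f" and "cball z r \<subseteq> V"
  obtains K where "\<And>x y. x \<in> cball z r \<Longrightarrow> y \<in> cball z r \<Longrightarrow> norm (f x - f y) \<le> K * norm (x - y)"
proof -
  define N where "N x = (\<Sum>b\<in>Basis. norm (frechet_derivative f (at x) b))" for x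
  have "continuous_on (cball z r) N"
    unfolding N_def using assms
    by (intro continuous_on_sum continuous_on_norm) (auto intro: continuous_on_subset)
  then have "bounded (N ` cball z r)"
    by (intro compact_imp_bounded compact_continuous_image) auto
  then obtain K where K: "\<And>x. x \<in> cball z r \<Longrightarrow> N x \<le> K"
    unfolding bounded_iff by (metis abs_le_D1 image_eqI real_norm_def)
  have "norm (f x - f y) \<le> K * norm (x - y)" if "x \<in> cball z r" "y \<in> cball z r" for x y
  proof (rule differentiable_bound[of "cball z r" f "\<lambda>x. frechet_derivative f (at x)"])
    fix x assume x: "x \<in> cball z r"
    have d: "(f has_derivative frechet_derivative f (at x)) (at x)"
      using C_k_on_has_derivative[OF f] x assms(2) by blast
    then show "(f has_derivative frechet_derivative f (at x)) (at x within cball z r)"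
      by (rule has_derivative_at_withinI)
    have lin: "linear (frechet_derivative f (at x))" using d has_derivative_linear by blast
    show "onorm (frechet_derivative f (at x)) \<le> K"
    proof (rule onorm_le)
      fix h
      have "frechet_derivative f (at x) h = frechet_derivative f (at x) (\<Sum>b\<in>Basis. (h \<bullet> b) *\<^sub>R b)"
        by (simp add: euclidean_representation)
      also have "\<dots> = (\<Sum>b\<in>Basis. (h \<bullet> b) *\<^sub>R frechet_derivative f (at x) b)"
        by (simp add: linear_sum[OF lin] linear_scale[OF lin])
      also have "norm \<dots> \<le> (\<Sum>b\<in>Basis. norm h * norm (frechet_derivative f (at x) b))"
        by (intro sum_norm_le) (auto intro!: mult_right_mono Basis_le_norm)
      also have "\<dots> = N x * norm h" by (simp add: N_def sum_distrib_left mult.commute)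
      also have "\<dots> \<le> K * norm h" using K[OF x] by (intro mult_right_mono) auto
      finally show "norm (frechet_derivative f (at x) h) \<le> K * norm h" .
    qed
  qed (use that in auto)
  then show ?thesis by (rule that)
qed

lemma mexp_flow_has_vector_derivative:
  "((\<lambda>t. mexp (t *\<^sub>R X) *v y) has_vector_derivative X *v (mexp (t *\<^sub>R X) *v y)) (at t)"
  using bounded_linear.has_vector_derivative[OF matrix_vector.bounded_linear_left
      mexp_has_vector_derivative[of X t UNIV], of y]
  by (simp add: matrix_vector_mul_assoc)

text \<open>The squared norm of \<open>w\<close> grows at rate at most \<open>2 * K\<close>, so it
  does not increase after multiplication by \<open>exp (- (2 * K) * t)\<close>.\<close>

lemma linear_gronwall_zero:
  fixes w :: "real \<Rightarrow> 'a::real_inner"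
  assumes w: "\<And>t. 0 \<le> t \<Longrightarrow> t \<le> 1 \<Longrightarrow> (w has_vector_derivative w' t) (at t)"
    and le: "\<And>t. 0 \<le> t \<Longrightarrow> t \<le> 1 \<Longrightarrow> norm (w' t) \<le> K * norm (w t)" and "w 0 = 0"
  shows "w 1 = 0"
proof -
  define u where "u t = exp (- (2 * K) * t) * (w t \<bullet> w t)" for t
  have "u 1 \<le> u 0"
  proof (rule DERIV_nonpos_imp_nonincreasing[where f = u and a = 0 and b = 1])
    fix t :: real assume t: "0 \<le> t" "t \<le> 1"
    have "((\<lambda>t. w t \<bullet> w t) has_vector_derivative w t \<bullet> w' t + w' t \<bullet> w t) (at t)"
      by (rule bounded_bilinear.has_vector_derivative[OF bounded_bilinear_inner w[OF t] w[OF t]])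
    then have "((\<lambda>t. w t \<bullet> w t) has_real_derivative 2 * (w t \<bullet> w' t)) (at t)"
      by (simp add: has_real_derivative_iff_has_vector_derivative inner_commute)
    then have "(u has_real_derivative exp (- (2 * K) * t) * (2 * (w t \<bullet> w' t) - 2 * K * (w t \<bullet> w t))) (at t)"
      unfolding u_def[abs_def] by (auto intro!: derivative_eq_intros simp: algebra_simps)
    moreover have "w t \<bullet> w' t \<le> K * (w t \<bullet> w t)"
    proof -
      have "w t \<bullet> w' t \<le> norm (w t) * norm (w' t)" by (rule norm_cauchy_schwarz)
      also have "\<dots> \<le> norm (w t) * (K * norm (w t))" using le[OF t] by (intro mult_left_mono) auto
      finally show ?thesis by (simp add: dot_square_norm power2_eq_square mult_ac)
    qed
    ultimately show "\<exists>y. (u has_real_derivative y) (at t) \<and> y \<le> 0"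
      by (intro exI conjI) (auto simp: mult_le_0_iff)
  qed simp
  then have "exp (- (2 * K)) * (w 1 \<bullet> w 1) \<le> 0" using \<open>w 0 = 0\<close> by (simp add: u_def)
  then have "w 1 \<bullet> w 1 \<le> 0" by (simp add: mult_le_0_iff)
  then show ?thesis by (metis inner_eq_zero_iff inner_ge_zero order_antisym)
qed

text \<open>In the chart, the component \<open>F\<close> of the field normal to \<open>E\<close>
  vanishes on \<open>E\<close> and is Lipschitz on a ball, hence bounded by the normal coordinate of
  the point. Gronwall then keeps that coordinate at 0. The Lipschitz constant depends on
  \<open>X\<close>, but the neighbourhood \<open>U'\<close> does not.\<close>

lemma flow_preserves_submanifold:
  fixes P :: "(real^'n) set"
  assumes P: "smooth_submanifold d P" and q: "q \<in> P"
  obtains U' where "open U'" "q \<in> U'"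
    "\<And>X y. (\<And>p. p \<in> P \<Longrightarrow> X *v p \<in> tangent_space (top_of_set P) p) \<Longrightarrow> y \<in> P \<Longrightarrow>
       (\<And>t. 0 \<le> t \<Longrightarrow> t \<le> 1 \<Longrightarrow> mexp (t *\<^sub>R X) *v y \<in> U') \<Longrightarrow> mexp X *v y \<in> P"
proof -
  obtain U V \<phi> \<psi> E where ch: "submanifold_chart P U V \<phi> \<psi> E" and qU: "q \<in> U"
    using smooth_submanifold_chart[OF P q] by metis
  interpret submanifold_chart P U V \<phi> \<psi> E by (rule ch)
  define z0 where "z0 = \<phi> q"
  have z0: "z0 \<in> V" "z0 \<in> E" using q qU \<phi>_V \<phi>_E by (auto simp: z0_def)
  obtain r where r: "r > 0" "cball z0 r \<subseteq> V" using open_V z0 open_contains_cball by blast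
  define U' where "U' = U \<inter> \<phi> -` ball z0 r"
  have "open U'" unfolding U'_def by (rule continuous_open_preimage[OF cont_\<phi> open_U]) simp
  moreover have "q \<in> U'" using qU r by (simp add: U'_def z0_def)
  moreover have "mexp X *v y \<in> P"
    if X: "\<And>p. p \<in> P \<Longrightarrow> X *v p \<in> tangent_space (top_of_set P) p" and y: "y \<in> P"
      and path: "\<And>t. 0 \<le> t \<Longrightarrow> t \<le> 1 \<Longrightarrow> mexp (t *\<^sub>R X) *v y \<in> U'" for X y
  proof -
    obtain pr where pr: "bounded_linear pr" "\<And>x. pr x \<in> E" "\<And>x. x \<in> E \<Longrightarrow> pr x = x"
      "\<And>x. norm (pr x) \<le> norm x"
      using orthogonal_projection_exists[OF E] by metis
    interpret pr: bounded_linear pr by fact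
    \<comment> \<open>The field in chart coordinates, expanded in \<open>Basis\<close> so that
      \<open>\<phi>\<close> is differentiated in fixed directions only, as the rules for
      \<open>C_k_on\<close> require.\<close>
    define G where "G z = (\<Sum>b\<in>Basis. ((X *v \<psi> z) \<bullet> b) *\<^sub>R D\<phi> (\<psi> z) b)" for z
    define F where "F z = G z - pr (G z)" for z
    have G: "G z = D\<phi> (\<psi> z) (X *v \<psi> z)" if z: "z \<in> V" for z
    proof -
      have "D\<phi> (\<psi> z) (X *v \<psi> z) = D\<phi> (\<psi> z) (\<Sum>b\<in>Basis. ((X *v \<psi> z) \<bullet> b) *\<^sub>R b)"
        by (simp add: euclidean_representation)
      then show ?thesis
        using linear_D\<phi>[OF \<psi>_U[OF z]] by (simp add: G_def linear_sum linear_scale)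
    qed
    have "C_k_on (Suc 0) V G"
      unfolding G_def[abs_def]
    proof (intro C_k_on_sum C_k_on_bilinear[OF _ bounded_bilinear_scaleR] open_V)
      fix b :: "real^'n" assume "b \<in> Basis"
      show "C_k_on (Suc 0) V (\<lambda>z. (X *v \<psi> z) \<bullet> b)"
        by (intro C_k_on_linear_compose[where h = "\<lambda>y. (X *v y) \<bullet> b"] open_V C_k_\<psi>
            bounded_linear_compose[OF bounded_linear_inner_left matrix_vector_mul_bounded_linear])
      show "C_k_on (Suc 0) V (\<lambda>z. D\<phi> (\<psi> z) b)"
      proof (rule C_k_on_compose[where f = "\<lambda>x. D\<phi> x b", OF open_V open_U _ C_k_\<psi>])
        show "C_k_on (Suc 0) U (\<lambda>x. D\<phi> x b)" using C_k_\<phi>[of "Suc (Suc 0)"] by simp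
      qed (use \<psi>_U in auto)
    qed
    then have "C_k_on (Suc 0) V F"
      unfolding F_def[abs_def]
      by (intro C_k_on_linear_compose[where h = "\<lambda>x. x - pr x"] open_V bounded_linear_sub
          bounded_linear_ident pr)
    then obtain K where K: "\<And>x y. x \<in> cball z0 r \<Longrightarrow> y \<in> cball z0 r \<Longrightarrow> norm (F x - F y) \<le> K * norm (x - y)"
      using C_k_on_lipschitz r(2) by metis
    have F0: "F z = 0" if z: "z \<in> V" "z \<in> E" for z
    proof -
      have "X *v \<psi> z \<in> tangent_space (top_of_set P) (\<psi> z)" using X \<psi>_M[OF z] .
      then obtain \<eta> where \<eta>: "\<eta> \<in> E" "X *v \<psi> z = D\<psi> z \<eta>"
        using tangent_space_eq[OF \<psi>_M[OF z] \<psi>_U[OF z(1)]] z by auto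
      then have "G z = \<eta>" using G z D\<phi>_D\<psi> by simp
      then show ?thesis using \<eta> pr by (simp add: F_def)
    qed
    have Fle: "norm (F z) \<le> K * norm (z - pr z)" if z: "z \<in> ball z0 r" for z
    proof -
      \<comment> \<open>\<open>z0\<close> lies in \<open>E\<close> and projecting does not increase
        norms, so \<open>pr z\<close> stays in the ball where the Lipschitz bound holds.\<close>
      have "norm (pr z - z0) \<le> norm (z - z0)"
        using pr(4)[of "z - z0"] pr(3)[OF z0(2)] by (simp add: pr.diff)
      then have "pr z \<in> cball z0 r" using z by (simp add: dist_norm norm_minus_commute)
      moreover from this have "F (pr z) = 0" using r pr by (intro F0) auto
      ultimately show ?thesis using K[of z "pr z"] z by simp
    qed
    define z where "z t = \<phi> (mexp (t *\<^sub>R X) *v y)" for t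
    define w where "w t = z t - pr (z t)" for t
    have zt: "z t \<in> ball z0 r" "z t \<in> V" if "0 \<le> t" "t \<le> 1" for t
      using path[OF that] \<phi>_V by (auto simp: U'_def z_def)
    have "w 1 = 0"
    proof (rule linear_gronwall_zero)
      fix t :: real assume t: "0 \<le> t" "t \<le> 1"
      have tU: "mexp (t *\<^sub>R X) *v y \<in> U" using path[OF t] by (simp add: U'_def)
      have "((\<phi> \<circ> (\<lambda>t. mexp (t *\<^sub>R X) *v y)) has_vector_derivative
          D\<phi> (mexp (t *\<^sub>R X) *v y) (X *v (mexp (t *\<^sub>R X) *v y))) (at t)"
        using vector_derivative_diff_chain_within[OF mexp_flow_has_vector_derivative[of X y t], of \<phi>] der_\<phi>[OF tU]
        by (simp add: has_derivative_at_withinI)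
      moreover have "D\<phi> (mexp (t *\<^sub>R X) *v y) (X *v (mexp (t *\<^sub>R X) *v y)) = G (z t)"
        using G[OF zt(2)[OF t]] tU by (simp add: z_def)
      ultimately have "(z has_vector_derivative G (z t)) (at t)"
        by (simp add: o_def z_def[abs_def])
      then show "(w has_vector_derivative F (z t)) (at t)"
        unfolding w_def[abs_def] F_def
        by (intro has_vector_derivative_diff pr.has_vector_derivative)
      show "norm (F (z t)) \<le> K * norm (w t)" unfolding w_def by (rule Fle[OF zt(1)[OF t]])
    next
      have "y \<in> U" using path[of 0] by (simp add: U'_def)
      then show "w 0 = 0" using y pr(3) \<phi>_E by (simp add: w_def z_def)
    qed
    then have "z 1 \<in> E" using pr(2)[of "z 1"] by (simp add: w_def)
    moreover have "z 1 \<in> V" using zt(2)[of 1] by simp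
    moreover have "\<psi> (z 1) = mexp X *v y" using path[of 1] by (simp add: z_def U'_def)
    ultimately show ?thesis using \<psi>_M by metis
  qed
  ultimately show ?thesis by (rule that)
qed

section \<open>Orbits of the generated group on the submanifold\<close>

locale lie_orbit = lie_matrices bs A
  for bs and A :: "(real^'n^'n) set" +
  fixes P :: "(real^'n) set" and d :: nat
  assumes submanifold: "smooth_submanifold d P"
    and tangent: "\<And>X p. X \<in> A \<Longrightarrow> p \<in> P \<Longrightarrow> X *v p \<in> tangent_space (top_of_set P) p"
    and transitive: "\<And>v p. p \<in> P \<Longrightarrow> v \<in> tangent_space (top_of_set P) p \<Longrightarrow> \<exists>X\<in>A. X *v p = v"
begin

lemma flow_preserves:
  assumes "q \<in> P"
  obtains U' where "open U'" "q \<in> U'"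
    "\<And>X y. X \<in> A \<Longrightarrow> y \<in> P \<Longrightarrow>
       (\<And>t. 0 \<le> t \<Longrightarrow> t \<le> 1 \<Longrightarrow> mexp (t *\<^sub>R X) *v y \<in> U') \<Longrightarrow> mexp X *v y \<in> P"
proof -
  obtain U' where U': "open U'" "q \<in> U'"
    "\<And>X y. (\<And>p. p \<in> P \<Longrightarrow> X *v p \<in> tangent_space (top_of_set P) p) \<Longrightarrow> y \<in> P \<Longrightarrow>
       (\<And>t. 0 \<le> t \<Longrightarrow> t \<le> 1 \<Longrightarrow> mexp (t *\<^sub>R X) *v y \<in> U') \<Longrightarrow> mexp X *v y \<in> P"
    using flow_preserves_submanifold[OF submanifold assms] by blast
  show ?thesis
    by (rule that[OF U'(1,2)]) (rule U'(3), use tangent in auto)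
qed

text \<open>If \<open>reach\<close> is confined to the matrices that send \<open>x\<close> into
  \<open>U'\<close>, every step moves the point of the orbit along a trajectory inside
  \<open>U'\<close>, and so within \<open>P\<close>.\<close>

lemma openin_orbit_map_preimage: "openin lie_top {g \<in> carrier. g *v x \<in> P}"
  unfolding openin_lie_top
proof (intro conjI ballI)
  fix g assume "g \<in> {g \<in> carrier. g *v x \<in> P}"
  then have g: "g \<in> carrier" "g *v x \<in> P" by auto
  obtain U' where U': "open U'" "g *v x \<in> U'"
    "\<And>X y. X \<in> A \<Longrightarrow> y \<in> P \<Longrightarrow>
       (\<And>t. 0 \<le> t \<Longrightarrow> t \<le> 1 \<Longrightarrow> mexp (t *\<^sub>R X) *v y \<in> U') \<Longrightarrow> mexp X *v y \<in> P"
    using flow_preserves[OF g(2)] by blast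
  define Om where "Om = (\<lambda>k. k *v x) -` U'"
  have "open Om"
    unfolding Om_def using U'(1) by (intro open_vimage matrix_vector.continuous_on continuous_on_id continuous_on_const)
  moreover have "k *v x \<in> P" if "reach Om g k" for k
  proof -
    have "reach Om h k \<Longrightarrow> h = g \<Longrightarrow> k *v x \<in> P" for h
    proof (induction rule: reach.induct)
      case (step h k X)
      have "mexp X *v (k *v x) \<in> P"
      proof (rule U'(3))
        show "mexp (t *\<^sub>R X) *v (k *v x) \<in> U'" if "0 \<le> t" "t \<le> 1" for t
          using step.hyps(3)[OF that] by (simp add: Om_def matrix_vector_mul_assoc)
      qed (use step in auto)
      then show ?case by (simp add: matrix_vector_mul_assoc)
    qed (use g in simp)
    then show ?thesis using that by blast
  qed
  ultimately show "\<exists>Om. open Om \<and> g \<in> Om \<and> (\<forall>k. reach Om g k \<longrightarrow> k \<in> {g \<in> carrier. g *v x \<in> P})"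
    using g U'(2) carrier_reach by (intro exI[of _ Om]) (auto simp: Om_def)
qed auto

text \<open>The counterpart of \<open>Phi\<close> on an orbit: the direction \<open>\<eta>\<close>
  is followed along the linear field \<open>Xf \<eta>\<close> for the time
  \<open>x \<bullet> \<eta>\<close>.\<close>

primrec flow :: "(real^'n \<Rightarrow> real^'n^'n) \<Rightarrow> real^'n \<Rightarrow> (real^'n) list \<Rightarrow> real^'n \<Rightarrow> real^'n" where
  "flow Xf q [] x = q"
| "flow Xf q (\<eta> # hs) x = mexp ((x \<bullet> \<eta>) *\<^sub>R Xf \<eta>) *v flow Xf q hs x"

lemma flow_carrier: "Xf ` set hs \<subseteq> A \<Longrightarrow> \<exists>g\<in>carrier. flow Xf q hs x = g *v q"
proof (induction hs)
  case Nil
  then show ?case using carrier_one by (intro bexI[of _ "mat 1"]) auto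
next
  case (Cons \<eta> hs)
  then obtain g where "g \<in> carrier" "flow Xf q hs x = g *v q" by auto
  then show ?case
    using Cons.prems
    by (intro bexI[of _ "mexp ((x \<bullet> \<eta>) *\<^sub>R Xf \<eta>) ** g"])
       (auto simp: matrix_vector_mul_assoc intro!: carrier_step A_closed)
qed

lemma continuous_on_flow: "continuous_on S (flow Xf q hs)"
proof (induction hs)
  case (Cons \<eta> hs)
  have "continuous_on S (\<lambda>x. mexp ((x \<bullet> \<eta>) *\<^sub>R Xf \<eta>))"
    by (rule continuous_on_compose2[OF continuous_on_mexp[of UNIV]]) (auto intro!: continuous_intros)
  then show ?case using Cons by (simp add: matrix_vector.continuous_on)
qed simp

lemma flow_zero [simp]: "flow Xf q hs 0 = q"
  by (induction hs) auto

lemma flow_has_derivative_zero: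
  "(flow Xf q hs has_derivative (\<lambda>h. \<Sum>\<eta>\<leftarrow>hs. (h \<bullet> \<eta>) *\<^sub>R (Xf \<eta> *v q))) (at 0)"
proof (induction hs)
  case (Cons \<eta> hs)
  have "((\<lambda>t. mexp (t *\<^sub>R Xf \<eta>)) has_derivative (\<lambda>h. h *\<^sub>R Xf \<eta>)) (at ((0 :: real^'n) \<bullet> \<eta>))"
    using mexp_has_vector_derivative[of "Xf \<eta>" 0 UNIV] by (simp add: has_vector_derivative_def)
  from has_derivative_compose[where f = "\<lambda>x. x \<bullet> \<eta>", OF has_derivative_inner_left[OF has_derivative_ident] this]
  have "((\<lambda>x. mexp ((x \<bullet> \<eta>) *\<^sub>R Xf \<eta>)) has_derivative (\<lambda>h. (h \<bullet> \<eta>) *\<^sub>R Xf \<eta>)) (at 0)"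
    by simp
  from matrix_vector.FDERIV[OF this Cons] show ?case
    by (simp add: add.commute matrix_vector.scaleR_left)
qed simp

text \<open>\<open>flow_preserves\<close> applies only while a trajectory remains in
  \<open>U0\<close>. Joint continuity in the time and in the starting parameter ensures this for
  small \<open>x\<close>, one factor at a time.\<close>

lemma flow_in_submanifold:
  assumes "q \<in> P" and U'': "open U''" "q \<in> U''" and "Xf ` set hs \<subseteq> A"
  shows "\<exists>\<delta>>0. \<forall>x\<in>ball 0 \<delta>. flow Xf q hs x \<in> P \<inter> U''"
proof -
  obtain U0 where U0: "open U0" "q \<in> U0"
    "\<And>X y. X \<in> A \<Longrightarrow> y \<in> P \<Longrightarrow>
       (\<And>t. 0 \<le> t \<Longrightarrow> t \<le> 1 \<Longrightarrow> mexp (t *\<^sub>R X) *v y \<in> U0) \<Longrightarrow> mexp X *v y \<in> P"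
    using flow_preserves[OF assms(1)] by blast
  define U' where "U' = U0 \<inter> U''"
  have U': "open U'" "q \<in> U'" using U0 U'' by (auto simp: U'_def)
  have "\<exists>\<delta>>0. \<forall>x\<in>ball 0 \<delta>. flow Xf q hs x \<in> P \<inter> U'"
    using assms(4)
  proof (induction hs)
    case Nil
    then show ?case using assms(1) U' by (auto intro: exI[of _ 1])
  next
    case (Cons \<eta> hs)
    then obtain \<delta>1 where \<delta>1: "\<delta>1 > 0" "\<And>x. x \<in> ball 0 \<delta>1 \<Longrightarrow> flow Xf q hs x \<in> P" by auto
    define f where "f z = mexp (fst z *\<^sub>R Xf \<eta>) *v flow Xf q hs (snd z)" for z :: "real \<times> (real^'n)"
    have "continuous_on UNIV f"
      unfolding f_def
      by (intro matrix_vector.continuous_on continuous_on_compose2[OF continuous_on_mexp[of UNIV]]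
          continuous_on_compose2[OF continuous_on_flow[of UNIV]] continuous_intros) auto
    then have "open (f -` U')" using U' by (simp add: open_vimage)
    moreover have "(0, 0) \<in> f -` U'" using U' by (simp add: f_def)
    ultimately obtain S T where ST: "open S" "open T" "(0, 0) \<in> S \<times> T" "S \<times> T \<subseteq> f -` U'"
      by (rule open_prod_elim)
    obtain \<delta>2 where \<delta>2: "\<delta>2 > 0" "ball 0 \<delta>2 \<subseteq> S" using ST openE by (metis mem_Sigma_iff)
    obtain \<delta>3 where \<delta>3: "\<delta>3 > 0" "ball 0 \<delta>3 \<subseteq> T" using ST openE by (metis mem_Sigma_iff)
    \<comment> \<open>The last bound keeps \<open>\<bar>x \<bullet> \<eta>\<bar>\<close> below
      \<open>\<delta>2\<close>, so every time up to the end of the last factor lies in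
      \<open>S\<close>.\<close>
    define \<delta> where "\<delta> = min (min \<delta>1 \<delta>3) (\<delta>2 / (norm \<eta> + 1))"
    have n: "norm \<eta> + 1 > 0" by (simp add: add_nonneg_pos)
    have "\<delta> > 0" using \<delta>1 \<delta>2 \<delta>3 n by (simp add: \<delta>_def)
    moreover have "flow Xf q (\<eta> # hs) x \<in> P \<inter> U'" if x: "x \<in> ball 0 \<delta>" for x
    proof -
      have xn: "norm x < \<delta>1" "norm x < \<delta>3" "norm x < \<delta>2 / (norm \<eta> + 1)"
        using x by (auto simp: \<delta>_def)
      have "\<bar>x \<bullet> \<eta>\<bar> \<le> norm x * norm \<eta>" by (rule Cauchy_Schwarz_ineq2)
      also have "\<dots> \<le> norm x * (norm \<eta> + 1)" by (intro mult_left_mono) auto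
      also have "\<dots> < \<delta>2" using xn(3) n by (simp add: field_simps)
      finally have small: "\<bar>x \<bullet> \<eta>\<bar> < \<delta>2" .
      have in_U: "mexp (t *\<^sub>R (x \<bullet> \<eta>) *\<^sub>R Xf \<eta>) *v flow Xf q hs x \<in> U'" if t: "0 \<le> t" "t \<le> 1" for t
      proof -
        have "\<bar>t * (x \<bullet> \<eta>)\<bar> \<le> \<bar>x \<bullet> \<eta>\<bar>" using t by (simp add: abs_mult mult_left_le_one_le)
        then have "(t * (x \<bullet> \<eta>), x) \<in> S \<times> T" using small \<delta>2 \<delta>3 xn by (auto simp: subset_iff)
        then show ?thesis using ST(4) by (auto simp: f_def)
      qed
      have "mexp ((x \<bullet> \<eta>) *\<^sub>R Xf \<eta>) *v flow Xf q hs x \<in> P"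
      proof (rule U0(3))
        show "(x \<bullet> \<eta>) *\<^sub>R Xf \<eta> \<in> A" using Cons.prems by (intro A_closed) auto
        show "flow Xf q hs x \<in> P" using \<delta>1 xn by simp
        show "mexp (t *\<^sub>R (x \<bullet> \<eta>) *\<^sub>R Xf \<eta>) *v flow Xf q hs x \<in> U0" if "0 \<le> t" "t \<le> 1" for t
          using in_U[OF that] by (simp add: U'_def)
      qed
      then show ?thesis using in_U[of 1] by simp
    qed
    ultimately show ?case by blast
  qed
  then show ?thesis by (auto simp: U'_def)
qed

text \<open>In the chart the composed flows have derivative \<open>pr\<close> at 0, which covers
  only \<open>E\<close>. Adding \<open>x - pr x\<close> gives a map \<open>\<kappa>\<close> with
  derivative the identity, to which an open mapping theorem requiring the derivative at a single
  point applies. Chart points in \<open>E\<close> are then attained with the added part equal to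
  0.\<close>

lemma orbit_neighbourhood:
  assumes q: "q \<in> P"
  shows "\<exists>T. openin (top_of_set P) T \<and> q \<in> T \<and> (\<forall>p\<in>T. \<exists>g\<in>carrier. p = g *v q)"
proof -
  obtain U V \<phi> \<psi> E where ch: "submanifold_chart P U V \<phi> \<psi> E" and qU: "q \<in> U"
    using smooth_submanifold_chart[OF submanifold q] by metis
  interpret submanifold_chart P U V \<phi> \<psi> E by (rule ch)
  define z0 where "z0 = \<phi> q"
  have z0: "z0 \<in> V" using qU \<phi>_V by (simp add: z0_def)
  obtain B pr where B: "finite B" "B \<subseteq> E"
    and pr_eq: "pr = (\<lambda>x. \<Sum>b\<in>B. (x \<bullet> b) *\<^sub>R b)"
    and pr: "bounded_linear pr" "\<And>x. pr x \<in> E" "\<And>x. x \<in> E \<Longrightarrow> pr x = x"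
      "\<And>x y. y \<in> E \<Longrightarrow> (x - pr x) \<bullet> y = 0" "\<And>x. norm (pr x) \<le> norm x"
    apply (rule orthogonal_projection_exists[OF E])
    subgoal premises p by (rule p(1)[OF p(2-9)])
    done
  obtain hs where hs: "set hs = B" "distinct hs" using B(1) finite_distinct_list by blast
  have "\<exists>X\<in>A. X *v q = D\<psi> z0 \<eta>" if "\<eta> \<in> B" for \<eta>
  proof (rule transitive[OF q])
    show "D\<psi> z0 \<eta> \<in> tangent_space (top_of_set P) q"
      using tangent_space_eq[OF q qU] that B by (auto simp: z0_def)
  qed
  then obtain Xf where Xf: "\<And>\<eta>. \<eta> \<in> B \<Longrightarrow> Xf \<eta> \<in> A" "\<And>\<eta>. \<eta> \<in> B \<Longrightarrow> Xf \<eta> *v q = D\<psi> z0 \<eta>"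
    by metis
  define \<Theta> where "\<Theta> = flow Xf q hs"
  obtain \<delta> where \<delta>: "\<delta> > 0" "\<And>x. x \<in> ball 0 \<delta> \<Longrightarrow> \<Theta> x \<in> P \<inter> U"
  proof -
    have "Xf ` set hs \<subseteq> A" using Xf(1) hs(1) by blast
    from flow_in_submanifold[OF q open_U qU this] show ?thesis
      using that unfolding \<Theta>_def by blast
  qed
  define \<kappa> where "\<kappa> x = \<phi> (\<Theta> x) + (x - pr x)" for x
  have "continuous_on (ball 0 \<delta>) \<kappa>"
  proof -
    have "continuous_on (ball 0 \<delta>) (\<lambda>x. \<phi> (\<Theta> x))"
      by (rule continuous_on_compose2[OF cont_\<phi>]) (use \<delta> in \<open>auto simp: \<Theta>_def continuous_on_flow\<close>)
    then show ?thesis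
      unfolding \<kappa>_def by (intro continuous_intros bounded_linear.continuous_on[OF pr(1)])
  qed
  moreover have "(\<kappa> has_derivative id) (at 0)"
  proof -
    define \<Theta>' where "\<Theta>' h = (\<Sum>\<eta>\<in>B. (h \<bullet> \<eta>) *\<^sub>R D\<psi> z0 \<eta>)" for h
    have "(\<lambda>h. \<Sum>\<eta>\<leftarrow>hs. (h \<bullet> \<eta>) *\<^sub>R (Xf \<eta> *v q)) = \<Theta>'"
      using hs Xf(2) by (auto simp: \<Theta>'_def sum_list_distinct_conv_sum_set intro!: sum.cong)
    then have "(\<Theta> has_derivative \<Theta>') (at 0)"
      using flow_has_derivative_zero[of Xf q hs] by (simp add: \<Theta>_def)
    moreover have "(\<phi> has_derivative D\<phi> q) (at (\<Theta> 0))"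
      using der_\<phi>[OF qU] by (simp add: \<Theta>_def)
    ultimately have "((\<lambda>x. \<phi> (\<Theta> x)) has_derivative (\<lambda>h. D\<phi> q (\<Theta>' h))) (at 0)"
      by (rule has_derivative_compose)
    moreover have "D\<phi> q (\<Theta>' h) = pr h" for h
    proof -
      have "D\<phi> q (\<Theta>' h) = (\<Sum>\<eta>\<in>B. (h \<bullet> \<eta>) *\<^sub>R D\<phi> q (D\<psi> z0 \<eta>))"
        using linear_D\<phi>[OF qU] by (simp add: \<Theta>'_def linear_sum linear_scale)
      then show ?thesis using D\<phi>_D\<psi>[OF z0] qU by (simp add: pr_eq z0_def)
    qed
    ultimately have "((\<lambda>x. \<phi> (\<Theta> x)) has_derivative pr) (at 0)" by simp
    then have "((\<lambda>x. \<phi> (\<Theta> x) + (x - pr x)) has_derivative (\<lambda>h. pr h + (h - pr h))) (at 0)"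
      by (intro has_derivative_add has_derivative_diff has_derivative_ident
          bounded_linear_imp_has_derivative pr(1))
    then show ?thesis by (simp add: \<kappa>_def[abs_def] id_def)
  qed
  ultimately have "\<kappa> 0 \<in> interior (\<kappa> ` ball 0 \<delta>)"
    by (intro sussmann_open_mapping[where f' = id and g' = id and S = "ball 0 \<delta>"])
       (use \<delta>(1) in \<open>auto simp: bounded_linear_ident[folded id_def]\<close>)
  moreover have "\<kappa> 0 = z0" using pr(3)[of 0] subspace_0[OF E] by (simp add: \<kappa>_def \<Theta>_def z0_def)
  ultimately obtain e where e: "e > 0" "ball z0 e \<subseteq> \<kappa> ` ball 0 \<delta>"
    by (auto simp: mem_interior)
  define T where "T = P \<inter> (U \<inter> \<phi> -` ball z0 e)"
  have "open (U \<inter> \<phi> -` ball z0 e)" by (rule continuous_open_preimage[OF cont_\<phi> open_U]) simp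
  then have "openin (top_of_set P) T" unfolding T_def by (auto simp: openin_open)
  moreover have "q \<in> T" using q qU e by (simp add: T_def z0_def)
  moreover have "\<exists>g\<in>carrier. p = g *v q" if p: "p \<in> T" for p
  proof -
    have pU: "p \<in> U" "p \<in> P" "\<phi> p \<in> ball z0 e" using p by (auto simp: T_def)
    then obtain x where x: "x \<in> ball 0 \<delta>" "\<phi> p = \<kappa> x" using e(2) by blast
    \<comment> \<open>Both chart points lie in \<open>E\<close>, hence so does the added part
      \<open>x - pr x\<close>; being also orthogonal to \<open>E\<close>, it is 0.\<close>
    have "\<phi> p \<in> E" "\<phi> (\<Theta> x) \<in> E" using pU \<delta>(2)[OF x(1)] \<phi>_E by auto
    then have "x - pr x \<in> E"
      using subspace_diff[OF E] x(2) unfolding \<kappa>_def by (metis add_diff_cancel_left')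
    then have "x - pr x = 0" using pr(4)[of "x - pr x" x] by simp
    then have "\<phi> p = \<phi> (\<Theta> x)" using x(2) by (simp add: \<kappa>_def)
    then have "p = \<Theta> x" using pU \<delta>(2)[OF x(1)] \<psi>_\<phi> by (metis IntD2)
    moreover have "Xf ` set hs \<subseteq> A" using Xf(1) hs(1) by blast
    ultimately show ?thesis
      using flow_carrier unfolding \<Theta>_def by blast
  qed
  ultimately show ?thesis by blast
qed

lemma single_orbit:
  assumes "connected P" and "x \<in> P" "y \<in> P"
  shows "\<exists>g\<in>carrier. y = g *v x"
proof (rule connected_equivalence_relation[OF assms(1-3), where R = "\<lambda>x y. \<exists>g\<in>carrier. y = g *v x"])
  show "\<exists>g\<in>carrier. a = g *v b" if "\<exists>g\<in>carrier. b = g *v a" for a b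
  proof -
    obtain g where g: "g \<in> carrier" "b = g *v a" using \<open>\<exists>g\<in>carrier. b = g *v a\<close> by blast
    then have "a = matrix_inv g *v b"
      by (simp add: matrix_vector_mul_assoc matrix_inv_mult carrier_invertible)
    then show ?thesis using carrier_inv g by blast
  qed
  show "\<exists>g\<in>carrier. c = g *v a" if "\<exists>g\<in>carrier. b = g *v a" "\<exists>g\<in>carrier. c = g *v b" for a b c
    using that carrier_mult by (metis matrix_vector_mul_assoc)
qed (rule orbit_neighbourhood)

text \<open>The orbit carries the quotient topology of the group under the orbit map, which may be
  finer than its subspace topology. Openness of \<open>P\<close> thus means openness of its preimage
  in \<open>lie_top\<close>.\<close>

lemma open_in_orbit:
  assumes "connected P" and "x \<in> P"
  shows "\<exists>Orb. quotient_map lie_top Orb (\<lambda>g. g *v x) \<and> openin Orb P"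
proof -
  define Q where "Q W \<longleftrightarrow> W \<subseteq> (\<lambda>g. g *v x) ` carrier \<and> openin lie_top {g \<in> carrier. g *v x \<in> W}" for W
  have "istopology Q"
    unfolding istopology_def
  proof (intro conjI allI impI)
    fix S T assume "Q S" "Q T"
    moreover have "{g \<in> carrier. g *v x \<in> S \<inter> T} = {g \<in> carrier. g *v x \<in> S} \<inter> {g \<in> carrier. g *v x \<in> T}"
      by auto
    ultimately show "Q (S \<inter> T)" unfolding Q_def by (auto intro: openin_Int)
  next
    fix \<K> assume "\<forall>K\<in>\<K>. Q K"
    moreover have "{g \<in> carrier. g *v x \<in> \<Union> \<K>} = \<Union> ((\<lambda>K. {g \<in> carrier. g *v x \<in> K}) ` \<K>)"
      by auto
    ultimately show "Q (\<Union> \<K>)" unfolding Q_def by (auto intro!: openin_Union)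
  qed
  then have openin: "openin (topology Q) = Q" by simp
  have "{g \<in> carrier. g *v x \<in> (\<lambda>g. g *v x) ` carrier} = carrier" by auto
  then have "Q ((\<lambda>g. g *v x) ` carrier)"
    unfolding Q_def using openin_topspace[of lie_top] by simp
  then have top: "topspace (topology Q) = (\<lambda>g. g *v x) ` carrier"
    unfolding topspace_def openin using Q_def by blast
  have "quotient_map lie_top (topology Q) (\<lambda>g. g *v x)"
    unfolding quotient_map_def top openin Q_def by auto
  moreover have "P \<subseteq> (\<lambda>g. g *v x) ` carrier" using single_orbit[OF assms] by blast
  then have "openin (topology Q) P"
    unfolding openin Q_def using openin_orbit_map_preimage by blast
  ultimately show ?thesis by blast
qed

end

section \<open>Alternating functionals and contractions\<close>

definition multilinear :: "nat \<Rightarrow> ('a::real_vector list \<Rightarrow> real) \<Rightarrow> bool" where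
  "multilinear k T \<longleftrightarrow> (\<forall>xs. length xs \<noteq> k \<longrightarrow> T xs = 0) \<and>
     (\<forall>xs i. length xs = k \<longrightarrow> i < k \<longrightarrow> linear (\<lambda>x. T (xs[i := x])))"

definition alternating :: "nat \<Rightarrow> ('a::real_vector list \<Rightarrow> real) \<Rightarrow> bool" where
  "alternating k T \<longleftrightarrow> multilinear k T \<and>
     (\<forall>xs i j. length xs = k \<longrightarrow> i < j \<longrightarrow> j < k \<longrightarrow> xs ! i = xs ! j \<longrightarrow> T xs = 0)"

lemma multilinear_length: "multilinear k T \<Longrightarrow> length xs \<noteq> k \<Longrightarrow> T xs = 0"
  by (simp add: multilinear_def)

lemma multilinear_slot: "multilinear k T \<Longrightarrow> length xs = k \<Longrightarrow> i < k \<Longrightarrow> linear (\<lambda>x. T (xs[i := x]))"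
  by (simp add: multilinear_def)

lemma alternating_multilinear: "alternating k T \<Longrightarrow> multilinear k T"
  by (simp add: alternating_def)

lemma alternating_eq:
  assumes "alternating k T" "length xs = k" "i < k" "j < k" "i \<noteq> j" "xs ! i = xs ! j"
  shows "T xs = 0"
proof (cases "i < j")
  case True
  then show ?thesis using assms unfolding alternating_def by blast
next
  case False
  then have "j < i" using assms by simp
  then show ?thesis using assms unfolding alternating_def by metis
qed

lemma alternating_not_distinct: "alternating k T \<Longrightarrow> \<not> distinct xs \<Longrightarrow> T xs = 0"
proof (cases "length xs = k")
  case True
  assume "alternating k T" "\<not> distinct xs"
  then show ?thesis using True alternating_eq by (metis distinct_conv_nth)
qed (blast dest: alternating_multilinear multilinear_length)

lemma multilinear_zero_slot:
  assumes "multilinear k T" "0 \<in> set xs"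
  shows "T xs = 0"
proof (cases "length xs = k")
  case True
  obtain i where i: "i < k" "xs ! i = 0" using assms(2) True by (metis in_set_conv_nth)
  then have "T xs = T (xs[i := 0])" by (metis list_update_id)
  also have "\<dots> = 0" using linear_0[OF multilinear_slot[OF assms(1) True i(1)]] .
  finally show ?thesis .
qed (use assms multilinear_length in blast)

lemma multilinear_head: "multilinear (Suc k) T \<Longrightarrow> length xs = k \<Longrightarrow> linear (\<lambda>x. T (x # xs))"
  using multilinear_slot[of "Suc k" T "0 # xs" 0] by simp

lemma multilinear_tail: "multilinear (Suc k) T \<Longrightarrow> multilinear k (\<lambda>xs. T (x # xs))"
proof -
  assume T: "multilinear (Suc k) T"
  have "linear (\<lambda>y. T (x # xs[i := y]))" if "length xs = k" "i < k" for xs i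
    using multilinear_slot[OF T, of "x # xs" "Suc i"] that by simp
  then show ?thesis using T by (auto simp: multilinear_def)
qed

lemma alternating_tail: "alternating (Suc k) T \<Longrightarrow> alternating k (\<lambda>xs. T (x # xs))"
proof -
  assume T: "alternating (Suc k) T"
  have "T (x # xs) = 0" if "length xs = k" "i < j" "j < k" "xs ! i = xs ! j" for xs i j
    using alternating_eq[OF T, of "x # xs" "Suc i" "Suc j"] that by simp
  then show ?thesis
    using multilinear_tail[OF alternating_multilinear[OF T]] by (auto simp: alternating_def)
qed

text \<open>Polarization: \<open>T\<close> vanishes with \<open>x + y\<close> in both slots, and so
  do two of the four terms of its expansion.\<close>

lemma alternating_swap_slots:
  assumes T: "alternating k T" and "length xs = k" "i < k" "j < k" "i \<noteq> j"
  shows "T (xs[i := y, j := x]) = - T (xs[i := x, j := y])"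
proof -
  have l1: "linear (\<lambda>x. T (xs[i := x, j := y]))" for y
    using multilinear_slot[OF alternating_multilinear[OF T], of "xs[j := y]" i] assms
    by (simp add: list_update_swap)
  have l2: "linear (\<lambda>y. T (xs[i := x, j := y]))" for x
    using multilinear_slot[OF alternating_multilinear[OF T], of "xs[i := x]" j] assms by simp
  have z: "T (xs[i := x, j := x]) = 0" for x
    using assms by (intro alternating_eq[OF T, of _ i j]) auto
  have "T (xs[i := x + y, j := x + y]) = T (xs[i := x, j := x + y]) + T (xs[i := y, j := x + y])"
    by (rule linear_add[OF l1])
  moreover have "T (xs[i := x, j := x + y]) = T (xs[i := x, j := x]) + T (xs[i := x, j := y])"
    "T (xs[i := y, j := x + y]) = T (xs[i := y, j := x]) + T (xs[i := y, j := y])"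
    by (rule linear_add[OF l2])+
  ultimately show ?thesis using z[of x] z[of y] z[of "x + y"] by linarith
qed

lemma alternating_swap_head:
  assumes T: "alternating k T"
  shows "T (y # x # xs) = - T (x # y # xs)"
proof (cases "length xs + 2 = k")
  case True
  then show ?thesis using alternating_swap_slots[OF T, of "x # y # xs" 0 1 y x] by simp
next
  case False
  then show ?thesis using multilinear_length[OF alternating_multilinear[OF T]] by simp
qed

text \<open>The sign is the same for all alternating functionals, so it cancels in products of two.\<close>

lemma alternating_permuted:
  assumes "mset xs = mset ys"
  shows "\<exists>\<epsilon>\<in>{1, -1 :: real}. \<forall>k (T :: 'a::real_vector list \<Rightarrow> real). alternating k T \<longrightarrow> T ys = \<epsilon> * T xs"
  using assms
proof (induction xs arbitrary: ys)
  case Nil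
  then show ?case by (intro bexI[of _ 1]) auto
next
  case (Cons x xs)
  have "x \<in> set ys" using Cons.prems by (metis list.set_intros(1) set_mset_mset)
  then obtain us vs where ys: "ys = us @ x # vs" by (meson split_list)
  have move: "\<exists>\<epsilon>\<in>{1, -1 :: real}. \<forall>k (T :: 'a list \<Rightarrow> real). alternating k T \<longrightarrow>
      T (us @ x # vs) = \<epsilon> * T (x # us @ vs)" for us
  proof (induction us)
    case Nil
    then show ?case by (intro bexI[of _ 1]) auto
  next
    case (Cons u us)
    then obtain \<epsilon> :: real where \<epsilon>: "\<epsilon> \<in> {1, -1}"
      "\<And>k (T :: 'a list \<Rightarrow> real). alternating k T \<Longrightarrow> T (us @ x # vs) = \<epsilon> * T (x # us @ vs)" by blast
    have "T ((u # us) @ x # vs) = - \<epsilon> * T (x # (u # us) @ vs)" if T: "alternating k T"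
      for k and T :: "'a list \<Rightarrow> real"
    proof (cases k)
      case 0
      then show ?thesis using multilinear_length[OF alternating_multilinear[OF T]] by simp
    next
      case (Suc k')
      then have "T (u # us @ x # vs) = \<epsilon> * T (u # x # us @ vs)"
        using \<epsilon>(2)[OF alternating_tail] T by blast
      then show ?thesis using alternating_swap_head[OF T, of x u] by simp
    qed
    then show ?case using \<epsilon>(1) by (intro bexI[of _ "- \<epsilon>"]) auto
  qed
  obtain \<epsilon>1 :: real where \<epsilon>1: "\<epsilon>1 \<in> {1, -1}"
    "\<And>k (T :: 'a list \<Rightarrow> real). alternating k T \<Longrightarrow> T ys = \<epsilon>1 * T (x # us @ vs)"
    using move[of us] ys by blast
  have "mset xs = mset (us @ vs)" using Cons.prems ys by simp
  then obtain \<epsilon>2 :: real where \<epsilon>2: "\<epsilon>2 \<in> {1, -1}"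
    "\<And>k (T :: 'a list \<Rightarrow> real). alternating k T \<Longrightarrow> T (us @ vs) = \<epsilon>2 * T xs"
    using Cons.IH by blast
  have "T ys = (\<epsilon>1 * \<epsilon>2) * T (x # xs)" if T: "alternating k T" for k and T :: "'a list \<Rightarrow> real"
  proof (cases k)
    case 0
    then show ?thesis using multilinear_length[OF alternating_multilinear[OF T]] ys by simp
  next
    case (Suc k')
    then have "T (x # us @ vs) = \<epsilon>2 * T (x # xs)"
      using \<epsilon>2(2)[OF alternating_tail] T by blast
    then show ?thesis using \<epsilon>1(2)[OF T] by simp
  qed
  moreover have "\<epsilon>1 * \<epsilon>2 \<in> {1, -1}" using \<epsilon>1(1) \<epsilon>2(1) by auto
  ultimately show ?case by blast
qed

lemma multilinear_vanishes_span:
  assumes "multilinear k T" "\<And>bs. set bs \<subseteq> B \<Longrightarrow> length bs = k \<Longrightarrow> T bs = 0"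
    and "set xs \<subseteq> span B" "length xs = k"
  shows "T xs = 0"
  using assms
proof (induction k arbitrary: T xs)
  case (Suc k)
  obtain x ys where xs: "xs = x # ys" "length ys = k" using Suc.prems(4) by (cases xs) auto
  have b: "T (b # ys) = 0" if "b \<in> B" for b
  proof (rule Suc.IH[of "\<lambda>ys. T (b # ys)"])
    show "multilinear k (\<lambda>ys. T (b # ys))" using multilinear_tail Suc.prems(1) by blast
    show "T (b # bs) = 0" if "set bs \<subseteq> B" "length bs = k" for bs
      using Suc.prems(2)[of "b # bs"] that \<open>b \<in> B\<close> by simp
  qed (use Suc.prems xs in auto)
  have "x \<in> span B" using Suc.prems xs by simp
  then show ?case
    unfolding xs using linear_eq_0_on_span[OF multilinear_head[OF Suc.prems(1) xs(2)]] b by blast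
qed simp

lemma multilinear_map:
  assumes T: "multilinear k T" and "linear f"
  shows "multilinear k (\<lambda>xs. T (map f xs))"
  unfolding multilinear_def
proof (intro conjI allI impI)
  show "T (map f xs) = 0" if "length xs \<noteq> k" for xs
    using multilinear_length[OF T] that by simp
  show "linear (\<lambda>x. T (map f (xs[i := x])))" if "length xs = k" "i < k" for xs i
    using linear_compose[OF \<open>linear f\<close> multilinear_slot[OF T, of "map f xs" i]] that
    by (simp add: map_update o_def)
qed

lemma multilinear_add: "multilinear k S \<Longrightarrow> multilinear k T \<Longrightarrow> multilinear k (\<lambda>xs. S xs + T xs)"
  unfolding multilinear_def by (auto intro: linear_compose_add)

lemma multilinear_scale: "multilinear k T \<Longrightarrow> multilinear k (\<lambda>xs. c * T xs)"
  unfolding multilinear_def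
  by (auto intro: linear_compose_scale_right[where 'b = real, unfolded real_scaleR_def])

lemma alternating_add: "alternating k S \<Longrightarrow> alternating k T \<Longrightarrow> alternating k (\<lambda>xs. S xs + T xs)"
  unfolding alternating_def by (auto intro: multilinear_add)

lemma alternating_scale: "alternating k T \<Longrightarrow> alternating k (\<lambda>xs. c * T xs)"
  unfolding alternating_def by (auto intro: multilinear_scale)

lemma alternating_zero: "alternating k (\<lambda>xs. 0)"
  by (simp add: alternating_def multilinear_def linear_zero)

section \<open>Wedge products and exterior powers of subspaces\<close>

lemma wedge_multilinear: "multilinear (length vs) (wedge vs)"
  unfolding multilinear_def
proof (intro conjI allI impI)
  fix xs :: "'a list" and i assume xs: "length xs = length vs" and i: "i < length vs"
  define n where "n = length vs"
  have "linear (\<lambda>x. \<Sum>\<sigma> | \<sigma> permutes {..<n}.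
       of_int (sign \<sigma>) * (\<Prod>j<n. xs[i := x] ! j \<bullet> vs ! \<sigma> j))"
  proof (rule linear_compose_sum, intro ballI)
    fix \<sigma> assume "\<sigma> \<in> {\<sigma>. \<sigma> permutes {..<n}}"
    have "(\<Prod>j<n. xs[i := x] ! j \<bullet> vs ! \<sigma> j) =
        (x \<bullet> vs ! \<sigma> i) * (\<Prod>j\<in>{..<n} - {i}. xs ! j \<bullet> vs ! \<sigma> j)" for x
    proof -
      have "(\<Prod>j<n. xs[i := x] ! j \<bullet> vs ! \<sigma> j) = (xs[i := x] ! i \<bullet> vs ! \<sigma> i) *
          (\<Prod>j\<in>{..<n} - {i}. xs[i := x] ! j \<bullet> vs ! \<sigma> j)"
        using i by (intro prod.remove) (auto simp: n_def)
      also have "(\<Prod>j\<in>{..<n} - {i}. xs[i := x] ! j \<bullet> vs ! \<sigma> j) = (\<Prod>j\<in>{..<n} - {i}. xs ! j \<bullet> vs ! \<sigma> j)"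
        by (intro prod.cong) auto
      finally show ?thesis using i xs by simp
    qed
    then show "linear (\<lambda>x. of_int (sign \<sigma>) * (\<Prod>j<n. xs[i := x] ! j \<bullet> vs ! \<sigma> j))"
      by (simp add: linear_iff inner_add_left algebra_simps)
  qed
  then show "linear (\<lambda>x. wedge vs (xs[i := x]))" by (simp add: wedge_def xs n_def)
qed (simp add: wedge_def)

text \<open>Composing with the transposition of the two equal slots sends each term of the
  determinant to its negative, so the sum equals its own negative.\<close>

lemma wedge_alternating: "alternating (length vs) (wedge vs)"
  unfolding alternating_def
proof (intro conjI allI impI wedge_multilinear)
  fix xs :: "'a list" and a b
  assume xs: "length xs = length vs" and ab: "a < b" "b < length vs" and eq: "xs ! a = xs ! b"
  define n where "n = length vs"
  define \<tau> where "\<tau> = Transposition.transpose a b"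
  have \<tau>: "\<tau> permutes {..<n}" unfolding \<tau>_def using ab by (intro permutes_swap_id) (auto simp: n_def)
  have \<tau>\<tau>: "\<tau> (\<tau> i) = i" for i by (simp add: \<tau>_def)
  have sg: "sign \<tau> = -1" using ab by (simp add: \<tau>_def sign_swap_id)
  define F where "F \<sigma> = of_int (sign \<sigma>) * (\<Prod>i<n. xs ! i \<bullet> vs ! \<sigma> i)" for \<sigma>
  have "F (\<sigma> \<circ> \<tau>) = - F \<sigma>" if \<sigma>: "\<sigma> permutes {..<n}" for \<sigma>
  proof -
    have "sign (\<sigma> \<circ> \<tau>) = - sign \<sigma>"
      using sign_compose[of \<sigma> \<tau>] \<sigma> \<tau> sg permutation_permutes[of \<sigma>] permutation_permutes[of \<tau>] by auto
    moreover have "(\<Prod>i<n. xs ! i \<bullet> vs ! (\<sigma> \<circ> \<tau>) i) = (\<Prod>i<n. xs ! \<tau> i \<bullet> vs ! \<sigma> (\<tau> i))"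
      using eq by (intro prod.cong) (auto simp: \<tau>_def Transposition.transpose_def)
    moreover have "\<dots> = (\<Prod>i<n. xs ! i \<bullet> vs ! \<sigma> i)"
      using prod.permute[OF \<tau>, of "\<lambda>i. xs ! i \<bullet> vs ! \<sigma> i"] by (simp add: o_def)
    ultimately show ?thesis by (simp add: F_def)
  qed
  moreover have "(\<Sum>\<sigma> | \<sigma> permutes {..<n}. F \<sigma>) = (\<Sum>\<sigma> | \<sigma> permutes {..<n}. F (\<sigma> \<circ> \<tau>))"
    by (rule sum_permutations_compose_right) (rule \<tau>)
  ultimately have "(\<Sum>\<sigma> | \<sigma> permutes {..<n}. F \<sigma>) = - (\<Sum>\<sigma> | \<sigma> permutes {..<n}. F \<sigma>)"
    by (simp add: sum_negf)
  then show "wedge vs xs = 0" by (simp add: wedge_def xs F_def n_def)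
qed

lemma ext_power_induct [consumes 1, case_names zero step]:
  assumes "T \<in> ext_power k S" and "P (\<lambda>xs. 0)"
    and "\<And>c vs T. length vs = k \<Longrightarrow> set vs \<subseteq> S \<Longrightarrow> P T \<Longrightarrow> P (\<lambda>xs. c * wedge vs xs + T xs)"
  shows "P T"
  using assms(1) unfolding ext_power_def
proof (induction rule: span_induct_alt)
  case base
  then show ?case using assms(2) by (simp add: zero_fun_def)
next
  case (step c x y)
  then show ?case using assms(3) by (auto simp: plus_fun_def scaleR_fun_def)
qed

lemma ext_power_alternating: "T \<in> ext_power k S \<Longrightarrow> alternating k T"
proof (induction rule: ext_power_induct)
  case (step c vs T)
  then show ?case
    using alternating_add[OF alternating_scale[OF wedge_alternating[of vs], of c]] by blast
qed (rule alternating_zero)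

lemma wedge_in_ext_power: "length vs = k \<Longrightarrow> set vs \<subseteq> S \<Longrightarrow> wedge vs \<in> ext_power k S"
  unfolding ext_power_def by (intro span_base) auto

text \<open>Moves a substitution in the arguments over to the factors by the adjoint map. It is
  applied to projections, to derivatives of parametrizations and to the group action on
  forms.\<close>

lemma wedge_adjoint:
  assumes "\<And>x v. v \<in> set vs \<Longrightarrow> f x \<bullet> v = x \<bullet> g v"
  shows "wedge vs (map f xs) = wedge (map g vs) xs"
proof (cases "length xs = length vs")
  case True
  have "(\<Prod>i<length vs. map f xs ! i \<bullet> vs ! \<sigma> i) = (\<Prod>i<length vs. xs ! i \<bullet> map g vs ! \<sigma> i)"
    if "\<sigma> permutes {..<length vs}" for \<sigma>
  proof (intro prod.cong HOL.refl)
    fix i assume i: "i \<in> {..<length vs}"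
    then have "\<sigma> i < length vs" using that permutes_in_image by fastforce
    then show "map f xs ! i \<bullet> vs ! \<sigma> i = xs ! i \<bullet> map g vs ! \<sigma> i"
      using i True assms by simp
  qed
  then show ?thesis using True by (simp add: wedge_def)
qed (simp add: wedge_def)

text \<open>A multivector over \<open>S\<close> sees covectors only through their pairing with
  \<open>S\<close>; this is how membership in the exterior power of a tangent space is
  exploited.\<close>

lemma ext_power_supported:
  assumes "T \<in> ext_power k S" and "\<And>x v. v \<in> S \<Longrightarrow> f x \<bullet> v = x \<bullet> v"
  shows "T (map f xs) = T xs"
  using assms(1)
proof (induction rule: ext_power_induct)
  case (step c vs T)
  have "wedge vs (map f xs) = wedge (map (\<lambda>v. v) vs) xs"
    using step assms(2) by (intro wedge_adjoint) auto
  then show ?case using step by simp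
qed simp

text \<open>Serves to pull a multivector at a nearby point of the manifold back to the tangent space
  at a base point. The adjoint \<open>f\<close> appears because the functionals take
  covectors.\<close>

lemma ext_power_image:
  fixes f g :: "'a::euclidean_space \<Rightarrow> 'a"
  assumes "T \<in> ext_power k (g ` S)" and "\<And>x v. f x \<bullet> v = x \<bullet> g v"
  shows "\<exists>T'\<in>ext_power k S. T = (\<lambda>xs. T' (map f xs))"
  using assms(1)
proof (induction rule: ext_power_induct)
  case zero
  show ?case
  proof (rule bexI)
    show "(\<lambda>xs. 0) = (\<lambda>xs. (0 :: 'a list \<Rightarrow> real) (map f xs))" by (simp add: zero_fun_def)
    show "(0 :: 'a list \<Rightarrow> real) \<in> ext_power k S" unfolding ext_power_def by (rule span_zero)
  qed
next
  case (step c vs T)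
  then obtain T' where T': "T' \<in> ext_power k S" "T = (\<lambda>xs. T' (map f xs))" by blast
  have "\<forall>v\<in>set vs. \<exists>w. w \<in> S \<and> g w = v" using step(2) by auto
  then obtain s where s: "\<And>v. v \<in> set vs \<Longrightarrow> s v \<in> S" "\<And>v. v \<in> set vs \<Longrightarrow> g (s v) = v"
    by metis
  define ws where "ws = map s vs"
  have "map (\<lambda>v. g (s v)) vs = vs" by (rule map_idI) (rule s(2))
  then have ws: "length ws = k" "set ws \<subseteq> S" "vs = map g ws"
    using step(1) s(1) by (auto simp: ws_def o_def)
  have "c *\<^sub>R wedge ws + T' \<in> ext_power k S"
    using T'(1) wedge_in_ext_power[OF ws(1,2)] unfolding ext_power_def
    by (intro span_add span_scale)
  then show ?case
    using wedge_adjoint[of ws f g] assms(2) ws T'(2)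
    by (intro bexI[of _ "c *\<^sub>R wedge ws + T'"]) (auto simp: plus_fun_def scaleR_fun_def)
qed

lemma wedge_orthonormal:
  assumes "\<And>i j. i < length vs \<Longrightarrow> j < length vs \<Longrightarrow> vs ! i \<bullet> vs ! j = (if i = j then 1 else 0)"
  shows "wedge vs vs = 1"
proof -
  define n where "n = length vs"
  have "(\<Prod>i<n. vs ! i \<bullet> vs ! \<sigma> i) = (if \<sigma> = id then 1 else 0)" if \<sigma>: "\<sigma> permutes {..<n}" for \<sigma>
  proof (cases "\<sigma> = id")
    case False
    then obtain i where i: "\<sigma> i \<noteq> i" by (auto simp: fun_eq_iff)
    then have "i < n" using \<sigma> by (metis lessThan_iff permutes_not_in)
    moreover have "\<sigma> i < n" using \<sigma> \<open>i < n\<close> permutes_in_image by fastforce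
    ultimately have "vs ! i \<bullet> vs ! \<sigma> i = 0" using assms i by (simp add: n_def)
    then have "(\<Prod>i<n. vs ! i \<bullet> vs ! \<sigma> i) = 0" using \<open>i < n\<close> by (intro prod_zero) auto
    then show ?thesis using False by simp
  qed (use assms in \<open>simp add: n_def\<close>)
  then have "wedge vs vs = (\<Sum>\<sigma> | \<sigma> permutes {..<n}. if \<sigma> = id then 1 else 0)"
    unfolding wedge_def n_def[symmetric] by (auto intro!: sum.cong)
  also have "\<dots> = 1" using finite_permutations[of "{..<n}"] permutes_id[of "{..<n}"] by simp
  finally show ?thesis .
qed

section \<open>Contraction in terms of arbitrary systems of vectors\<close>

definition tuples :: "'i set \<Rightarrow> nat \<Rightarrow> 'i list set" where
  "tuples I k = {js. set js \<subseteq> I \<and> length js = k}"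

lemma finite_tuples: "finite I \<Longrightarrow> finite (tuples I k)"
  unfolding tuples_def by (rule finite_lists_length_eq)

lemma tuples_0 [simp]: "tuples I 0 = {[]}"
  by (auto simp: tuples_def)

lemma sum_tuples_Suc: "(\<Sum>js\<in>tuples I (Suc k). f js) = (\<Sum>i\<in>I. \<Sum>js\<in>tuples I k. f (i # js))"
proof -
  have "tuples I (Suc k) = (\<lambda>z. fst z # snd z) ` (I \<times> tuples I k)"
    by (force simp: tuples_def length_Suc_conv image_iff)
  moreover have "inj_on (\<lambda>z. fst z # snd z) (I \<times> tuples I k)" by (auto simp: inj_on_def)
  ultimately have "(\<Sum>js\<in>tuples I (Suc k). f js) = (\<Sum>z\<in>I \<times> tuples I k. f (fst z # snd z))"
    by (simp only: sum.reindex o_def)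
  then show ?thesis by (simp add: sum.cartesian_product case_prod_beta)
qed

text \<open>Two indexed systems of pairs of vectors are equivalent if they represent the same tensor
  in \<open>V \<otimes> V\<close>. Contracting two multilinear functionals gives the same result for equivalent
  systems, where a different pair of systems may be used in every slot.\<close>

definition equiv_systems ::
  "'i set \<Rightarrow> ('i \<Rightarrow> 'a::real_vector) \<times> ('i \<Rightarrow> 'a) \<Rightarrow> 'j set \<Rightarrow> ('j \<Rightarrow> 'a) \<times> ('j \<Rightarrow> 'a) \<Rightarrow> bool" where
  "equiv_systems I p J q \<longleftrightarrow> (\<forall>f h :: 'a \<Rightarrow> real. linear f \<longrightarrow> linear h \<longrightarrow>
     (\<Sum>i\<in>I. f (fst p i) * h (snd p i)) = (\<Sum>j\<in>J. f (fst q j) * h (snd q j)))"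

lemma contract_equiv_systems:
  fixes F G :: "'a::real_vector list \<Rightarrow> real"
  assumes "multilinear k F" "multilinear k G" and "length ps = k" "length qs = k"
    and "\<And>l. l < k \<Longrightarrow> equiv_systems I (ps ! l) J (qs ! l)"
  shows "(\<Sum>js\<in>tuples I k. F (map2 (\<lambda>p j. fst p j) ps js) * G (map2 (\<lambda>p j. snd p j) ps js)) =
    (\<Sum>js\<in>tuples J k. F (map2 (\<lambda>p j. fst p j) qs js) * G (map2 (\<lambda>p j. snd p j) qs js))"
  using assms
proof (induction k arbitrary: F G ps qs)
  case (Suc k)
  obtain p ps' where ps: "ps = p # ps'" "length ps' = k" using Suc.prems(3) by (cases ps) auto
  obtain q qs' where qs: "qs = q # qs'" "length qs' = k" using Suc.prems(4) by (cases qs) auto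
  let ?f = "\<lambda>ps js. map2 (\<lambda>p j. fst p j) ps js" and ?s = "\<lambda>ps js. map2 (\<lambda>p j. snd p j) ps js"
  have len: "length (?f qs' js) = k" "length (?s qs' js) = k" if "js \<in> tuples J k" for js
    using that qs by (auto simp: tuples_def)
  have "(\<Sum>js\<in>tuples I (Suc k). F (?f ps js) * G (?s ps js)) =
    (\<Sum>i\<in>I. \<Sum>js\<in>tuples I k. F (fst p i # ?f ps' js) * G (snd p i # ?s ps' js))"
    by (simp add: sum_tuples_Suc ps)
  also have "\<dots> = (\<Sum>i\<in>I. \<Sum>js\<in>tuples J k. F (fst p i # ?f qs' js) * G (snd p i # ?s qs' js))"
  proof (intro sum.cong HOL.refl)
    fix i
    show "(\<Sum>js\<in>tuples I k. F (fst p i # ?f ps' js) * G (snd p i # ?s ps' js)) =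
      (\<Sum>js\<in>tuples J k. F (fst p i # ?f qs' js) * G (snd p i # ?s qs' js))"
      using Suc.prems(5)[of "Suc _"] ps qs
      by (intro Suc.IH[of "\<lambda>xs. F (fst p i # xs)" "\<lambda>xs. G (snd p i # xs)"] multilinear_tail Suc.prems) auto
  qed
  also have "\<dots> = (\<Sum>js\<in>tuples J k. \<Sum>i\<in>I. F (fst p i # ?f qs' js) * G (snd p i # ?s qs' js))"
    by (rule sum.swap)
  also have "\<dots> = (\<Sum>js\<in>tuples J k. \<Sum>j\<in>J. F (fst q j # ?f qs' js) * G (snd q j # ?s qs' js))"
  proof (intro sum.cong HOL.refl)
    fix js assume js: "js \<in> tuples J k"
    have "equiv_systems I p J q" using Suc.prems(5)[of 0] ps qs by simp
    then show "(\<Sum>i\<in>I. F (fst p i # ?f qs' js) * G (snd p i # ?s qs' js)) =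
        (\<Sum>j\<in>J. F (fst q j # ?f qs' js) * G (snd q j # ?s qs' js))"
      unfolding equiv_systems_def
      using multilinear_head[OF Suc.prems(1) len(1)[OF js]] multilinear_head[OF Suc.prems(2) len(2)[OF js]]
      by blast
  qed
  also have "\<dots> = (\<Sum>j\<in>J. \<Sum>js\<in>tuples J k. F (fst q j # ?f qs' js) * G (snd q j # ?s qs' js))"
    by (rule sum.swap)
  also have "\<dots> = (\<Sum>js\<in>tuples J (Suc k). F (?f qs js) * G (?s qs js))"
    by (simp add: sum_tuples_Suc qs)
  finally show ?case .
qed simp

lemma map2_replicate: "length js = k \<Longrightarrow> map2 f (replicate k p) js = map (f p) js"
  by (induction k arbitrary: js) (auto simp: length_Suc_conv)

lemma map2_replicate_tuples: "js \<in> tuples K k \<Longrightarrow> map2 f (replicate k p) js = map (f p) js"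
  by (simp add: tuples_def map2_replicate)

lemma contract_equiv_systems_same:
  fixes F G :: "'a::real_vector list \<Rightarrow> real"
  assumes "multilinear k F" "multilinear k G" "equiv_systems I (r, s) J (r', s')"
  shows "(\<Sum>js\<in>tuples I k. F (map r js) * G (map s js)) = (\<Sum>js\<in>tuples J k. F (map r' js) * G (map s' js))"
proof -
  have "(\<Sum>js\<in>tuples I k. F (map2 (\<lambda>p j. fst p j) (replicate k (r, s)) js)
        * G (map2 (\<lambda>p j. snd p j) (replicate k (r, s)) js)) =
    (\<Sum>js\<in>tuples J k. F (map2 (\<lambda>p j. fst p j) (replicate k (r', s')) js)
        * G (map2 (\<lambda>p j. snd p j) (replicate k (r', s')) js))"
    using assms by (intro contract_equiv_systems) auto
  then show ?thesis by (simp add: map2_replicate_tuples)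
qed

abbreviation ax :: "'n::finite \<Rightarrow> real^'n" where "ax i \<equiv> axis i 1"

lemma inner_ax: "x \<bullet> ax i = x $ i"
  by (simp add: inner_axis)

lemma linear_ax_expansion:
  fixes f :: "real^'n \<Rightarrow> real"
  assumes "linear f"
  shows "f x = (\<Sum>i\<in>UNIV. (x $ i) * f (ax i))"
proof -
  have "f x = f (\<Sum>i\<in>UNIV. (x $ i) *\<^sub>R ax i)"
    using basis_expansion[of x] by (simp add: scalar_mult_eq_scaleR)
  also have "\<dots> = (\<Sum>i\<in>UNIV. (x $ i) * f (ax i))"
    by (simp add: linear_sum[OF assms] linear_scale[OF assms])
  finally show ?thesis .
qed

text \<open>Both systems represent the endomorphism \<open>R\<close> as a tensor. With
  \<open>R\<close> a projection this passes from the standard basis to an orthonormal frame of a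
  subspace; other choices move an operator from one functional to the other.\<close>

lemma equiv_systems_ax:
  fixes r' s' :: "'j \<Rightarrow> real^'n" and R :: "real^'n \<Rightarrow> real^'n"
  assumes "linear R" and "\<And>x. R x = (\<Sum>j\<in>J. (x \<bullet> s' j) *\<^sub>R r' j)"
  shows "equiv_systems UNIV (\<lambda>i. R (ax i), ax) J (r', s')"
  unfolding equiv_systems_def
proof (intro allI impI)
  fix f h :: "real^'n \<Rightarrow> real" assume f: "linear f" and h: "linear h"
  have "(\<Sum>i\<in>UNIV. f (R (ax i)) * h (ax i)) = (\<Sum>i\<in>UNIV. \<Sum>j\<in>J. (s' j $ i) * f (r' j) * h (ax i))"
    by (simp add: assms(2) linear_sum[OF f] linear_scale[OF f] sum_distrib_right inner_axis')
  also have "\<dots> = (\<Sum>j\<in>J. \<Sum>i\<in>UNIV. (s' j $ i) * f (r' j) * h (ax i))" by (rule sum.swap)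
  also have "\<dots> = (\<Sum>j\<in>J. f (r' j) * (\<Sum>i\<in>UNIV. (s' j $ i) * h (ax i)))"
    by (simp add: sum_distrib_left mult_ac)
  also have "\<dots> = (\<Sum>j\<in>J. f (r' j) * h (s' j))"
    by (simp only: linear_ax_expansion[OF h, symmetric])
  finally show "(\<Sum>i\<in>UNIV. f (fst (\<lambda>i. R (ax i), ax) i) * h (snd (\<lambda>i. R (ax i), ax) i)) =
      (\<Sum>j\<in>J. f (fst (r', s') j) * h (snd (r', s') j))" by simp
qed

lemma inner_contraction:
  fixes T \<alpha> :: "(real^'n) list \<Rightarrow> real"
  assumes T: "multilinear (Suc k) T"
  shows "\<nu> \<bullet> contraction k T \<alpha> = (1 / fact k) * (\<Sum>js\<in>tuples UNIV k. T (\<nu> # map ax js) * \<alpha> (map ax js))"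
proof -
  have "\<nu> \<bullet> contraction k T \<alpha> = (\<Sum>i\<in>UNIV. (\<nu> $ i) * ((1 / fact k) *
      (\<Sum>js\<in>tuples UNIV k. T (ax i # map ax js) * \<alpha> (map ax js))))"
    by (simp add: inner_vec_def contraction_def tuples_def)
  also have "\<dots> = (1 / fact k) * (\<Sum>i\<in>UNIV. \<Sum>js\<in>tuples UNIV k. (\<nu> $ i) * (T (ax i # map ax js) * \<alpha> (map ax js)))"
    by (simp add: sum_distrib_left mult_ac)
  also have "\<dots> = (1 / fact k) * (\<Sum>js\<in>tuples UNIV k. \<Sum>i\<in>UNIV. (\<nu> $ i) * (T (ax i # map ax js) * \<alpha> (map ax js)))"
    by (subst sum.swap) (rule HOL.refl)
  also have "\<dots> = (1 / fact k) * (\<Sum>js\<in>tuples UNIV k. T (\<nu> # map ax js) * \<alpha> (map ax js))"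
  proof -
    have "(\<Sum>i\<in>UNIV. (\<nu> $ i) * (T (ax i # map ax js) * \<alpha> (map ax js))) = T (\<nu> # map ax js) * \<alpha> (map ax js)"
      if "js \<in> tuples UNIV k" for js
      using linear_ax_expansion[OF multilinear_head[OF T], of "map ax js" \<nu>] that
      by (simp add: tuples_def sum_distrib_left mult_ac)
    then show ?thesis by simp
  qed
  finally show ?thesis .
qed

text \<open>The bases \<open>ax i v* g\<close> and \<open>matrix_inv g *v ax i\<close> are dual to
  each other, so they represent the same tensor as the standard basis and the contracted slots do
  not notice \<open>g\<close>. Only the free slot, tested by \<open>\<nu>\<close>, does.\<close>

lemma contraction_equivariant:
  fixes T \<alpha> :: "(real^'n) list \<Rightarrow> real"
  assumes T: "multilinear (Suc k) T" and \<alpha>: "multilinear k \<alpha>" and g: "invertible g"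
  shows "contraction k (multivector_act g T) (form_act g \<alpha>) = g *v contraction k T \<alpha>"
proof (rule vector_eq_ldot[THEN iffD1], rule allI)
  fix \<nu> :: "real^'n"
  have lin: "linear (\<lambda>\<phi> :: real^'n. \<phi> v* g)" by (simp flip: transpose_matrix_vector)
  have lin': "linear (\<lambda>v. matrix_inv g *v v)" by simp
  have gT: "multilinear (Suc k) (multivector_act g T)"
    unfolding multivector_act_def by (rule multilinear_map[OF T lin])
  have R: "(x v* g) = (\<Sum>i\<in>UNIV. (x \<bullet> (g *v ax i)) *\<^sub>R ax i)" for x
    using basis_expansion[of "x v* g"]
    by (simp add: inner_ax scalar_mult_eq_scaleR flip: dot_lmul_matrix)
  have es: "equiv_systems UNIV (\<lambda>i. ax i v* g, ax) UNIV (ax, \<lambda>i. g *v ax i)"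
    by (rule equiv_systems_ax[OF lin R])
  have "equiv_systems UNIV (\<lambda>i. ax i v* g, \<lambda>i. matrix_inv g *v ax i) UNIV (ax, ax)"
    unfolding equiv_systems_def
  proof (intro allI impI)
    fix f h :: "real^'n \<Rightarrow> real" assume f: "linear f" and h: "linear h"
    have "linear (\<lambda>x. h (matrix_inv g *v x))" using linear_compose[OF lin' h] by (simp add: o_def)
    then have "(\<Sum>i\<in>UNIV. f (ax i v* g) * h (matrix_inv g *v ax i)) =
        (\<Sum>i\<in>UNIV. f (ax i) * h (matrix_inv g *v (g *v ax i)))"
      using es f unfolding equiv_systems_def by (metis (no_types, lifting) fst_conv snd_conv sum.cong)
    then show "(\<Sum>i\<in>UNIV. f (fst (\<lambda>i. ax i v* g, \<lambda>i. matrix_inv g *v ax i) i) *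
        h (snd (\<lambda>i. ax i v* g, \<lambda>i. matrix_inv g *v ax i) i)) =
        (\<Sum>i\<in>UNIV. f (fst (ax, ax) i) * h (snd (ax, ax) i))"
      using g by (simp add: matrix_vector_mul_assoc matrix_inv_mult)
  qed
  from contract_equiv_systems_same[OF multilinear_tail[OF T, of "\<nu> v* g"] \<alpha> this]
  have "(\<Sum>js\<in>tuples UNIV k. T (\<nu> v* g # map (\<lambda>i. ax i v* g) js) * \<alpha> (map (\<lambda>i. matrix_inv g *v ax i) js)) =
     (\<Sum>js\<in>tuples UNIV k. T (\<nu> v* g # map ax js) * \<alpha> (map ax js))" .
  then have "\<nu> \<bullet> contraction k (multivector_act g T) (form_act g \<alpha>) = (\<nu> v* g) \<bullet> contraction k T \<alpha>"
    unfolding inner_contraction[OF gT] inner_contraction[OF T]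
    by (simp add: multivector_act_def form_act_def o_def)
  then show "\<nu> \<bullet> contraction k (multivector_act g T) (form_act g \<alpha>) = \<nu> \<bullet> (g *v contraction k T \<alpha>)"
    by (simp add: dot_lmul_matrix)
qed

section \<open>Top-degree multivectors on a subspace with an orthonormal frame\<close>

locale orthonormal_frame =
  fixes Bs :: "(real^'n) set" and d :: nat
  assumes finite_Bs: "finite Bs" and card_Bs: "card Bs = d"
    and on: "\<And>b c. b \<in> Bs \<Longrightarrow> c \<in> Bs \<Longrightarrow> b \<bullet> c = (if b = c then 1 else 0)"
begin

definition pr :: "real^'n \<Rightarrow> real^'n" where "pr x = (\<Sum>b\<in>Bs. (x \<bullet> b) *\<^sub>R b)"

lemma linear_pr: "linear pr"
  unfolding pr_def
  by (intro linear_compose_sum ballI) (simp add: linear_iff inner_add_left scaleR_add_left)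

lemma pr_Bs: "b \<in> Bs \<Longrightarrow> pr b = b"
proof -
  assume b: "b \<in> Bs"
  have "pr b = (\<Sum>c\<in>Bs. if c = b then b else 0)"
    unfolding pr_def using b by (intro sum.cong) (auto simp: on)
  then show ?thesis using b finite_Bs by simp
qed

lemma pr_span: "pr x \<in> span Bs"
  unfolding pr_def by (intro span_sum span_scale span_base)

lemma pr_id: "x \<in> span Bs \<Longrightarrow> pr x = x"
  using linear_eq_on_span[OF linear_pr linear_ident, of Bs x] pr_Bs by blast

lemma pr_inner: "v \<in> span Bs \<Longrightarrow> pr x \<bullet> v = x \<bullet> v"
proof -
  assume "v \<in> span Bs"
  have "x \<bullet> v = x \<bullet> pr v" using pr_id[OF \<open>v \<in> span Bs\<close>] by simp
  also have "\<dots> = pr x \<bullet> v" by (simp add: pr_def inner_sum_left inner_sum_right inner_commute mult.commute)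
  finally show ?thesis by simp
qed

text \<open>Describes the top exterior power of \<open>span Bs\<close> through functionals that
  factor through the projection. Because \<open>d\<close> is the number of frame vectors, they form
  a space of dimension at most one, as \<open>supported_proportional\<close> expresses.\<close>

definition supported :: "((real^'n) list \<Rightarrow> real) \<Rightarrow> bool" where
  "supported T \<longleftrightarrow> alternating d T \<and> (\<forall>xs. T (map pr xs) = T xs)"

lemma supported_ext_power: "T \<in> ext_power d (span Bs) \<Longrightarrow> supported T"
  unfolding supported_def
  using ext_power_alternating ext_power_supported[of T d "span Bs" pr] pr_inner by blast

lemma supported_alternating: "supported T \<Longrightarrow> alternating d T"
  and supported_multilinear: "supported T \<Longrightarrow> multilinear d T"
  by (auto simp: supported_def alternating_multilinear)

lemma supported_pr: "supported T \<Longrightarrow> T (map pr xs) = T xs"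
  by (simp add: supported_def)

lemma supported_slot:
  assumes "supported T" "length xs = d" "i < d"
  shows "T (xs[i := x]) = T (xs[i := pr x])"
proof -
  have "T (xs[i := x]) = T (map pr (xs[i := x]))" using supported_pr[OF assms(1)] by metis
  also have "map pr (xs[i := x]) = map pr (xs[i := pr x])"
    by (simp add: map_update pr_id pr_span)
  finally show ?thesis using supported_pr[OF assms(1)] by metis
qed

lemma supported_perp:
  assumes "supported T" "x \<in> set xs" "pr x = 0"
  shows "T xs = 0"
proof -
  have "0 \<in> set (map pr xs)" using assms(2,3) by (metis image_eqI list.set_map)
  then have "T (map pr xs) = 0"
    using multilinear_zero_slot supported_multilinear assms(1) by blast
  then show ?thesis using supported_pr[OF assms(1)] by simp
qed

text \<open>By multilinearity and projection only lists from \<open>Bs\<close> matter. Those with a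
  repetition give 0, and the others have length \<open>d = card Bs\<close>, so they are permutations
  of \<open>es\<close>.\<close>

lemma supported_eq_0:
  assumes T: "supported T" and es: "set es = Bs" "length es = d" and 0: "T es = 0"
  shows "T xs = 0"
proof (cases "length xs = d")
  case True
  have basis: "T bs = 0" if bs: "set bs \<subseteq> Bs" "length bs = d" for bs
  proof (cases "distinct bs")
    case True
    have de: "distinct es" using es card_Bs by (simp add: card_distinct)
    have "set bs = Bs"
      using bs card_Bs finite_Bs True by (metis card_subset_eq distinct_card)
    then have "mset es = mset bs" using True de es by (metis set_eq_iff_mset_eq_distinct)
    then obtain \<epsilon> where "T bs = \<epsilon> * T es"
      using alternating_permuted[of es bs] supported_alternating[OF T] by blast
    then show ?thesis using 0 by simp
  qed (rule alternating_not_distinct[OF supported_alternating[OF T]])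
  have "set (map pr xs) \<subseteq> span Bs" using pr_span by auto
  then have "T (map pr xs) = 0"
    using True multilinear_vanishes_span[OF supported_multilinear[OF T] basis] by simp
  then show ?thesis using supported_pr[OF T] by simp
qed (use multilinear_length supported_multilinear T in blast)

lemma supported_proportional:
  assumes S: "supported S" and T: "supported T" and es: "set es = Bs" "length es = d"
  shows "S xs * T es = S es * T xs"
proof -
  define R where "R xs = T es * S xs + (- S es) * T xs" for xs
  have "alternating d R"
    unfolding R_def[abs_def]
    by (intro alternating_add alternating_scale supported_alternating S T)
  then have "supported R" by (simp add: supported_def R_def supported_pr[OF S] supported_pr[OF T])
  then have "R xs = 0" by (rule supported_eq_0[OF _ es]) (simp add: R_def)
  then show ?thesis by (simp add: R_def mult.commute)
qed

lemma enumerate_Bs: obtains es where "set es = Bs" "length es = d" "distinct es"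
  using finite_distinct_list[OF finite_Bs] card_Bs distinct_card by metis

end

text \<open>For an orthonormal list \<open>u # ws\<close> spanning the support of \<open>T\<close>, pairing \<open>T \<cdot> wedge ws\<close> with \<open>u\<close>
  only involves the permutations of \<open>ws\<close>, which all contribute with the same sign.\<close>

lemma (in orthonormal_frame) contraction_onto:
  assumes T: "supported T" and d: "d = Suc k" and nz: "T \<noteq> (\<lambda>xs. 0)"
  shows "(\<lambda>\<alpha>. contraction k T \<alpha>) ` ext_power k UNIV = span Bs"
proof -
  have mT: "multilinear (Suc k) T" using supported_multilinear[OF T] d by simp
  have frame: "\<nu> \<bullet> contraction k T \<alpha> = (1 / fact k) * (\<Sum>bs\<in>tuples Bs k. T (\<nu> # bs) * \<alpha> bs)"
    if \<alpha>: "multilinear k \<alpha>" for \<nu> \<alpha>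
  proof -
    have pr: "T (\<nu> # map pr xs) = T (\<nu> # xs)" for xs
    proof -
      have "T (\<nu> # map pr xs) = T (map pr (\<nu> # map pr xs))" using supported_pr[OF T] by metis
      also have "map pr (\<nu> # map pr xs) = map pr (\<nu> # xs)" by (simp add: pr_id pr_span)
      finally show ?thesis using supported_pr[OF T] by metis
    qed
    have "equiv_systems UNIV (\<lambda>i. pr (ax i), ax) Bs (\<lambda>b. b, \<lambda>b. b)"
      by (rule equiv_systems_ax[OF linear_pr]) (simp add: pr_def)
    from contract_equiv_systems_same[OF multilinear_tail[OF mT] \<alpha> this, of \<nu>]
    have "(\<Sum>js\<in>tuples UNIV k. T (\<nu> # map (\<lambda>i. pr (ax i)) js) * \<alpha> (map ax js)) =
      (\<Sum>bs\<in>tuples Bs k. T (\<nu> # bs) * \<alpha> bs)" by simp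
    moreover have "T (\<nu> # map (\<lambda>i. pr (ax i)) js) = T (\<nu> # map ax js)" for js
      using pr[of "map ax js"] by (simp add: o_def)
    ultimately show ?thesis by (simp add: inner_contraction[OF mT])
  qed
  define W where "W = (\<lambda>\<alpha>. contraction k T \<alpha>) ` ext_power k UNIV"
  have lin: "linear (contraction k T)"
    by (simp add: linear_iff contraction_def vec_eq_iff plus_fun_def scaleR_fun_def sum.distrib
        sum_distrib_left algebra_simps)
  have W: "subspace W"
    unfolding W_def ext_power_def by (intro linear_subspace_image lin subspace_span)
  have multi: "multilinear k \<alpha>" if "\<alpha> \<in> ext_power k UNIV" for \<alpha>
    using ext_power_alternating[OF that] by (rule alternating_multilinear)
  have W_sub: "W \<subseteq> span Bs"
  proof
    fix w assume "w \<in> W"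
    then obtain \<alpha> where \<alpha>: "\<alpha> \<in> ext_power k UNIV" "w = contraction k T \<alpha>" by (auto simp: W_def)
    have "(w - pr w) \<bullet> w = 0"
    proof -
      have "pr (w - pr w) = 0" by (simp add: linear_diff[OF linear_pr] pr_id pr_span)
      then have "T ((w - pr w) # bs) = 0" for bs by (intro supported_perp[OF T]) auto
      then show ?thesis using frame[OF multi[OF \<alpha>(1)]] \<alpha>(2) by simp
    qed
    moreover have "(w - pr w) \<bullet> pr w = 0" using pr_inner[OF pr_span, of w w] by (simp add: inner_diff_left)
    ultimately have "(w - pr w) \<bullet> (w - pr w) = 0" by (simp add: inner_diff_right)
    then have "w = pr w" by simp
    then show "w \<in> span Bs" using pr_span by metis
  qed
  have "W = span Bs"
  proof (rule ccontr)
    \<comment> \<open>A proper image leaves a unit vector \<open>u\<close> of \<open>span Bs\<close>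
      orthogonal to it. The form built from the other members of a frame containing \<open>u\<close>
      contracts to a vector with a component along \<open>u\<close>.\<close>
    assume "W \<noteq> span Bs"
    then have "span W \<subset> span Bs" using W_sub span_eq_iff[THEN iffD2, OF W] by blast
    then obtain x where x: "x \<noteq> 0" "x \<in> span Bs" "\<And>w. w \<in> span W \<Longrightarrow> orthogonal x w"
      using orthogonal_to_subspace_exists_gen by metis
    define u where "u = x /\<^sub>R norm x"
    have u: "u \<in> span Bs" "norm u = 1" "\<And>w. w \<in> W \<Longrightarrow> u \<bullet> w = 0"
      using x span_base[of _ W] by (auto simp: u_def span_scale orthogonal_def)
    define S where "S = {y \<in> span Bs. y \<bullet> u = 0}"
    have "subspace S" unfolding S_def subspace_def by (auto simp: span_zero span_add span_scale inner_add_left)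
    then obtain C where C: "C \<subseteq> S" "pairwise orthogonal C" "\<And>c. c \<in> C \<Longrightarrow> norm c = 1"
      "independent C" "card C = dim S" "span C = S"
      using orthonormal_basis_subspace by metis
    have fC: "finite C" using C(4) by (rule independent_imp_finite)
    have uu: "u \<bullet> u = 1" using u(2) by (simp add: norm_eq_1)
    have uC: "u \<notin> C" using C(1) uu by (auto simp: S_def)
    have onC: "b \<bullet> c = (if b = c then 1 else 0)" if "b \<in> insert u C" "c \<in> insert u C" for b c
    proof -
      have "u \<bullet> c = 0" if "c \<in> C" for c using C(1) that by (auto simp: S_def inner_commute)
      then show ?thesis
        using that C(2,3) uu uC
        by (auto simp: pairwise_def orthogonal_def norm_eq_1 inner_commute)
    qed
    have span_uC: "span (insert u C) = span Bs"
    proof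
      show "span (insert u C) \<subseteq> span Bs"
        using u(1) C(1) by (intro span_minimal) (auto simp: S_def subspace_span)
      show "span Bs \<subseteq> span (insert u C)"
      proof
        fix y assume y: "y \<in> span Bs"
        have "y - (y \<bullet> u) *\<^sub>R u \<in> S"
          using y u(1) uu by (simp add: S_def span_diff span_scale inner_diff_left)
        then have "y - (y \<bullet> u) *\<^sub>R u \<in> span C" using C(6) by simp
        then show "y \<in> span (insert u C)" by (auto simp: span_insert)
      qed
    qed
    have card_uC: "card (insert u C) = d"
    proof -
      have "independent (insert u C)"
        using onC by (intro pairwise_orthogonal_independent) (force simp: pairwise_def orthogonal_def)+
      moreover have "independent Bs"
        using on by (intro pairwise_orthogonal_independent) (force simp: pairwise_def orthogonal_def)+
      ultimately show ?thesis using span_uC card_Bs by (metis dim_eq_card_independent dim_span)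
    qed
    interpret F: orthonormal_frame "insert u C" d
      by unfold_locales (use fC card_uC onC in auto)
    \<comment> \<open>The projection depends only on the span, so \<open>T\<close> is supported on
      the frame through \<open>u\<close> as well.\<close>
    have pr_eq: "F.pr = pr"
    proof
      fix y
      have "(F.pr y - pr y) \<bullet> v = 0" if "v \<in> span Bs" for v
        using F.pr_inner[of v y] pr_inner[OF that, of y] that span_uC by (simp add: inner_diff_left)
      moreover have "F.pr y - pr y \<in> span Bs" using F.pr_span pr_span span_uC by (metis span_diff)
      ultimately have "(F.pr y - pr y) \<bullet> (F.pr y - pr y) = 0" by blast
      then show "F.pr y = pr y" by simp
    qed
    have FT: "F.supported T" using T by (simp add: supported_def F.supported_def pr_eq)
    obtain ws where ws: "set ws = C" "distinct ws" using finite_distinct_list[OF fC] by blast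
    have len: "length ws = k" using ws card_uC uC fC d by (metis Suc_inject card_insert_disjoint distinct_card)
    have Tu: "T (u # ws) \<noteq> 0"
      using F.supported_eq_0[OF FT, of "u # ws"] ws len d nz by auto
    define \<alpha> where "\<alpha> = wedge ws"
    have \<alpha>: "\<alpha> \<in> ext_power k UNIV" unfolding \<alpha>_def using len by (intro wedge_in_ext_power) auto
    have mC: "\<alpha> ws = 1"
      unfolding \<alpha>_def using ws onC nth_mem
      by (intro wedge_orthonormal) (auto simp: nth_eq_iff_index_eq)
    have altT: "alternating k (\<lambda>bs. T (u # bs))"
      using supported_alternating[OF T] d by (intro alternating_tail) simp
    have alt\<alpha>: "alternating k \<alpha>" using \<alpha> by (rule ext_power_alternating)
    have equivF: "u \<bullet> contraction k T \<alpha> = (1 / fact k) * (\<Sum>bs\<in>tuples (insert u C) k. T (u # bs) * \<alpha> bs)"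
    proof -
      have "equiv_systems UNIV (\<lambda>i. pr (ax i), ax) (insert u C) (\<lambda>b. b, \<lambda>b. b)"
        by (rule equiv_systems_ax[OF linear_pr]) (simp only: pr_eq[symmetric] F.pr_def)
      from contract_equiv_systems_same[OF multilinear_tail[OF mT] multi[OF \<alpha>] this, of u]
      have "(\<Sum>js\<in>tuples UNIV k. T (u # map (\<lambda>i. pr (ax i)) js) * \<alpha> (map ax js)) =
        (\<Sum>bs\<in>tuples (insert u C) k. T (u # bs) * \<alpha> bs)" by simp
      moreover have "T (u # map (\<lambda>i. pr (ax i)) js) = T (u # map ax js)" for js
        using supported_pr[OF T, of "u # map ax js"] pr_id[OF u(1)] by (simp add: o_def)
      ultimately show ?thesis by (simp add: inner_contraction[OF mT])
    qed
    have terms: "T (u # bs) * \<alpha> bs = (if mset bs = mset ws then T (u # ws) else 0)"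
      if bs: "bs \<in> tuples (insert u C) k" for bs
    proof (cases "mset bs = mset ws")
      case True
      then obtain \<epsilon> :: real where "\<epsilon> \<in> {1, -1}" "T (u # bs) = \<epsilon> * T (u # ws)" "\<alpha> bs = \<epsilon> * \<alpha> ws"
        using alternating_permuted[OF True[symmetric]] altT alt\<alpha> by metis
      then show ?thesis using True mC by auto
    next
      case False
      have "T (u # bs) = 0"
      proof (cases "distinct (u # bs)")
        case True
        then have "set bs \<subseteq> C" using bs by (auto simp: tuples_def)
        moreover have "card (set bs) = k"
          using True bs by (simp add: tuples_def distinct_card)
        moreover have "card C = k" using ws len distinct_card by metis
        ultimately have "set bs = C" using fC by (intro card_subset_eq) auto
        then have "mset bs = mset ws" using ws True by (metis distinct.simps(2) set_eq_iff_mset_eq_distinct)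
        then show ?thesis using False by simp
      next
        case False
        then show ?thesis using alternating_not_distinct[OF supported_alternating[OF T]] by blast
      qed
      then show ?thesis using False by simp
    qed
    have fin: "finite (tuples (insert u C) k)" using fC by (simp add: finite_tuples)
    have "u \<bullet> contraction k T \<alpha> = (1 / fact k) *
        (real (card {bs \<in> tuples (insert u C) k. mset bs = mset ws}) * T (u # ws))"
      unfolding equivF using terms fin by (simp add: sum.If_cases Int_def cong: sum.cong)
    moreover have "ws \<in> {bs \<in> tuples (insert u C) k. mset bs = mset ws}"
      using ws len by (auto simp: tuples_def)
    then have "card {bs \<in> tuples (insert u C) k. mset bs = mset ws} \<noteq> 0"
      using fin by (auto simp: card_eq_0_iff)
    ultimately have "u \<bullet> contraction k T \<alpha> \<noteq> 0" using Tu by simp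
    moreover have "contraction k T \<alpha> \<in> W" using \<alpha> by (auto simp: W_def)
    ultimately show False using u(3) by blast
  qed
  then show ?thesis by (simp add: W_def)
qed

section \<open>Invariance of linear evolution data\<close>

lemma linear_Basis_expansion:
  fixes f :: "'a::euclidean_space \<Rightarrow> real"
  assumes "linear f"
  shows "f x = (\<Sum>b\<in>Basis. (x \<bullet> b) * f b)"
proof -
  have "f x = f (\<Sum>b\<in>Basis. (x \<bullet> b) *\<^sub>R b)" by (simp add: euclidean_representation)
  also have "\<dots> = (\<Sum>b\<in>Basis. (x \<bullet> b) * f b)"
    by (simp add: linear_sum[OF assms] linear_scale[OF assms])
  finally show ?thesis .
qed

text \<open>The Leibniz rule for multilinear functionals. Expanding the first slot in
  \<open>Basis\<close> reduces it to the product rule for real functions.\<close>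

lemma multilinear_has_real_derivative:
  fixes T :: "'a::euclidean_space list \<Rightarrow> real"
  assumes "multilinear k T" "length \<phi>s = k"
    and "\<And>\<phi>. \<phi> \<in> set \<phi>s \<Longrightarrow> ((\<lambda>t. J t \<phi>) has_vector_derivative J' \<phi>) (at t0)"
  shows "((\<lambda>t. T (map (J t) \<phi>s)) has_real_derivative
    (\<Sum>l<k. T ((map (J t0) \<phi>s)[l := J' (\<phi>s ! l)]))) (at t0)"
  using assms
proof (induction k arbitrary: T \<phi>s)
  case (Suc k)
  obtain \<phi> \<psi>s where \<phi>s: "\<phi>s = \<phi> # \<psi>s" "length \<psi>s = k" using Suc.prems(2) by (cases \<phi>s) auto
  define X where "X t = map (J t) \<psi>s" for t
  have ex: "T (x # ys) = (\<Sum>b\<in>Basis. (x \<bullet> b) * T (b # ys))" if "length ys = k" for x ys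
    by (rule linear_Basis_expansion[OF multilinear_head[OF Suc.prems(1) that]])
  have IH: "((\<lambda>t. T (b # X t)) has_real_derivative
      (\<Sum>l<k. T (b # (X t0)[l := J' (\<psi>s ! l)]))) (at t0)" for b
    unfolding X_def using Suc.prems(3) \<phi>s
    by (intro Suc.IH[of "\<lambda>xs. T (b # xs)"] multilinear_tail Suc.prems(1)) auto
  have d\<phi>: "((\<lambda>t. J t \<phi> \<bullet> b) has_real_derivative J' \<phi> \<bullet> b) (at t0)" for b
    using bounded_linear.has_vector_derivative[OF bounded_linear_inner_left Suc.prems(3)[of \<phi>]] \<phi>s
    by (simp add: has_real_derivative_iff_has_vector_derivative)
  have "((\<lambda>t. \<Sum>b\<in>Basis. (J t \<phi> \<bullet> b) * T (b # X t)) has_real_derivative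
     (\<Sum>b\<in>Basis. (J' \<phi> \<bullet> b) * T (b # X t0) +
        (\<Sum>l<k. T (b # (X t0)[l := J' (\<psi>s ! l)])) * (J t0 \<phi> \<bullet> b))) (at t0)"
    by (intro DERIV_sum DERIV_mult' IH d\<phi> DERIV_mult)
  moreover have "(\<lambda>t. \<Sum>b\<in>Basis. (J t \<phi> \<bullet> b) * T (b # X t)) = (\<lambda>t. T (map (J t) \<phi>s))"
    using \<phi>s by (intro ext) (simp add: X_def ex[symmetric])
  moreover have "(\<Sum>b\<in>Basis. (J' \<phi> \<bullet> b) * T (b # X t0) +
        (\<Sum>l<k. T (b # (X t0)[l := J' (\<psi>s ! l)])) * (J t0 \<phi> \<bullet> b)) =
      (\<Sum>l<Suc k. T ((map (J t0) \<phi>s)[l := J' (\<phi>s ! l)]))"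
  proof -
    have "(\<Sum>b\<in>Basis. (\<Sum>l<k. T (b # (X t0)[l := J' (\<psi>s ! l)])) * (J t0 \<phi> \<bullet> b)) =
        (\<Sum>l<k. \<Sum>b\<in>Basis. (J t0 \<phi> \<bullet> b) * T (b # (X t0)[l := J' (\<psi>s ! l)]))"
      unfolding sum_distrib_right by (subst sum.swap) (simp add: mult.commute)
    also have "\<dots> = (\<Sum>l<k. T (J t0 \<phi> # (X t0)[l := J' (\<psi>s ! l)]))"
      using \<phi>s by (intro sum.cong HOL.refl ex[symmetric]) (simp add: X_def)
    finally have "(\<Sum>b\<in>Basis. (\<Sum>l<k. T (b # (X t0)[l := J' (\<psi>s ! l)])) * (J t0 \<phi> \<bullet> b)) =
        (\<Sum>l<k. T (J t0 \<phi> # (X t0)[l := J' (\<psi>s ! l)]))" .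
    moreover have "(\<Sum>b\<in>Basis. (J' \<phi> \<bullet> b) * T (b # X t0)) = T (J' \<phi> # X t0)"
      using \<phi>s by (intro ex[symmetric]) (simp add: X_def)
    ultimately show ?thesis
      by (simp add: sum.distrib sum.lessThan_Suc_shift \<phi>s X_def del: sum.lessThan_Suc)
  qed
  ultimately show ?case by simp
qed simp

text \<open>When slots \<open>i\<close> and \<open>j\<close> agree, all terms that leave both
  untouched vanish, and the two remaining ones are exchanged by swapping these slots.\<close>

lemma alternating_derivation:
  assumes T: "alternating k T" and g: "linear g"
  shows "alternating k (\<lambda>xs. \<Sum>l<k. T (xs[l := g (xs ! l)]))"
  unfolding alternating_def multilinear_def
proof (intro conjI allI impI)
  fix xs :: "'a list" and i assume xs: "length xs = k" and i: "i < k"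
  show "linear (\<lambda>x. \<Sum>l<k. T (xs[i := x, l := g (xs[i := x] ! l)]))"
  proof (rule linear_compose_sum, intro ballI)
    fix l assume l: "l \<in> {..<k}"
    show "linear (\<lambda>x. T (xs[i := x, l := g (xs[i := x] ! l)]))"
    proof (cases "l = i")
      case True
      then show ?thesis
        using linear_compose[OF g multilinear_slot[OF alternating_multilinear[OF T] xs i]] xs i
        by (simp add: o_def)
    next
      case False
      then show ?thesis
        using multilinear_slot[OF alternating_multilinear[OF T], of "xs[l := g (xs ! l)]" i] xs i
        by (simp add: list_update_swap)
    qed
  qed
next
  fix xs :: "'a list" and i j
  assume xs: "length xs = k" and ij: "i < j" "j < k" and eq: "xs ! i = xs ! j"
  have "(\<Sum>l<k. T (xs[l := g (xs ! l)])) = (\<Sum>l\<in>{i, j}. T (xs[l := g (xs ! l)]))"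
  proof (rule sum.mono_neutral_right)
    show "\<forall>l\<in>{..<k} - {i, j}. T (xs[l := g (xs ! l)]) = 0"
      using xs ij eq by (auto intro!: alternating_eq[OF T, of _ i j])
  qed (use ij in auto)
  also have "\<dots> = T (xs[i := g (xs ! i), j := xs ! j]) + T (xs[i := xs ! j, j := g (xs ! i)])"
  proof -
    have "xs[i := xs ! j] = xs" using eq by (metis list_update_id)
    moreover have "xs[i := g (xs ! i), j := xs ! j] = xs[i := g (xs ! i)]"
      using ij by (metis less_irrefl list_update_id list_update_swap)
    ultimately show ?thesis using ij eq by simp
  qed
  also have "\<dots> = 0"
    using alternating_swap_slots[OF T xs, of i j "g (xs ! i)" "xs ! j"] ij by simp
  finally show "(\<Sum>l<k. T (xs[l := g (xs ! l)])) = 0" .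
qed (simp add: multilinear_length[OF alternating_multilinear[OF T]])

context orthonormal_frame
begin

text \<open>The components of \<open>x\<close> along the other frame vectors repeat an entry of
  \<open>es\<close>, and the component normal to the frame is projected away.\<close>

lemma supported_frame_slot:
  assumes T: "supported T" and es: "set es = Bs" "length es = d" and i: "i < d"
  shows "T (es[i := x]) = (es ! i \<bullet> x) * T es"
proof -
  have de: "distinct es" using es card_Bs by (simp add: card_distinct)
  have lin: "linear (\<lambda>y. T (es[i := y]))"
    using multilinear_slot[OF supported_multilinear[OF T] es(2) i] .
  have "T (es[i := x]) = T (es[i := pr x])" by (rule supported_slot[OF T es(2) i])
  also have "\<dots> = (\<Sum>b\<in>Bs. (x \<bullet> b) * T (es[i := b]))"
    unfolding pr_def by (simp add: linear_sum[OF lin] linear_scale[OF lin])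
  also have "\<dots> = (\<Sum>b\<in>Bs. if b = es ! i then (x \<bullet> b) * T es else 0)"
  proof (intro sum.cong HOL.refl)
    fix b assume "b \<in> Bs"
    then obtain j where j: "j < d" "b = es ! j" using es by (metis in_set_conv_nth)
    show "(x \<bullet> b) * T (es[i := b]) = (if b = es ! i then (x \<bullet> b) * T es else 0)"
    proof (cases "j = i")
      case False
      then have "T (es[i := b]) = 0"
        using j i es by (intro alternating_eq[OF supported_alternating[OF T], of _ i j]) auto
      moreover have "b \<noteq> es ! i" using False j i es de by (simp add: nth_eq_iff_index_eq)
      ultimately show ?thesis by simp
    qed (use j in simp)
  qed
  also have "\<dots> = (x \<bullet> es ! i) * T es" using finite_Bs es i nth_mem[of i es] by simp
  finally show ?thesis by (simp add: inner_commute)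
qed

text \<open>The functional \<open>\<xi> x\<close> is the derivative in direction \<open>x\<close> of the field of multivectors at a point
  where it equals \<open>T\<close>; \<open>h\<close> is the second derivative of a parametrization. The asserted identity
  says that the Lie derivative of the field along the linear vector field \<open>M\<close> vanishes there.
  The trace of \<open>M\<close> contributes a sum over \<open>T (e # bs) * \<alpha> (bs[l := h e (bs ! l)])\<close>, which
  changes sign when \<open>e\<close> and \<open>bs ! l\<close> are exchanged.\<close>

lemma infinitesimal_invariance:
  fixes T :: "(real^'n) list \<Rightarrow> real" and h :: "real^'n \<Rightarrow> real^'n \<Rightarrow> real^'n"
  assumes d: "d = Suc k" and T: "supported T" "T \<noteq> (\<lambda>xs. 0)" and \<alpha>: "\<alpha> \<in> ext_power k UNIV"
    and lin: "\<And>xs. linear (\<lambda>x. \<xi> x xs)" and alt: "\<And>x. alternating d (\<xi> x)"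
    and sym: "\<And>b c. b \<in> Bs \<Longrightarrow> c \<in> Bs \<Longrightarrow> h b c = h c b"
    and \<xi>: "\<And>b \<phi>s. b \<in> Bs \<Longrightarrow> length \<phi>s = d \<Longrightarrow> \<xi> b \<phi>s = a b * T \<phi>s +
        (\<Sum>l<d. T (\<phi>s[l := (\<Sum>c\<in>Bs. ((\<phi>s ! l) \<bullet> h b c) *\<^sub>R c)]))"
    and M: "\<And>x. M *v x = contraction k (\<xi> x) \<alpha>"
  shows "\<xi> (contraction k T \<alpha>) \<phi>s = (\<Sum>l<d. T (\<phi>s[l := (\<phi>s ! l) v* M]))"
proof -
  define v where "v = contraction k T \<alpha>"
  define C where "C b \<phi> = (\<Sum>c\<in>Bs. (\<phi> \<bullet> h b c) *\<^sub>R c)" for b \<phi>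
  have linC: "linear (C b)" for b
    unfolding C_def by (intro linear_compose_sum ballI) (simp add: linear_iff inner_add_left scaleR_add_left)
  have C_inner: "c \<bullet> C b \<phi> = \<phi> \<bullet> h b c" if "c \<in> Bs" for b c \<phi>
  proof -
    have "c \<bullet> C b \<phi> = (\<Sum>c'\<in>Bs. if c' = c then \<phi> \<bullet> h b c else 0)"
      unfolding C_def inner_sum_right using that on by (intro sum.cong) auto
    then show ?thesis using that finite_Bs by simp
  qed
  have v: "v = (\<Sum>b\<in>Bs. (v \<bullet> b) *\<^sub>R b)"
  proof -
    have "v \<in> span Bs" using contraction_onto[OF T(1) d T(2)] \<alpha> by (auto simp: v_def)
    then show ?thesis using pr_id[of v] by (simp add: pr_def)
  qed
  have \<xi>v: "\<xi> v xs = (\<Sum>b\<in>Bs. (v \<bullet> b) * \<xi> b xs)" for xs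
    by (subst v) (simp add: linear_sum[OF lin] linear_scale[OF lin])
  note \<xi>' = \<xi>[folded C_def]
  have mT: "multilinear (Suc k) T" using supported_multilinear[OF T(1)] d by simp
  have m\<xi>: "multilinear (Suc k) (\<xi> x)" for x using alternating_multilinear[OF alt] d by simp
  have m\<alpha>: "multilinear k \<alpha>" using \<alpha> ext_power_alternating alternating_multilinear by blast
  have linM: "linear (\<lambda>\<phi>. \<phi> v* M)" by (simp flip: transpose_matrix_vector)
  have M_inner: "x \<bullet> (\<nu> v* M) = (1 / fact k) * (\<Sum>js\<in>tuples UNIV k. \<xi> x (\<nu> # map ax js) * \<alpha> (map ax js))" for x \<nu>
    using inner_contraction[OF m\<xi>, of \<nu> x \<alpha>] M[of x] by (metis dot_lmul_matrix inner_commute)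
  have v_inner: "x \<bullet> v = (1 / fact k) * (\<Sum>js\<in>tuples UNIV k. T (x # map ax js) * \<alpha> (map ax js))" for x
    unfolding v_def by (rule inner_contraction[OF mT])
  define R where "R xs = \<xi> v xs + (- 1) * (\<Sum>l<d. T (xs[l := (xs ! l) v* M]))" for xs
  have altR: "alternating d R"
    unfolding R_def[abs_def]
    by (intro alternating_add alternating_scale alt alternating_derivation supported_alternating T linM)
  \<comment> \<open>\<open>R\<close> is multilinear, so lists from a spanning set suffice. This one
    joins the frame to the covectors normal to it, so that the two kinds of slot can be
    counted.\<close>
  define B where "B = Bs \<union> {y. pr y = 0}"
  have "span B = UNIV"
  proof -
    have "x \<in> span B" for x
    proof -
      have "pr (x - pr x) = 0" by (simp add: linear_diff[OF linear_pr] pr_id pr_span)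
      then have "x - pr x \<in> span B" by (intro span_base) (simp add: B_def)
      moreover have "pr x \<in> span B" using pr_span span_mono[of Bs B] by (auto simp: B_def)
      ultimately have "(x - pr x) + pr x \<in> span B" by (rule span_add)
      then show ?thesis by simp
    qed
    then show ?thesis by blast
  qed
  have basis: "R bs = 0" if bs: "set bs \<subseteq> B" "length bs = d" for bs
  proof (cases "distinct bs")
    case False
    then show ?thesis using alternating_not_distinct[OF altR] by blast
  next
    case dist: True
    define N where "N = {i. i < d \<and> bs ! i \<notin> Bs}"
    have perp: "pr (bs ! i) = 0" if "i \<in> N" for i
    proof -
      have "bs ! i \<in> B" using that bs by (auto simp: N_def)
      then show ?thesis using that by (auto simp: B_def N_def)
    qed
    have T0: "T (bs[l := y]) = 0" if "i \<in> N" "i \<noteq> l" for i l y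
    proof (rule supported_perp[OF T(1) _ perp[OF that(1)]])
      have "(bs[l := y]) ! i = bs ! i" using that(2) by simp
      then show "bs ! i \<in> set (bs[l := y])"
        using that(1) bs(2) by (metis (mono_tags, lifting) N_def length_list_update mem_Collect_eq nth_mem)
    qed
    have T00: "T bs = 0" if "i \<in> N" for i
      using that bs(2) by (intro supported_perp[OF T(1) _ perp[OF that]]) (auto simp: N_def)
    \<comment> \<open>\<open>N\<close> collects the slots with a normal covector. Each term changes
      at most one slot, so two such slots make everything vanish; a single one leads to the symmetry
      of \<open>h\<close>, and none to a trace.\<close>
    consider i j where "i \<in> N" "j \<in> N" "i \<noteq> j" | i where "N = {i}" | "N = {}" by blast
    then show ?thesis
    proof cases
      case 1
      have "T (bs[l := y]) = 0" for l y using T0 1 by metis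
      then show ?thesis
        using T00[OF 1(1)] bs by (simp add: R_def \<xi>v \<xi>')
    next
      case (2 i)
      define \<nu> where "\<nu> = bs ! i"
      have i: "i < d" "\<nu> \<notin> Bs" using 2 by (auto simp: N_def \<nu>_def)
      have pr\<nu>: "pr \<nu> = 0" using perp[of i] 2 by (simp add: \<nu>_def)
      have single: "(\<Sum>l<d. T (bs[l := y l])) = T (bs[i := y i])" for y
      proof -
        have "(\<Sum>l<d. T (bs[l := y l])) = (\<Sum>l\<in>{i}. T (bs[l := y l]))"
          using i T0[of i] 2 by (intro sum.mono_neutral_right) auto
        then show ?thesis by simp
      qed
      define rest where "rest = (\<lambda>j. bs ! j) ` ({..<d} - {i})"
      have rest: "rest \<subseteq> Bs" using 2 by (auto simp: rest_def N_def)
      have "card rest = d - 1"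
        unfolding rest_def using dist bs i
        by (subst card_image) (auto simp: inj_on_def nth_eq_iff_index_eq)
      then have "rest \<noteq> Bs" using card_Bs i by auto
      then obtain e where e: "e \<in> Bs" "e \<notin> rest" using rest by blast
      \<comment> \<open>\<open>e\<close> is the frame vector missing from \<open>bs\<close>. Putting
        it in place of \<open>\<nu>\<close> gives a full frame, so slot \<open>i\<close> reads only
        the component along \<open>e\<close>.\<close>
      define es where "es = bs[i := e]"
      have "set es = Bs"
      proof (rule card_subset_eq[OF finite_Bs])
        have nth: "es ! j = (if j = i then e else bs ! j)" if "j < d" for j
          using that bs(2) i by (simp add: es_def)
        show "set es \<subseteq> Bs"
        proof
          fix y assume "y \<in> set es"
          then obtain j where "j < d" "y = es ! j" using bs(2) by (metis es_def in_set_conv_nth length_list_update)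
          then show "y \<in> Bs" using nth e rest by (auto simp: rest_def)
        qed
        have "distinct es"
          unfolding distinct_conv_nth
        proof (intro allI impI)
          fix j l assume jl: "j < length es" "l < length es" "j \<noteq> l"
          then have jl': "j < d" "l < d" using bs(2) by (auto simp: es_def)
          show "es ! j \<noteq> es ! l"
            using nth[OF jl'(1)] nth[OF jl'(2)] jl(3) jl' e(2) dist bs(2)
            by (auto simp: rest_def nth_eq_iff_index_eq image_iff)
        qed
        then show "card (set es) = card Bs" using bs(2) card_Bs by (simp add: es_def distinct_card)
      qed
      then have slot: "T (bs[i := y]) = (e \<bullet> y) * T es" for y
        using supported_frame_slot[OF T(1), of es i y] bs(2) i by (simp add: es_def)
      have "\<xi> v bs = (\<Sum>b\<in>Bs. (v \<bullet> b) * ((\<nu> \<bullet> h b e) * T es))"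
      proof -
        have "\<xi> b bs = (\<nu> \<bullet> h b e) * T es" if b: "b \<in> Bs" for b
          using \<xi>'[OF b bs(2)] T00[of i] 2 single[of "\<lambda>l. C b (bs ! l)"] slot C_inner[OF e(1)]
          by (simp add: \<nu>_def)
        then show ?thesis by (simp add: \<xi>v)
      qed
      moreover have "(\<Sum>l<d. T (bs[l := (bs ! l) v* M])) = (e \<bullet> (\<nu> v* M)) * T es"
        using single[of "\<lambda>l. (bs ! l) v* M"] slot by (simp add: \<nu>_def)
      \<comment> \<open>In \<open>\<xi> e\<close> the normal covector \<open>\<nu>\<close> survives
        only in the slot changed by \<open>C e\<close>. So \<open>M\<close> yields
        \<open>h e b\<close> where the derivative of the field yielded \<open>h b e\<close>.\<close>
      moreover have "e \<bullet> (\<nu> v* M) = (\<Sum>b\<in>Bs. (v \<bullet> b) * (\<nu> \<bullet> h b e))"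
      proof -
        have "\<xi> e (\<nu> # xs) = T (C e \<nu> # xs)" if "length xs = k" for xs
        proof -
          have "T (\<nu> # xs) = 0" "T (\<nu> # xs[l := y]) = 0" for l y
            using pr\<nu> by (auto intro!: supported_perp[OF T(1), of \<nu>])
          then show ?thesis
            using \<xi>'[OF e(1), of "\<nu> # xs"] that d
            by (simp add: sum.lessThan_Suc_shift del: sum.lessThan_Suc)
        qed
        then have "e \<bullet> (\<nu> v* M) = C e \<nu> \<bullet> v"
          unfolding M_inner v_inner by (simp add: tuples_def)
        also have "\<dots> = (\<Sum>b\<in>Bs. (v \<bullet> b) * (\<nu> \<bullet> h e b))"
          unfolding C_def by (simp add: inner_sum_left inner_commute[of v] mult.commute)
        also have "\<dots> = (\<Sum>b\<in>Bs. (v \<bullet> b) * (\<nu> \<bullet> h b e))"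
          using sym e by (intro sum.cong) auto
        finally show ?thesis .
      qed
      ultimately show ?thesis by (simp add: R_def sum_distrib_right mult.assoc)
    next
      case 3
      \<comment> \<open>On a full frame both sides are multiples of \<open>T bs\<close>. It remains
        to see that the trace of \<open>M\<close> along the frame equals the logarithmic derivative
        of the field in direction \<open>v\<close>.\<close>
      have es: "set bs = Bs"
      proof (rule card_subset_eq[OF finite_Bs])
        show "set bs \<subseteq> Bs" using 3 bs(2) by (auto simp: N_def in_set_conv_nth)
        show "card (set bs) = card Bs" using dist bs(2) card_Bs by (simp add: distinct_card)
      qed
      have slot: "T (bs[i := y]) = (bs ! i \<bullet> y) * T bs" if "i < d" for i y
        by (rule supported_frame_slot[OF T(1) es bs(2) that])
      have reindex: "(\<Sum>l<d. f (bs ! l)) = (\<Sum>e\<in>Bs. f e)" for f :: "real^'n \<Rightarrow> real"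
        using sum.reindex_bij_betw[OF bij_betw_nth[OF dist, of "{..<d}" Bs], of f] bs(2) es
        by (simp add: lessThan_atLeast0)
      have "\<xi> b bs = (a b + (\<Sum>e\<in>Bs. e \<bullet> h b e)) * T bs" if b: "b \<in> Bs" for b
      proof -
        have "(\<Sum>l<d. T (bs[l := C b (bs ! l)])) = (\<Sum>l<d. (bs ! l \<bullet> C b (bs ! l)) * T bs)"
          by (intro sum.cong) (auto simp: slot)
        also have "\<dots> = (\<Sum>e\<in>Bs. (e \<bullet> C b e) * T bs)" by (rule reindex)
        also have "\<dots> = (\<Sum>e\<in>Bs. e \<bullet> h b e) * T bs" by (simp add: C_inner sum_distrib_right)
        finally show ?thesis using \<xi>'[OF b bs(2)] by (simp add: distrib_right)
      qed
      then have lhs: "\<xi> v bs = (\<Sum>b\<in>Bs. (v \<bullet> b) * (a b + (\<Sum>e\<in>Bs. e \<bullet> h b e))) * T bs"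
        by (simp add: \<xi>v sum_distrib_right mult.assoc)
      have "(\<Sum>l<d. T (bs[l := (bs ! l) v* M])) = (\<Sum>l<d. (bs ! l \<bullet> ((bs ! l) v* M)) * T bs)"
        by (intro sum.cong) (auto simp: slot)
      also have "\<dots> = (\<Sum>e\<in>Bs. (e \<bullet> (e v* M)) * T bs)" by (rule reindex)
      finally have rhs: "(\<Sum>l<d. T (bs[l := (bs ! l) v* M])) = (\<Sum>e\<in>Bs. e \<bullet> (e v* M)) * T bs"
        by (simp add: sum_distrib_right)
      define Z where "Z l e = (\<Sum>js\<in>tuples UNIV k. T (e # (map ax js)[l := C e (ax (js ! l))]) * \<alpha> (map ax js))" for l e
      have eM: "e \<bullet> (e v* M) = a e * (e \<bullet> v) + C e e \<bullet> v + (1 / fact k) * (\<Sum>l<k. Z l e)" if e: "e \<in> Bs" for e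
      proof -
        have "\<xi> e (e # map ax js) = a e * T (e # map ax js) + T (C e e # map ax js) +
            (\<Sum>l<k. T (e # (map ax js)[l := C e (ax (js ! l))]))" if js: "js \<in> tuples UNIV k" for js
          using \<xi>'[OF e, of "e # map ax js"] js d
          by (simp add: sum.lessThan_Suc_shift tuples_def del: sum.lessThan_Suc)
        then have "e \<bullet> (e v* M) = (1 / fact k) * (\<Sum>js\<in>tuples UNIV k. a e * (T (e # map ax js) * \<alpha> (map ax js)) +
            T (C e e # map ax js) * \<alpha> (map ax js) +
            (\<Sum>l<k. T (e # (map ax js)[l := C e (ax (js ! l))]) * \<alpha> (map ax js)))"
          unfolding M_inner by (simp add: distrib_right sum_distrib_right mult.assoc)
        also have "\<dots> = a e * (e \<bullet> v) + C e e \<bullet> v + (1 / fact k) *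
            (\<Sum>js\<in>tuples UNIV k. \<Sum>l<k. T (e # (map ax js)[l := C e (ax (js ! l))]) * \<alpha> (map ax js))"
          unfolding v_inner by (simp add: sum.distrib distrib_left sum_distrib_left mult.left_commute)
        also have "(\<Sum>js\<in>tuples UNIV k. \<Sum>l<k. T (e # (map ax js)[l := C e (ax (js ! l))]) * \<alpha> (map ax js)) =
            (\<Sum>l<k. Z l e)"
          unfolding Z_def by (rule sum.swap)
        finally show ?thesis .
      qed
      have Z0: "(\<Sum>e\<in>Bs. Z l e) = 0" if l: "l < k" for l
      proof -
        have Z: "Z l e = (\<Sum>cs\<in>tuples Bs k. T (e # cs) * \<alpha> (cs[l := h e (cs ! l)]))" for e
        proof -
          \<comment> \<open>In slot \<open>l\<close> the operator \<open>C e\<close> on the side of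
            \<open>T\<close> is traded for \<open>h e\<close> on the side of
            \<open>\<alpha>\<close>; the other slots only pass from the standard basis to the
            frame.\<close>
          define ps where "ps = (replicate k (\<lambda>i. pr (ax i), ax :: 'n \<Rightarrow> real^'n))[l := (\<lambda>i. C e (ax i), ax)]"
          define qs where "qs = (replicate k (\<lambda>b :: real^'n. b, \<lambda>b :: real^'n. b))[l := (\<lambda>b. b, h e)]"
          have eq: "equiv_systems UNIV (ps ! m) Bs (qs ! m)" if "m < k" for m
          proof (cases "m = l")
            case True
            have "equiv_systems UNIV (\<lambda>i. C e (ax i), ax) Bs (\<lambda>b. b, h e)"
              by (rule equiv_systems_ax[OF linC]) (simp add: C_def)
            then show ?thesis using True l by (simp add: ps_def qs_def)
          next
            case False
            have "equiv_systems UNIV (\<lambda>i. pr (ax i), ax) Bs (\<lambda>b. b, \<lambda>b. b)"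
              by (rule equiv_systems_ax[OF linear_pr]) (simp add: pr_def)
            then show ?thesis using False that by (simp add: ps_def qs_def)
          qed
          have ps: "map2 (\<lambda>p j. fst p j) ps js = (map (\<lambda>i. pr (ax i)) js)[l := C e (ax (js ! l))]"
            "map2 (\<lambda>p j. snd p j) ps js = map ax js" if "js \<in> tuples UNIV k" for js
            using that l by (auto intro!: nth_equalityI simp: ps_def tuples_def nth_list_update)
          have qs: "map2 (\<lambda>p j. fst p j) qs cs = cs"
            "map2 (\<lambda>p j. snd p j) qs cs = cs[l := h e (cs ! l)]" if "cs \<in> tuples Bs k" for cs
            using that l by (auto intro!: nth_equalityI simp: qs_def tuples_def nth_list_update)
          have prT: "T (e # (map (\<lambda>i. pr (ax i)) js)[l := y]) = T (e # (map ax js)[l := y])" for js y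
          proof -
            have "map pr (e # (map (\<lambda>i. pr (ax i)) js)[l := y]) = map pr (e # (map ax js)[l := y])"
              by (simp add: map_update pr_id pr_span o_def)
            then show ?thesis using supported_pr[OF T(1)] by metis
          qed
          have "(\<Sum>js\<in>tuples UNIV k. T (e # map2 (\<lambda>p j. fst p j) ps js) * \<alpha> (map2 (\<lambda>p j. snd p j) ps js)) =
            (\<Sum>cs\<in>tuples Bs k. T (e # map2 (\<lambda>p j. fst p j) qs cs) * \<alpha> (map2 (\<lambda>p j. snd p j) qs cs))"
            by (rule contract_equiv_systems[OF multilinear_tail[OF mT] m\<alpha> _ _ eq]) (simp_all add: ps_def qs_def)
          then show ?thesis by (simp only: ps qs prT Z_def cong: sum.cong)
        qed
        define W where "W z = T (fst z # snd z) * \<alpha> ((snd z)[l := h (fst z) (snd z ! l)])" for z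
        define s where "s z = (snd z ! l, (snd z)[l := fst z])" for z :: "(real^'n) \<times> (real^'n) list"
        have inS: "s z \<in> Bs \<times> tuples Bs k" "s (s z) = z" "W (s z) = - W z" if z: "z \<in> Bs \<times> tuples Bs k" for z
        proof -
          obtain e cs where ecs: "z = (e, cs)" "e \<in> Bs" "set cs \<subseteq> Bs" "length cs = k"
            using z by (auto simp: tuples_def)
          have c: "cs ! l \<in> Bs" using ecs l by auto
          show "s z \<in> Bs \<times> tuples Bs k"
            using ecs c set_update_subset_insert[of cs l e] by (auto simp: s_def tuples_def)
          show "s (s z) = z" using ecs l by (simp add: s_def)
          have "T (cs ! l # cs[l := e]) = - T (e # cs)"
            using alternating_swap_slots[OF supported_alternating[OF T(1)], of "e # cs" 0 "Suc l" "cs ! l" e] ecs l d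
            by simp
          then show "W (s z) = - W z" using ecs l sym[OF c ecs(2)] by (simp add: W_def s_def)
        qed
        have "(\<Sum>z\<in>Bs \<times> tuples Bs k. W z) = (\<Sum>z\<in>Bs \<times> tuples Bs k. W (s z))"
          by (rule sum.reindex_bij_witness[of _ s s]) (use inS in auto)
        also have "\<dots> = - (\<Sum>z\<in>Bs \<times> tuples Bs k. W z)"
          using inS(3) by (simp add: sum_negf)
        finally have "(\<Sum>z\<in>Bs \<times> tuples Bs k. W z) = 0" by simp
        then show ?thesis
          by (simp add: Z W_def sum.cartesian_product case_prod_beta)
      qed
      have "(\<Sum>e\<in>Bs. e \<bullet> (e v* M)) = (\<Sum>e\<in>Bs. a e * (e \<bullet> v)) + (\<Sum>e\<in>Bs. C e e \<bullet> v) +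
          (1 / fact k) * (\<Sum>e\<in>Bs. \<Sum>l<k. Z l e)"
        by (simp add: eM sum.distrib sum_distrib_left)
      also have "(\<Sum>e\<in>Bs. \<Sum>l<k. Z l e) = 0"
        by (subst sum.swap) (simp add: Z0)
      also have "(\<Sum>e\<in>Bs. C e e \<bullet> v) = (\<Sum>e\<in>Bs. \<Sum>b\<in>Bs. (v \<bullet> b) * (e \<bullet> h b e))"
        unfolding C_def inner_sum_left
        by (intro sum.cong HOL.refl) (simp add: sym inner_commute[of v] mult.commute)
      also have "\<dots> = (\<Sum>b\<in>Bs. (v \<bullet> b) * (\<Sum>e\<in>Bs. e \<bullet> h b e))"
        by (subst sum.swap) (simp add: sum_distrib_left)
      finally have "(\<Sum>e\<in>Bs. e \<bullet> (e v* M)) = (\<Sum>b\<in>Bs. (v \<bullet> b) * (a b + (\<Sum>e\<in>Bs. e \<bullet> h b e)))"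
        by (simp add: distrib_left sum.distrib inner_commute mult.commute)
      then show ?thesis using lhs rhs by (simp add: R_def)
    qed
  qed
  have "R \<phi>s = 0"
  proof (cases "length \<phi>s = d")
    case True
    have "set \<phi>s \<subseteq> span B" unfolding \<open>span B = UNIV\<close> by (rule subset_UNIV)
    then show ?thesis
      using multilinear_vanishes_span[OF alternating_multilinear[OF altR] basis _ True] by blast
  qed (use multilinear_length alternating_multilinear altR in blast)
  then show ?thesis by (simp add: R_def v_def)
qed

end

text \<open>Along a curve \<open>c\<close> in the manifold the derivatives of the parametrization \<open>\<psi>\<close> give isomorphisms
  \<open>J t\<close> of the tangent spaces at \<open>c 0 = q\<close> and \<open>c t\<close>. By one-dimensionality of the top exterior
  power, the field at \<open>c t\<close> is proportional to the image of the field at \<open>q\<close> under \<open>J t\<close>. Since the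
  factor is not known to be differentiable a priori, proportionality is differentiated in
  cross-multiplied form.\<close>

lemma multivector_field_derivative:
  fixes M :: "(real^'n) set"
  assumes ch: "submanifold_chart M U V \<phi> \<psi> E" and q: "q \<in> M" "q \<in> U"
    and frame: "orthonormal_frame Bs d" and span: "span Bs = tangent_space (top_of_set M) q"
    and lin: "\<And>xs. linear (\<lambda>x. \<xi> x xs)"
    and ext: "\<And>p. p \<in> M \<Longrightarrow> \<xi> p \<in> ext_power d (tangent_space (top_of_set M) p)"
    and nz: "\<xi> q \<noteq> (\<lambda>xs. 0)"
  shows "\<exists>h. (\<forall>b\<in>Bs. \<forall>c\<in>Bs. h b c = h c b) \<and>
    (\<forall>b\<in>Bs. \<exists>a. \<forall>\<phi>s. length \<phi>s = d \<longrightarrow> \<xi> b \<phi>s = a * \<xi> q \<phi>s +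
        (\<Sum>l<d. \<xi> q (\<phi>s[l := (\<Sum>c\<in>Bs. ((\<phi>s ! l) \<bullet> h b c) *\<^sub>R c)])))"
proof -
  interpret submanifold_chart M U V \<phi> \<psi> E by (rule ch)
  interpret orthonormal_frame Bs d by (rule frame)
  define T where "T = \<xi> q"
  have T: "supported T" unfolding T_def using ext[OF q(1)] span by (simp add: supported_ext_power)
  obtain es where es: "set es = Bs" "length es = d" using enumerate_Bs by metis
  have Tes: "T es \<noteq> 0" using supported_eq_0[OF T es] nz T_def by auto
  define z0 where "z0 = \<phi> q"
  have z0: "z0 \<in> V" "z0 \<in> E" "\<psi> z0 = q" using q \<phi>_V \<phi>_E by (auto simp: z0_def)
  have D\<psi>_z0: "D\<psi> z0 (D\<phi> q x) = x" for x using D\<psi>_D\<phi>[OF q(2)] by (simp add: z0_def)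
  have D\<phi>_q: "D\<phi> q (D\<psi> z0 x) = x" for x using D\<phi>_D\<psi>[OF z0(1)] z0 by simp
  have span_E: "span Bs = D\<psi> z0 ` E" using span tangent_space_eq[OF q] by (simp add: z0_def)
  have E_span: "D\<phi> q ` span Bs = E" unfolding span_E by (simp add: image_image D\<phi>_q)
  define H where "H \<zeta> \<eta> = frechet_derivative (\<lambda>z. D\<psi> z \<zeta>) (at z0) \<eta>" for \<zeta> \<eta>
  have H_sym: "H \<zeta> \<eta> = H \<eta> \<zeta>" for \<zeta> \<eta>
    unfolding H_def by (rule mixed_derivatives_commute[OF open_V z0(1) C_k_\<psi>])
  have H_der: "((\<lambda>z. D\<psi> z \<zeta>) has_derivative H \<zeta>) (at z0)" for \<zeta>
  proof -
    have "C_k_on (Suc 0) V (\<lambda>z. D\<psi> z \<zeta>)" using C_k_\<psi>[of "Suc (Suc 0)"] by simp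
    from C_k_on_has_derivative[OF this z0(1)] show ?thesis by (simp add: H_def[abs_def])
  qed
  \<comment> \<open>The second derivative of \<open>\<psi>\<close> at \<open>z0\<close>, with
    directions at \<open>q\<close> brought into the chart by \<open>D\<phi> q\<close>.\<close>
  define h where "h b x = H (D\<phi> q x) (D\<phi> q b)" for b x
  have h_sym: "h b c = h c b" for b c unfolding h_def by (rule H_sym)
  have lin_h: "linear (h b)" for b
  proof -
    have "linear (\<lambda>x. H (D\<phi> q b) (D\<phi> q x))"
      using linear_compose[OF linear_D\<phi>[OF q(2)] has_derivative_linear[OF H_der]] by (simp add: o_def)
    then show ?thesis by (simp add: h_def[abs_def] H_sym[of _ "D\<phi> q b"])
  qed
  have adj: "(\<Sum>i\<in>Basis. (\<phi> \<bullet> f i) *\<^sub>R i) \<bullet> x = \<phi> \<bullet> f x" if "linear f" for f :: "real^'n \<Rightarrow> real^'n" and \<phi> x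
  proof -
    have "\<phi> \<bullet> f x = (\<Sum>i\<in>Basis. (x \<bullet> i) * (\<phi> \<bullet> f i))"
      by (rule linear_Basis_expansion) (use that in \<open>simp add: linear_iff inner_add_right\<close>)
    then show ?thesis by (simp add: inner_sum_left inner_commute[of x] mult.commute)
  qed
  have "\<exists>a. \<forall>\<phi>s. length \<phi>s = d \<longrightarrow> \<xi> b \<phi>s = a * \<xi> q \<phi>s +
        (\<Sum>l<d. \<xi> q (\<phi>s[l := (\<Sum>c\<in>Bs. ((\<phi>s ! l) \<bullet> h b c) *\<^sub>R c)]))" if b: "b \<in> Bs" for b
  proof -
    define \<eta> where "\<eta> = D\<phi> q b"
    have \<eta>: "\<eta> \<in> E" using b E_span span_base[of b Bs] by (auto simp: \<eta>_def)
    define l where "l t = z0 + t *\<^sub>R \<eta>" for t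
    have l0: "l 0 = z0" by (simp add: l_def)
    have l_der: "(l has_vector_derivative \<eta>) (at t)" for t
      unfolding l_def[abs_def] by (rule line_has_vector_derivative)
    have lE: "l t \<in> E" for t unfolding l_def using z0 \<eta> by (intro subspace_add[OF E] subspace_scale[OF E])
    define S where "S = l -` V"
    have S: "open S" "0 \<in> S"
      using open_V z0 unfolding S_def l_def[abs_def] by (auto intro!: open_vimage continuous_intros)
    define J where "J t x = D\<psi> (l t) (D\<phi> q x)" for t x
    \<comment> \<open>The adjoint of \<open>J t\<close>: as functionals take covectors, a
      multivector is transported by \<open>J t\<close> by applying \<open>Js t\<close> to its
      arguments.\<close>
    define Js where "Js t \<phi> = (\<Sum>i\<in>Basis. (\<phi> \<bullet> J t i) *\<^sub>R i)" for t \<phi>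
    define K where "K \<phi> = (\<Sum>i\<in>Basis. (\<phi> \<bullet> h b i) *\<^sub>R i)" for \<phi>
    have linJ: "linear (J t)" if "t \<in> S" for t
      using linear_compose[OF linear_D\<phi>[OF q(2)] linear_D\<psi>, of "l t"] that
      by (simp add: o_def J_def[abs_def] S_def)
    have Js_inner: "Js t \<phi> \<bullet> x = \<phi> \<bullet> J t x" if "t \<in> S" for t \<phi> x
      unfolding Js_def by (rule adj[OF linJ[OF that]])
    have K_inner: "K \<phi> \<bullet> x = \<phi> \<bullet> h b x" for \<phi> x
      unfolding K_def by (rule adj[OF lin_h])
    have Js0: "Js 0 \<phi> = \<phi>" for \<phi>
      by (simp add: Js_def J_def l0 D\<psi>_z0 euclidean_representation)
    have "((\<lambda>t. J t x) has_vector_derivative h b x) (at 0)" for x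
    proof -
      have "((\<lambda>z. D\<psi> z (D\<phi> q x)) has_derivative H (D\<phi> q x)) (at (l 0))"
        using H_der l0 by simp
      from vector_derivative_diff_chain_within[OF l_der[of 0] has_derivative_at_withinI[OF this]]
      show ?thesis by (simp add: o_def J_def[abs_def] h_def \<eta>_def)
    qed
    then have Js_der: "((\<lambda>t. Js t \<phi>) has_vector_derivative K \<phi>) (at 0)" for \<phi>
      unfolding Js_def K_def
      by (intro has_vector_derivative_sum
          bounded_linear.has_vector_derivative[where f = "\<lambda>y. (\<phi> \<bullet> y) *\<^sub>R _"]
          bounded_linear_compose[OF bounded_linear_scaleR_left bounded_linear_inner_right])
    define D where "D \<phi>s = (\<Sum>l<d. T (\<phi>s[l := K (\<phi>s ! l)]))" for \<phi>s
    have g: "((\<lambda>t. T (map (Js t) \<phi>s)) has_real_derivative D \<phi>s) (at 0)" if "length \<phi>s = d" for \<phi>s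
    proof -
      have "map (Js 0) \<phi>s = \<phi>s" by (simp add: Js0 map_idI)
      then show ?thesis
        using multilinear_has_real_derivative[where J = Js and J' = K, OF supported_multilinear[OF T] that Js_der] by (simp add: D_def)
    qed
    have f: "((\<lambda>t. \<xi> (\<psi> (l t)) \<phi>s) has_real_derivative \<xi> b \<phi>s) (at 0)" for \<phi>s
    proof -
      have "(\<psi> has_derivative D\<psi> z0) (at (l 0))" using der_\<psi>[OF z0(1)] l0 by simp
      from vector_derivative_diff_chain_within[OF l_der[of 0] has_derivative_at_withinI[OF this]]
      have "((\<lambda>t. \<psi> (l t)) has_vector_derivative b) (at 0)" by (simp add: o_def \<eta>_def D\<psi>_z0)
      from bounded_linear.has_vector_derivative[OF _ this, of "\<lambda>x. \<xi> x \<phi>s"] show ?thesis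
        using lin[of \<phi>s] by (simp add: linear_conv_bounded_linear has_real_derivative_iff_has_vector_derivative)
    qed
    have cross: "\<xi> (\<psi> (l t)) \<phi>s * T (map (Js t) es) = \<xi> (\<psi> (l t)) es * T (map (Js t) \<phi>s)"
      if t: "t \<in> S" for t \<phi>s
    proof -
      have lt: "l t \<in> V" using t by (simp add: S_def)
      have p: "\<psi> (l t) \<in> M" using \<psi>_M[OF lt lE] .
      have "tangent_space (top_of_set M) (\<psi> (l t)) = D\<psi> (l t) ` E"
        using tangent_space_eq[OF p \<psi>_U[OF lt]] lt by simp
      also have "\<dots> = J t ` span Bs" unfolding E_span[symmetric] J_def by (simp add: image_image)
      finally have "\<xi> (\<psi> (l t)) \<in> ext_power d (J t ` span Bs)" using ext[OF p] by simp
      then obtain T' where T': "T' \<in> ext_power d (span Bs)" "\<xi> (\<psi> (l t)) = (\<lambda>xs. T' (map (Js t) xs))"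
        using ext_power_image[of "\<xi> (\<psi> (l t))" d "J t" "span Bs" "Js t"] Js_inner[OF t] by blast
      have proportional: "T' xs = (T' es / T es) * T xs" for xs
        using supported_proportional[OF supported_ext_power[OF T'(1)] T es, of xs] Tes
        by (simp add: field_simps)
      have "T' xs * T ys = T' ys * T xs" for xs ys
        unfolding proportional[of xs] proportional[of ys] by simp
      then show ?thesis by (simp add: T'(2))
    qed
    have key: "\<xi> b \<phi>s * T es + D es * T \<phi>s = \<xi> b es * T \<phi>s + D \<phi>s * T es" if len: "length \<phi>s = d" for \<phi>s
    proof -
      have id: "map (Js 0) xs = xs" for xs by (simp add: Js0 map_idI)
      have "((\<lambda>t. \<xi> (\<psi> (l t)) \<phi>s * T (map (Js t) es)) has_real_derivative
          \<xi> b \<phi>s * T (map (Js 0) es) + D es * \<xi> (\<psi> (l 0)) \<phi>s) (at 0)"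
        by (rule DERIV_mult[OF f g[OF es(2)]])
      then have 1: "((\<lambda>t. \<xi> (\<psi> (l t)) \<phi>s * T (map (Js t) es)) has_real_derivative
          \<xi> b \<phi>s * T es + D es * T \<phi>s) (at 0)" by (simp add: id l0 z0 T_def)
      have "((\<lambda>t. \<xi> (\<psi> (l t)) es * T (map (Js t) \<phi>s)) has_real_derivative
          \<xi> b es * T (map (Js 0) \<phi>s) + D \<phi>s * \<xi> (\<psi> (l 0)) es) (at 0)"
        by (rule DERIV_mult[OF f g[OF len]])
      then have 2: "((\<lambda>t. \<xi> (\<psi> (l t)) es * T (map (Js t) \<phi>s)) has_real_derivative
          \<xi> b es * T \<phi>s + D \<phi>s * T es) (at 0)" by (simp add: id l0 z0 T_def)
      have "((\<lambda>t. \<xi> (\<psi> (l t)) es * T (map (Js t) \<phi>s)) has_real_derivative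
          \<xi> b \<phi>s * T es + D es * T \<phi>s) (at 0)"
        by (rule has_field_derivative_transform_within_open[OF 1 S]) (rule cross)
      from DERIV_unique[OF this 2] show ?thesis .
    qed
    have "T (\<phi>s[l := K (\<phi>s ! l)]) = T (\<phi>s[l := (\<Sum>c\<in>Bs. ((\<phi>s ! l) \<bullet> h b c) *\<^sub>R c)])"
      if "length \<phi>s = d" "l < d" for \<phi>s l
      using supported_slot[OF T that, of "K (\<phi>s ! l)"] by (simp add: pr_def K_inner)
    then have D: "D \<phi>s = (\<Sum>l<d. T (\<phi>s[l := (\<Sum>c\<in>Bs. ((\<phi>s ! l) \<bullet> h b c) *\<^sub>R c)]))"
      if "length \<phi>s = d" for \<phi>s
      using that by (simp add: D_def)
    have "\<xi> b \<phi>s = ((\<xi> b es - D es) / T es) * T \<phi>s + D \<phi>s" if "length \<phi>s = d" for \<phi>s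
      using key[OF that] Tes by (simp add: field_simps)
    then show ?thesis
      using D unfolding T_def by (intro exI[of _ "(\<xi> b es - D es) / \<xi> q es"]) simp
  qed
  then show ?thesis using h_sym by blast
qed

text \<open>Invariance of \<xi> written without inverses, so that it passes to products by
  substitution. For invertible \<open>g\<close> it implies the form used by
  \<open>evolution_act\<close>, through \<open>multivector_act_invariant\<close>.\<close>

definition invariant_under :: "real^'n^'n \<Rightarrow> (real^'n \<Rightarrow> (real^'n) list \<Rightarrow> real) \<Rightarrow> bool" where
  "invariant_under g \<xi> \<longleftrightarrow> (\<forall>p \<phi>s. \<xi> (g *v p) \<phi>s = \<xi> p (map (\<lambda>\<phi>. \<phi> v* g) \<phi>s))"

lemma invariant_under_mult:
  "invariant_under g \<xi> \<Longrightarrow> invariant_under h \<xi> \<Longrightarrow> invariant_under (g ** h) \<xi>"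
  by (simp add: invariant_under_def o_def vector_matrix_mul_assoc flip: matrix_vector_mul_assoc)

lemma multivector_act_invariant:
  assumes "invariant_under g \<xi>" "invertible g"
  shows "multivector_act g (\<xi> (matrix_inv g *v p)) = \<xi> p"
proof
  fix \<phi>s
  have "g *v (matrix_inv g *v p) = p"
    using assms(2) by (simp add: matrix_vector_mul_assoc matrix_inv_mult)
  then show "multivector_act g (\<xi> (matrix_inv g *v p)) \<phi>s = \<xi> p \<phi>s"
    using assms(1) unfolding invariant_under_def multivector_act_def by metis
qed

text \<open>Move the point by \<open>mexp (t *\<^sub>R X)\<close> and the covectors by the inverse:
  the value of \<xi> then has derivative 0, since \<open>inf\<close> balances the change of the
  point against that of the covectors.\<close>

lemma infinitesimal_invariance_imp_invariant_under_mexp: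
  fixes X :: "real^'n^'n"
  assumes lin: "\<And>xs. linear (\<lambda>x. \<xi> x xs)" and multi: "\<And>x. multilinear d (\<xi> x)"
    and inf: "\<And>x \<phi>s. \<xi> (X *v x) \<phi>s = (\<Sum>l<d. \<xi> x (\<phi>s[l := (\<phi>s ! l) v* X]))"
  shows "invariant_under (mexp X) \<xi>"
  unfolding invariant_under_def
proof (intro allI)
  fix p \<phi>s
  define y where "y t = mexp (t *\<^sub>R X) *v p" for t
  define J where "J t \<phi> = \<phi> v* mexp (t *\<^sub>R (- X))" for t \<phi>
  have y': "((\<lambda>t. y t \<bullet> b) has_real_derivative (X *v y t) \<bullet> b) (at t)" for b t
    using bounded_linear.has_vector_derivative[OF bounded_linear_inner_left mexp_flow_has_vector_derivative[of X p t]]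
    by (simp add: y_def has_real_derivative_iff_has_vector_derivative)
  have J': "((\<lambda>t. J t \<phi>) has_vector_derivative - (J t \<phi> v* X)) (at t)" for t \<phi>
  proof -
    have bl: "bounded_linear (\<lambda>M :: real^'n^'n. \<phi> v* M)"
      by (simp add: linear_conv_bounded_linear[symmetric] linear_iff vector_matrix_mult_add_rdistrib vector_scaleR_matrix_ac)
    have "((\<lambda>t. \<phi> v* mexp (t *\<^sub>R (- X))) has_vector_derivative \<phi> v* ((- X) ** mexp (t *\<^sub>R (- X)))) (at t)"
      by (rule bounded_linear.has_vector_derivative[OF bl mexp_has_vector_derivative])
    moreover have "\<phi> v* ((- X) ** mexp (t *\<^sub>R (- X))) = - (J t \<phi> v* X)"
      unfolding mexp_commute matrix_mult.minus_right
      by (simp add: J_def linear_neg[OF bounded_linear.linear[OF bl]] vector_matrix_mul_assoc)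
    ultimately show ?thesis by (simp add: J_def)
  qed
  have const: "\<xi> (y 1) (map (J 1) \<phi>s) = \<xi> (y 0) (map (J 0) \<phi>s)" if len: "length \<phi>s = d" for \<phi>s
  proof -
    define u where "u t = \<xi> (y t) (map (J t) \<phi>s)" for t
    have ex: "\<xi> x xs = (\<Sum>b\<in>Basis. (x \<bullet> b) * \<xi> b xs)" for x xs
      by (rule linear_Basis_expansion[OF lin])
    have "(u has_real_derivative 0) (at t)" for t
    proof -
      define \<psi>s where "\<psi>s = map (J t) \<phi>s"
      define D where "D x = (\<Sum>l<d. \<xi> x (\<psi>s[l := - ((\<psi>s ! l) v* X)]))" for x
      have DJ: "((\<lambda>t. \<xi> b (map (J t) \<phi>s)) has_real_derivative D b) (at t)" for b
      proof -
        have "(\<Sum>l<d. \<xi> b ((map (J t) \<phi>s)[l := - (J t (\<phi>s ! l) v* X)])) = D b"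
          unfolding D_def \<psi>s_def using len by (intro sum.cong) auto
        then show ?thesis
          using multilinear_has_real_derivative[where T = "\<xi> b" and J = J
              and J' = "\<lambda>\<phi>. - (J t \<phi> v* X)", OF multi len J']
          by simp
      qed
      have "((\<lambda>t. \<Sum>b\<in>Basis. (y t \<bullet> b) * \<xi> b (map (J t) \<phi>s)) has_real_derivative
          (\<Sum>b\<in>Basis. ((X *v y t) \<bullet> b) * \<xi> b \<psi>s + D b * (y t \<bullet> b))) (at t)"
        unfolding \<psi>s_def by (intro DERIV_sum DERIV_mult y' DJ[unfolded \<psi>s_def])
      moreover have "(\<Sum>b\<in>Basis. ((X *v y t) \<bullet> b) * \<xi> b \<psi>s + D b * (y t \<bullet> b)) = \<xi> (X *v y t) \<psi>s + D (y t)"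
      proof -
        have "(\<Sum>b\<in>Basis. D b * (y t \<bullet> b)) = D (y t)"
        proof -
          have "(\<Sum>b\<in>Basis. D b * (y t \<bullet> b)) =
              (\<Sum>l<d. \<Sum>b\<in>Basis. (y t \<bullet> b) * \<xi> b (\<psi>s[l := - ((\<psi>s ! l) v* X)]))"
            unfolding D_def sum_distrib_right by (subst sum.swap) (simp add: mult.commute)
          then show ?thesis by (simp only: ex[symmetric] D_def)
        qed
        then show ?thesis by (simp add: sum.distrib ex[symmetric])
      qed
      moreover have "D x = - \<xi> (X *v x) \<psi>s" for x
      proof -
        have "\<xi> x (\<psi>s[l := - z]) = - \<xi> x (\<psi>s[l := z])" if "l < d" for l z
          using linear_neg[OF multilinear_slot[OF multi, of \<psi>s l]] that len by (simp add: \<psi>s_def)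
        then show ?thesis by (simp add: D_def inf sum_negf)
      qed
      ultimately show ?thesis by (simp add: u_def[abs_def] ex[symmetric])
    qed
    then show ?thesis
      using DERIV_isconst_all[of u 1 0] unfolding u_def by blast
  qed
  show "\<xi> (mexp X *v p) \<phi>s = \<xi> p (map (\<lambda>\<phi>. \<phi> v* mexp X) \<phi>s)"
  proof (cases "length \<phi>s = d")
    case True
    \<comment> \<open>Starting from covectors already multiplied by \<open>mexp X\<close> cancels
      the inverse in \<open>J 1\<close>, so constancy between times 0 and 1 is the claim.\<close>
    have "J 1 (\<phi> v* mexp X) = \<phi>" "J 0 \<phi> = \<phi>" for \<phi>
      by (simp_all add: J_def vector_matrix_mul_assoc mexp_minus)
    then have maps: "map (J 1) (map (\<lambda>\<phi>. \<phi> v* mexp X) \<phi>s) = \<phi>s"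
      "map (J 0) (map (\<lambda>\<phi>. \<phi> v* mexp X) \<phi>s) = map (\<lambda>\<phi>. \<phi> v* mexp X) \<phi>s"
      by (simp_all add: map_idI o_def)
    have "length (map (\<lambda>\<phi>. \<phi> v* mexp X) \<phi>s) = d" using True by simp
    from const[OF this, unfolded maps] show ?thesis by (simp add: y_def)
  next
    case False
    then show ?thesis using multilinear_length[OF multi] by simp
  qed
qed

lemma form_act_ext_power: "\<alpha> \<in> ext_power k UNIV \<Longrightarrow> form_act g \<alpha> \<in> ext_power k UNIV"
proof (induction rule: ext_power_induct)
  case zero
  have "form_act g (\<lambda>xs. 0) = 0" by (simp add: form_act_def zero_fun_def)
  then show ?case unfolding ext_power_def by (simp only: span_zero)
next
  case (step c vs T)
  have "(matrix_inv g *v x) \<bullet> v = x \<bullet> (v v* matrix_inv g)" for x v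
    by (metis dot_lmul_matrix inner_commute)
  then have "wedge vs (map (\<lambda>v. matrix_inv g *v v) xs) = wedge (map (\<lambda>v. v v* matrix_inv g) vs) xs" for xs
    by (rule wedge_adjoint)
  then have "form_act g (\<lambda>xs. c * wedge vs xs + T xs) =
      c *\<^sub>R wedge (map (\<lambda>v. v v* matrix_inv g) vs) + form_act g T"
    by (simp add: form_act_def plus_fun_def scaleR_fun_def)
  moreover have "wedge (map (\<lambda>v. v v* matrix_inv g) vs) \<in> ext_power k UNIV"
    using step by (intro wedge_in_ext_power) auto
  then have "c *\<^sub>R wedge (map (\<lambda>v. v v* matrix_inv g) vs) + form_act g T \<in> ext_power k UNIV"
    using step unfolding ext_power_def by (intro span_add span_scale)
  ultimately show ?case by (simp only:)
qed

section \<open>Application to linear evolution data\<close>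

locale evolution_data =
  fixes m :: nat and P :: "(real^'n) set" and \<xi> :: "real^'n \<Rightarrow> (real^'n) list \<Rightarrow> real"
  assumes m: "2 \<le> m" and data: "linear_evolution_data m P \<xi>"
begin

text \<open>The image of \<open>L\<close> is taken as the candidate Lie algebra, so surjectivity of
  \<open>L\<close> amounts to \<open>lie_algebra_lie_top\<close>.\<close>

definition A :: "(real^'n^'n) set" where "A = evolution_map m \<xi> ` ext_power (m - 2) UNIV"

lemma m_Suc: "m - 1 = Suc (m - 2)"
  using m by simp

lemma submanifold: "smooth_submanifold (m - 1) P"
  and tangential: "\<And>p. p \<in> P \<Longrightarrow> \<xi> p \<in> ext_power (m - 1) (tangent_space (top_of_set P) p)"
  and nonzero: "\<And>p. p \<in> P \<Longrightarrow> \<xi> p \<noteq> (\<lambda>xs. 0)"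
  and spanning: "\<And>S. subspace S \<Longrightarrow> P \<subseteq> S \<Longrightarrow> S = UNIV"
  using data unfolding linear_evolution_data_def zero_fun_def by blast+

lemma linear_\<xi>: "linear (\<lambda>x. \<xi> x xs)"
  using data unfolding linear_evolution_data_def
  by (simp add: linear_iff plus_fun_def scaleR_fun_def)

lemma alternating_\<xi>: "alternating (m - 1) (\<xi> x)"
  using data ext_power_alternating unfolding linear_evolution_data_def by blast

lemma multilinear_\<xi>: "multilinear (m - 1) (\<xi> x)" "multilinear (Suc (m - 2)) (\<xi> x)"
  using alternating_multilinear[OF alternating_\<xi>] m_Suc by auto

lemma evolution_map_vector: "evolution_map m \<xi> \<alpha> *v p = contraction (m - 2) (\<xi> p) \<alpha>"
proof -
  have "linear (\<lambda>p. contraction (m - 2) (\<xi> p) \<alpha>)"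
    using linear_\<xi> by (simp add: linear_iff contraction_def vec_eq_iff sum.distrib
        sum_distrib_left add_divide_distrib algebra_simps)
  then show ?thesis by (simp add: evolution_map_def matrix_works)
qed

lemma linear_evolution_map: "linear (evolution_map m \<xi>)"
proof -
  have "contraction (m - 2) T (\<alpha> + \<beta>) = contraction (m - 2) T \<alpha> + contraction (m - 2) T \<beta>"
    "contraction (m - 2) T (c *\<^sub>R \<alpha>) = c *\<^sub>R contraction (m - 2) T \<alpha>"
    for T \<alpha> \<beta> :: "(real^'n) list \<Rightarrow> real" and c
    by (simp_all add: contraction_def vec_eq_iff plus_fun_def scaleR_fun_def sum.distrib
        sum_distrib_left algebra_simps)
  then show ?thesis
    by (simp add: linear_iff matrix_eq evolution_map_vector matrix_vector_mult_add_rdistrib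
        flip: scaleR_matrix_vector_assoc)
qed

lemma subspace_A: "subspace A"
  unfolding A_def ext_power_def
  by (intro linear_subspace_image linear_evolution_map subspace_span)

lemma tangent_frame:
  assumes q: "q \<in> P"
  obtains U V \<phi> \<psi> E Bs where "submanifold_chart P U V \<phi> \<psi> E" "q \<in> U"
    "orthonormal_frame Bs (m - 1)" "span Bs = tangent_space (top_of_set P) q"
proof -
  obtain U V \<phi> \<psi> E where ch: "submanifold_chart P U V \<phi> \<psi> E" "q \<in> U" "dim E = m - 1"
    using smooth_submanifold_chart[OF submanifold q] by metis
  interpret submanifold_chart P U V \<phi> \<psi> E by (rule ch)
  obtain Bs where Bs: "pairwise orthogonal Bs" "\<And>x. x \<in> Bs \<Longrightarrow> norm x = 1" "independent Bs"
    "card Bs = dim (tangent_space (top_of_set P) q)" "span Bs = tangent_space (top_of_set P) q"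
    using orthonormal_basis_subspace[OF subspace_tangent_space[OF q ch(2)]] by metis
  have "orthonormal_frame Bs (m - 1)"
  proof
    show "finite Bs" using Bs(3) by (rule independent_imp_finite)
    show "card Bs = m - 1" using Bs(4) dim_tangent_space[OF q ch(2)] ch(3) by simp
    show "b \<bullet> c = (if b = c then 1 else 0)" if "b \<in> Bs" "c \<in> Bs" for b c
      using Bs(1,2) that by (auto simp: pairwise_def orthogonal_def norm_eq_1)
  qed
  then show ?thesis using that ch(1,2) Bs(5) by blast
qed

text \<open>Equality carries two facts for \<open>lie_orbit\<close>: one inclusion is tangency of
  the fields \<open>L \<alpha>\<close> to \<open>P\<close>, the other is infinitesimal
  transitivity.\<close>

lemma contraction_tangent_space:
  assumes q: "q \<in> P"
  shows "(\<lambda>\<alpha>. contraction (m - 2) (\<xi> q) \<alpha>) ` ext_power (m - 2) UNIV = tangent_space (top_of_set P) q"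
proof -
  obtain U V \<phi> \<psi> E Bs where fr: "submanifold_chart P U V \<phi> \<psi> E" "q \<in> U"
    "orthonormal_frame Bs (m - 1)" "span Bs = tangent_space (top_of_set P) q"
    using tangent_frame[OF q] .
  interpret orthonormal_frame Bs "m - 1" by (rule fr)
  show ?thesis
    using contraction_onto[OF _ m_Suc nonzero[OF q]] supported_ext_power tangential[OF q] fr(4) by simp
qed

lemma infinitesimal_invariance_P:
  assumes q: "q \<in> P" and \<alpha>: "\<alpha> \<in> ext_power (m - 2) UNIV"
  shows "\<xi> (evolution_map m \<xi> \<alpha> *v q) \<phi>s =
    (\<Sum>l<m - 1. \<xi> q (\<phi>s[l := (\<phi>s ! l) v* evolution_map m \<xi> \<alpha>]))"
proof -
  obtain U V \<phi> \<psi> E Bs where fr: "submanifold_chart P U V \<phi> \<psi> E" "q \<in> U"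
    "orthonormal_frame Bs (m - 1)" "span Bs = tangent_space (top_of_set P) q"
    using tangent_frame[OF q] .
  interpret orthonormal_frame Bs "m - 1" by (rule fr)
  obtain h where h: "(\<forall>b\<in>Bs. \<forall>c\<in>Bs. h b c = h c b) \<and>
      (\<forall>b\<in>Bs. \<exists>a. \<forall>\<phi>s. length \<phi>s = m - 1 \<longrightarrow> \<xi> b \<phi>s = a * \<xi> q \<phi>s +
        (\<Sum>l<m - 1. \<xi> q (\<phi>s[l := (\<Sum>c\<in>Bs. ((\<phi>s ! l) \<bullet> h b c) *\<^sub>R c)])))"
    using multivector_field_derivative[OF fr(1) q fr(2-4) linear_\<xi> tangential nonzero[OF q]]
    by (rule exE)
  from bchoice[OF conjunct2[OF h]]
  obtain a where a: "\<forall>b\<in>Bs. \<forall>\<phi>s. length \<phi>s = m - 1 \<longrightarrow> \<xi> b \<phi>s = a b * \<xi> q \<phi>s +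
        (\<Sum>l<m - 1. \<xi> q (\<phi>s[l := (\<Sum>c\<in>Bs. ((\<phi>s ! l) \<bullet> h b c) *\<^sub>R c)]))"
    by (rule exE)
  have "supported (\<xi> q)" using supported_ext_power tangential[OF q] fr(4) by simp
  then have "\<xi> (contraction (m - 2) (\<xi> q) \<alpha>) \<phi>s =
      (\<Sum>l<m - 1. \<xi> q (\<phi>s[l := (\<phi>s ! l) v* evolution_map m \<xi> \<alpha>]))"
  proof (rule infinitesimal_invariance[OF m_Suc _ nonzero[OF q] \<alpha> linear_\<xi> alternating_\<xi>])
    show "h b c = h c b" if "b \<in> Bs" "c \<in> Bs" for b c using conjunct1[OF h] that by blast
    show "\<xi> b \<phi>s = a b * \<xi> q \<phi>s +
        (\<Sum>l<m - 1. \<xi> q (\<phi>s[l := (\<Sum>c\<in>Bs. ((\<phi>s ! l) \<bullet> h b c) *\<^sub>R c)]))"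
      if "b \<in> Bs" "length \<phi>s = m - 1" for b \<phi>s using a that by blast
  qed (rule evolution_map_vector)
  then show ?thesis by (simp add: evolution_map_vector)
qed

lemma infinitesimal_invariance_everywhere:
  assumes \<alpha>: "\<alpha> \<in> ext_power (m - 2) UNIV"
  shows "\<xi> (evolution_map m \<xi> \<alpha> *v x) \<phi>s =
    (\<Sum>l<m - 1. \<xi> x (\<phi>s[l := (\<phi>s ! l) v* evolution_map m \<xi> \<alpha>]))"
proof -
  define X where "X = evolution_map m \<xi> \<alpha>"
  define S where "S = {x. \<forall>\<phi>s. \<xi> (X *v x) \<phi>s = (\<Sum>l<m - 1. \<xi> x (\<phi>s[l := (\<phi>s ! l) v* X]))}"
  have "subspace S"
    unfolding S_def subspace_def using linear_\<xi>
    by (auto simp: linear_iff linear_0 matrix_vector_right_distrib matrix_vector.scaleR_right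
        sum.distrib sum_distrib_left linear_0[OF linear_\<xi>])
  moreover have "P \<subseteq> S"
    using infinitesimal_invariance_P[OF _ \<alpha>] by (auto simp: S_def X_def)
  ultimately have "x \<in> S" using spanning by blast
  then show ?thesis by (simp add: S_def X_def)
qed

lemma mexp_invariant: "X \<in> A \<Longrightarrow> invariant_under (mexp X) \<xi>"
  unfolding A_def
  by (auto intro!: infinitesimal_invariance_imp_invariant_under_mexp[OF linear_\<xi> multilinear_\<xi>(1)]
      infinitesimal_invariance_everywhere)

lemma evolution_map_equivariant:
  assumes g: "invariant_under g \<xi>" "invertible g" and \<alpha>: "\<alpha> \<in> ext_power (m - 2) UNIV"
  shows "evolution_map m \<xi> (form_act g \<alpha>) = g ** evolution_map m \<xi> \<alpha> ** matrix_inv g"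
proof -
  have "contraction (m - 2) (\<xi> p) (form_act g \<alpha>) = g *v contraction (m - 2) (\<xi> (matrix_inv g *v p)) \<alpha>" for p
    using contraction_equivariant[OF multilinear_\<xi>(2) alternating_multilinear[OF ext_power_alternating[OF \<alpha>]] g(2),
        of "matrix_inv g *v p"]
    by (simp add: multivector_act_invariant[OF g])
  then show ?thesis
    by (simp add: matrix_eq evolution_map_vector flip: matrix_vector_mul_assoc)
qed

lemma A_Ad:
  assumes "X \<in> A" "Y \<in> A"
  shows "mexp X ** Y ** mexp (- X) \<in> A"
proof -
  obtain \<alpha> where \<alpha>: "\<alpha> \<in> ext_power (m - 2) UNIV" "Y = evolution_map m \<xi> \<alpha>" using assms(2) by (auto simp: A_def)
  have "mexp X ** Y ** mexp (- X) = evolution_map m \<xi> (form_act (mexp X) \<alpha>)"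
    using evolution_map_equivariant[OF mexp_invariant[OF assms(1)] _ \<alpha>(1)] \<alpha>(2)
    by (simp add: matrix_inv_mexp invertibleI[OF mexp_minus(1)])
  then show ?thesis using form_act_ext_power[OF \<alpha>(1)] by (simp add: A_def)
qed

lemma lie_orbit_exists: obtains bs where "lie_orbit bs A P (m - 1)"
proof -
  obtain B where B: "pairwise orthogonal B" "\<And>x. x \<in> B \<Longrightarrow> norm x = 1" "independent B" "span B = A"
    using orthonormal_basis_subspace[OF subspace_A] by metis
  obtain bs where bs: "set bs = B" "distinct bs"
    using finite_distinct_list[OF independent_imp_finite[OF B(3)]] by blast
  have "lie_orbit bs A P (m - 1)"
  proof
    show "b \<bullet> c = (if b = c then 1 else 0)" if "b \<in> set bs" "c \<in> set bs" for b c
      using B(1,2) that bs by (auto simp: pairwise_def orthogonal_def norm_eq_1)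
    show "X *v p \<in> tangent_space (top_of_set P) p" if "X \<in> A" "p \<in> P" for X p
      using that contraction_tangent_space[OF that(2)] by (auto simp: A_def evolution_map_vector)
    show "\<exists>X\<in>A. X *v p = v" if "p \<in> P" "v \<in> tangent_space (top_of_set P) p" for v p
    proof -
      have "v \<in> (\<lambda>\<alpha>. contraction (m - 2) (\<xi> p) \<alpha>) ` ext_power (m - 2) UNIV"
        using that contraction_tangent_space[OF that(1)] by simp
      then show ?thesis by (auto simp: A_def evolution_map_vector)
    qed
  qed (use bs B A_Ad submanifold in auto)
  then show ?thesis by (rule that)
qed

end

theorem theorem4p9:
  fixes P :: "(real^'n) set" and \<xi> :: "real^'n \<Rightarrow> (real^'n) list \<Rightarrow> real" and m :: nat
  assumes "2 \<le> m" and "m \<le> CARD('n)"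
    and "linear_evolution_data m P \<xi>"
    and "connected P"
  shows "\<exists>G :: (real^'n^'n) topology.
    GL_lie_subgroup G \<and> connected_space G \<and>
    (\<exists>x Orb. quotient_map G Orb (\<lambda>g. g *v x) \<and> openin Orb P) \<and>
    (\<forall>g\<in>topspace G. evolution_act g \<xi> = \<xi>) \<and>
    (\<exists>L :: ((real^'n) list \<Rightarrow> real) \<Rightarrow> real^'n^'n.
       L = evolution_map m \<xi> \<and> linear L \<and>
       L ` ext_power (m - 2) UNIV = lie_algebra G \<and>
       (\<forall>g\<in>topspace G. \<forall>\<alpha>\<in>ext_power (m - 2) UNIV.
          L (form_act g \<alpha>) = g ** L \<alpha> ** matrix_inv g))"
proof -
  interpret evolution_data m P \<xi> by unfold_locales (rule assms)+
  obtain bs where "lie_orbit bs A P (m - 1)" by (rule lie_orbit_exists)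
  then interpret lie_orbit bs A P "m - 1" .
  have inv: "invariant_under g \<xi>" if "g \<in> carrier" for g
    using that
  proof (induction rule: carrier_induct)
    case one
    show ?case by (simp add: invariant_under_def)
  next
    case (step X g)
    then show ?case by (intro invariant_under_mult mexp_invariant)
  qed
  have act: "evolution_act g \<xi> = \<xi>" if "g \<in> carrier" for g
    using multivector_act_invariant[OF inv[OF that] carrier_invertible[OF that]]
    by (simp add: evolution_act_def)
  \<comment> \<open>An orbit needs a base point. It comes from the spanning condition: an empty
    \<open>P\<close> would lie in the proper subspace \<open>{0}\<close>.\<close>
  have "P \<noteq> {}"
  proof
    assume "P = {}"
    then have "(UNIV :: (real^'n) set) = {0}" using spanning[of "{0}"] by simp
    then have "(axis undefined 1 :: real^'n) = 0" by blast
    then show False by (simp add: axis_eq_0_iff)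
  qed
  then obtain x where "x \<in> P" by blast
  then obtain Orb where "quotient_map lie_top Orb (\<lambda>g. g *v x)" "openin Orb P"
    using open_in_orbit[OF \<open>connected P\<close>] by blast
  moreover have "evolution_map m \<xi> ` ext_power (m - 2) UNIV = lie_algebra lie_top"
    using lie_algebra_lie_top A_def by metis
  ultimately show ?thesis
    using GL_lie_subgroup_lie_top connected_space_lie_top act linear_evolution_map
      evolution_map_equivariant[OF inv carrier_invertible]
    by (intro exI[of _ lie_top]) auto
qed

end
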